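(* Let $n\ge4$ and $\mathbf{a} = (a_1, \dots, a_n) \in (\mathbb{N} \setminus \{0\})^n$. Let $\mathbf{k}$ be a field of characteristic $0$ and consider the Pham-Brieskorn ring $B_{\mathbf{k};\mathbf{a}} = B_{\mathbf{k};a_1,\dots,a_n} = \mathbf{k}[x_1,\dots,x_n]$. For each $i \in \{1,\dots,n\}$, let $\mathbf{a}(i) = (a_1,\dots,\widehat{a_i},\dots,a_n) \in (\mathbb{N}\setminus\{0\})^{n-1}$ (the tuple with $a_i$ omitted) and consider the corresponding ring $B_{\mathbf{k};\mathbf{a}(i)}$. Then the implication $$B_{\mathbf{k};\mathbf{a}(i)} \text{ is rigid} \implies (B_{\mathbf{k};\mathbf{a}})_{(x_i)} \text{ is rigid}$$ is valid for each $i \in \{1,\dots,n\}$ that satisfies $S(\mathbf{a}) \subseteq \{i\}$.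
   Context: For $m\ge3$, a field $\mathbf{k}$ of characteristic $0$ and positive integers $a_1,\dots,a_m$, $B_{\mathbf{k};a_1,\dots,a_m}=\mathbf{k}[X_1,\dots,X_m]/(X_1^{a_1}+\cdots+X_m^{a_m})$, which is a normal domain; $x_i$ denotes the image of $X_i$. It is $\mathbb{N}$-graded with $\mathbf{k}$ in degree $0$ and $x_i$ homogeneous of degree $L/a_i$, where $L=\mathrm{lcm}(a_1,\dots,a_m)$. For $\mathbf{a}=(a_1,\dots,a_n)$, let $L=\mathrm{lcm}(a_1,\dots,a_n)$, $L_j=\mathrm{lcm}\{a_k:1\le k\le n,\ k\neq j\}$, and $S(\mathbf{a})=\{j:1\le j\le n,\ L_j\neq L\}$. For a homogeneous element $f$ of a graded ring $B$, $B_{(f)}$ is the degree-$0$ subring of the graded localization $B_f$. A derivation $D:R\to R$ is locally nilpotent if for each $b\in R$ there is $m>0$ with $D^m(b)=0$; a ring is rigid if its only locally nilpotent derivation is $0$. *)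

theory Defs
  imports "HOL-Algebra.QuotRing" "HOL-Library.Poly_Mapping"
begin

definition derivation :: "('a, 'm) ring_scheme \<Rightarrow> ('a \<Rightarrow> 'a) \<Rightarrow> bool" where
  "derivation R D \<longleftrightarrow>
     D \<in> carrier R \<rightarrow> carrier R \<and>
     (\<forall>b\<in>carrier R. \<forall>c\<in>carrier R. D (b \<oplus>\<^bsub>R\<^esub> c) = D b \<oplus>\<^bsub>R\<^esub> D c) \<and>
     (\<forall>b\<in>carrier R. \<forall>c\<in>carrier R.
        D (b \<otimes>\<^bsub>R\<^esub> c) = (D b \<otimes>\<^bsub>R\<^esub> c) \<oplus>\<^bsub>R\<^esub> (b \<otimes>\<^bsub>R\<^esub> D c))"

definition locally_nilpotent :: "('a, 'm) ring_scheme \<Rightarrow> ('a \<Rightarrow> 'a) \<Rightarrow> bool" where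
  "locally_nilpotent R D \<longleftrightarrow> (\<forall>b\<in>carrier R. \<exists>m>0. (D ^^ m) b = \<zero>\<^bsub>R\<^esub>)"

definition rigid :: "('a, 'm) ring_scheme \<Rightarrow> bool" where
  "rigid R \<longleftrightarrow>
     (\<forall>D. derivation R D \<and> locally_nilpotent R D \<longrightarrow> (\<forall>b\<in>carrier R. D b = \<zero>\<^bsub>R\<^esub>))"

text \<open>
  Localization at a multiplicative set \<open>S\<close>: the pair \<open>(r, s)\<close> stands for the fraction \<open>r/s\<close>.
  As the operations on fractions respect \<open>frac_rel\<close>, each union below is a single class.
\<close>

definition frac_rel ::
    "('a, 'm) ring_scheme \<Rightarrow> 'a set \<Rightarrow> (('a \<times> 'a) \<times> ('a \<times> 'a)) set" where
  "frac_rel R S =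
     {((r, s), (r', s')). r \<in> carrier R \<and> s \<in> S \<and> r' \<in> carrier R \<and> s' \<in> S \<and>
        (\<exists>t\<in>S. t \<otimes>\<^bsub>R\<^esub> ((r \<otimes>\<^bsub>R\<^esub> s') \<ominus>\<^bsub>R\<^esub> (r' \<otimes>\<^bsub>R\<^esub> s)) = \<zero>\<^bsub>R\<^esub>)}"

definition fraction :: "('a, 'm) ring_scheme \<Rightarrow> 'a set \<Rightarrow> 'a \<Rightarrow> 'a \<Rightarrow> ('a \<times> 'a) set" where
  "fraction R S r s = frac_rel R S `` {(r, s)}"

definition localization :: "('a, 'm) ring_scheme \<Rightarrow> 'a set \<Rightarrow> ('a \<times> 'a) set ring" where
  "localization R S =
     \<lparr> carrier = (carrier R \<times> S) // frac_rel R S,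
       mult = (\<lambda>x y. \<Union>(r, s)\<in>x. \<Union>(r', s')\<in>y. fraction R S (r \<otimes>\<^bsub>R\<^esub> r') (s \<otimes>\<^bsub>R\<^esub> s')),
       one = fraction R S \<one>\<^bsub>R\<^esub> \<one>\<^bsub>R\<^esub>,
       zero = fraction R S \<zero>\<^bsub>R\<^esub> \<one>\<^bsub>R\<^esub>,
       add = (\<lambda>x y. \<Union>(r, s)\<in>x. \<Union>(r', s')\<in>y.
                fraction R S ((r \<otimes>\<^bsub>R\<^esub> s') \<oplus>\<^bsub>R\<^esub> (r' \<otimes>\<^bsub>R\<^esub> s)) (s \<otimes>\<^bsub>R\<^esub> s')) \<rparr>"

definition powers :: "('a, 'm) ring_scheme \<Rightarrow> 'a \<Rightarrow> 'a set" where
  "powers R f = range (\<lambda>k::nat. f [^]\<^bsub>R\<^esub> k)"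

text \<open>
  An \<open>\<nat>\<close>-grading is given by its family \<open>G\<close> of homogeneous components. The localization at a
  set \<open>S\<close> of homogeneous elements is \<open>\<int>\<close>-graded by \<open>deg (r/s) = deg r - deg s\<close>.
\<close>

definition localization_component ::
    "('a, 'm) ring_scheme \<Rightarrow> (nat \<Rightarrow> 'a set) \<Rightarrow> 'a set \<Rightarrow> int \<Rightarrow> ('a \<times> 'a) set set" where
  "localization_component R G S d =
     {fraction R S r s | r s i j. r \<in> G i \<and> s \<in> S \<and> s \<in> G j \<and> int i - int j = d}"

text \<open>\<open>B\<^sub>(\<^sub>f\<^sub>)\<close> for a homogeneous element \<open>f\<close>.\<close>

definition homogeneous_localization ::
    "('a, 'm) ring_scheme \<Rightarrow> (nat \<Rightarrow> 'a set) \<Rightarrow> 'a \<Rightarrow> ('a \<times> 'a) set ring" where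
  "homogeneous_localization R G f =
     (localization R (powers R f))
       \<lparr> carrier := localization_component R G (powers R f) 0 \<rparr>"

text \<open>
  The polynomial ring in the variables \<open>X\<^sub>j\<close>, \<open>j \<in> I\<close>: a polynomial maps monomials (finitely
  supported exponent vectors) to coefficients.
\<close>

definition mpoly_ring :: "'k::comm_ring_1 itself \<Rightarrow> 'v set \<Rightarrow> (('v \<Rightarrow>\<^sub>0 nat) \<Rightarrow>\<^sub>0 'k) ring" where
  "mpoly_ring _ I =
     \<lparr> carrier = {p. \<forall>m\<in>Poly_Mapping.keys p. Poly_Mapping.keys m \<subseteq> I},
       mult = (*), one = 1, zero = 0, add = (+) \<rparr>"

definition mpoly_var :: "'k::comm_ring_1 itself \<Rightarrow> 'v \<Rightarrow> ('v \<Rightarrow>\<^sub>0 nat) \<Rightarrow>\<^sub>0 'k" where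
  "mpoly_var _ j = Poly_Mapping.single (Poly_Mapping.single j 1) 1"

text \<open>
  The Pham-Brieskorn ring of a family \<open>(a\<^sub>j)\<close> of exponents indexed by a finite set \<open>I\<close>; omitting
  an entry of the family amounts to removing its index from \<open>I\<close>.
\<close>

definition pb_ideal ::
    "'k::field_char_0 itself \<Rightarrow> 'v set \<Rightarrow> ('v \<Rightarrow> nat) \<Rightarrow> (('v \<Rightarrow>\<^sub>0 nat) \<Rightarrow>\<^sub>0 'k) set" where
  "pb_ideal K I a = PIdl\<^bsub>mpoly_ring K I\<^esub> (\<Sum>j\<in>I. mpoly_var K j ^ a j)"

definition pb_ring ::
    "'k::field_char_0 itself \<Rightarrow> 'v set \<Rightarrow> ('v \<Rightarrow> nat) \<Rightarrow> (('v \<Rightarrow>\<^sub>0 nat) \<Rightarrow>\<^sub>0 'k) set ring" where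
  "pb_ring K I a = mpoly_ring K I Quot pb_ideal K I a"

definition pb_var ::
    "'k::field_char_0 itself \<Rightarrow> 'v set \<Rightarrow> ('v \<Rightarrow> nat) \<Rightarrow> 'v \<Rightarrow> (('v \<Rightarrow>\<^sub>0 nat) \<Rightarrow>\<^sub>0 'k) set" where
  "pb_var K I a j = pb_ideal K I a +>\<^bsub>mpoly_ring K I\<^esub> mpoly_var K j"

text \<open>The grading in which \<open>x\<^sub>j\<close> has degree \<open>L / a\<^sub>j\<close> (an exact division).\<close>

definition weighted_degree :: "'v set \<Rightarrow> ('v \<Rightarrow> nat) \<Rightarrow> ('v \<Rightarrow>\<^sub>0 nat) \<Rightarrow> nat" where
  "weighted_degree I a m = (\<Sum>j\<in>I. Poly_Mapping.lookup m j * (Lcm (a ` I) div a j))"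

definition pb_component ::
    "'k::field_char_0 itself \<Rightarrow> 'v set \<Rightarrow> ('v \<Rightarrow> nat) \<Rightarrow> nat
      \<Rightarrow> (('v \<Rightarrow>\<^sub>0 nat) \<Rightarrow>\<^sub>0 'k) set set" where
  "pb_component K I a d =
     {pb_ideal K I a +>\<^bsub>mpoly_ring K I\<^esub> p | p.
        p \<in> carrier (mpoly_ring K I) \<and> (\<forall>m\<in>Poly_Mapping.keys p. weighted_degree I a m = d)}"

definition lcm_omit :: "'v set \<Rightarrow> ('v \<Rightarrow> nat) \<Rightarrow> 'v \<Rightarrow> nat" where
  "lcm_omit I a j = Lcm (a ` (I - {j}))"

definition S_set :: "'v set \<Rightarrow> ('v \<Rightarrow> nat) \<Rightarrow> 'v set" where
  "S_set I a = {j \<in> I. lcm_omit I a j \<noteq> Lcm (a ` I)}"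

end

theory Submission
  imports Defs "HOL-Algebra.Algebraic_Closure_Type" "HOL-Computational_Algebra.Computational_Algebra"
    "HOL-Number_Theory.Cong"
begin

text \<open>
  Write \<open>f = x\<^sub>i\<close>, of degree \<open>d\<close>, and let \<open>D\<close> be a locally nilpotent derivation of \<open>B\<^sub>(\<^sub>f\<^sub>)\<close>. Since the
  \<open>d\<close>-th powers of the variables become degree-0 fractions after division by powers of \<open>f\<close>, \<open>D\<close> has
  a unique extension \<open>E\<close> to the field of fractions with \<open>E f = 0\<close>, and \<open>E x\<^sub>j\<close> has at most
  a power of \<open>x\<^sub>j\<close> in the denominator. The hypothesis on \<open>S(a)\<close> yields, for each \<open>j \<noteq> i\<close>, a monomial
  linear in \<open>x\<^sub>j\<close> and free of \<open>x\<^sub>i\<close> whose degree is divisible by \<open>d\<close>, so that this power can be traded for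
  powers of the other variables. As any two variables form a regular sequence, \<open>E\<close> maps \<open>B\<^sub>f\<close> to itself.
  It is locally nilpotent there, because \<open>b ^ d / f ^ deg b\<close> lies in \<open>B\<^sub>(\<^sub>f\<^sub>)\<close> for homogeneous \<open>b\<close> and
  its degree with respect to \<open>D\<close> drops by \<open>d\<close> when \<open>b\<close> is replaced by \<open>E b\<close>. If \<open>E \<noteq> 0\<close>, multiplying \<open>E\<close>
  by the right power of \<open>f\<close> gives a locally nilpotent derivation of \<open>B\<close> that is nonzero modulo \<open>f\<close>, hence
  a nonzero locally nilpotent derivation of the Pham-Brieskorn ring without \<open>x\<^sub>i\<close>.

  All of this is carried out inside one field containing \<open>B\<close>. Such a field, of Laurent series in \<open>x\<^sub>i\<close>, is
  obtained by solving the defining equation for a second variable: it becomes a root of a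
  power series in \<open>x\<^sub>i ^ a\<^sub>i\<close>, and \<open>1, x\<^sub>i, \<dots>, x\<^sub>i ^ (a\<^sub>i - 1)\<close> are independent over such series.
\<close>

section \<open>Polynomials and derivations along evaluations\<close>

text \<open>The extension of \<open>D\<close> is forced by logarithmic derivatives. On degree-0
  monomial fractions \<open>v\<close>, the quotient \<open>D v / v\<close> is additive in the
  exponent vector, and dividing by \<open>d\<close>, which characteristic 0 permits, gives a value
  for every variable once \<open>f\<close> is a constant. The defining polynomial has degree
  \<open>a i * d\<close>, a multiple of \<open>d\<close>, so the extension kills it.

  The obstacle is that the values \<open>u j\<close> obtained in this way are a priori only elements
  of the field. For each variable other than \<open>x_i\<close> a denominator of \<open>u j\<close>
  is found that avoids this variable, apart from powers of \<open>f\<close>; regularity then merges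
  these descriptions into a single one with a power of \<open>f\<close> as denominator. Here
  \<open>n \<ge> 4\<close> matters: regularity is tested after setting one variable to zero, and
  three variables must remain, since a sum of two powers may factor.

  The argument with \<open>d\<close>-th powers applies to homogeneous elements only. The derivation
  is therefore lifted to polynomials \<open>V j\<close> that are homogeneous, and nilpotency is
  proved on monomials first. The right power of \<open>f\<close> exists because a nonzero power
  series has a finite order.\<close>

type_synonym ('v, 'k) mpoly = "('v \<Rightarrow>\<^sub>0 nat) \<Rightarrow>\<^sub>0 'k"

definition mvar :: "'v \<Rightarrow> ('v, 'k::comm_ring_1) mpoly" where
  "mvar j = Poly_Mapping.single (Poly_Mapping.single j 1) 1"

abbreviation mconst :: "'k \<Rightarrow> ('v, 'k::comm_ring_1) mpoly" where
  "mconst c \<equiv> Poly_Mapping.single 0 c"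

definition polys :: "'v set \<Rightarrow> ('v, 'k::comm_ring_1) mpoly set" where
  "polys I = {p. \<forall>m\<in>Poly_Mapping.keys p. Poly_Mapping.keys m \<subseteq> I}"

lemma keys_add_nat:
  fixes m m' :: "'v \<Rightarrow>\<^sub>0 nat"
  shows "Poly_Mapping.keys (m + m') = Poly_Mapping.keys m \<union> Poly_Mapping.keys m'"
  by (auto simp: in_keys_iff lookup_add)

lemma polys_0 [simp]: "0 \<in> polys I"
  by (simp add: polys_def)

lemma polys_single: "Poly_Mapping.keys m \<subseteq> I \<Longrightarrow> Poly_Mapping.single m c \<in> polys I"
  by (simp add: polys_def)

lemma polys_mconst [simp]: "mconst c \<in> polys I"
  by (simp add: polys_single)

lemma polys_1 [simp]: "1 \<in> polys I"
  by (simp add: polys_def)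

lemma polys_mvar: "j \<in> I \<Longrightarrow> mvar j \<in> polys I"
  by (simp add: polys_single mvar_def)

lemma polys_add: "p \<in> polys I \<Longrightarrow> q \<in> polys I \<Longrightarrow> p + q \<in> polys I"
  using keys_add[of p q] by (auto simp: polys_def)

lemma polys_uminus: "p \<in> polys I \<Longrightarrow> - p \<in> polys I"
  by (auto simp: polys_def in_keys_iff)

lemma polys_diff: "p \<in> polys I \<Longrightarrow> q \<in> polys I \<Longrightarrow> p - q \<in> polys I"
  using polys_add[of p I "- q"] polys_uminus[of q I] by simp

lemma polys_mult: "p \<in> polys I \<Longrightarrow> q \<in> polys I \<Longrightarrow> p * q \<in> polys I"
  using keys_mult[of p q] by (force simp: polys_def keys_add_nat)

lemma polys_power: "p \<in> polys I \<Longrightarrow> p ^ n \<in> polys I"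
  by (induction n) (auto simp: polys_mult)

lemma polys_sum: "(\<And>j. j \<in> A \<Longrightarrow> f j \<in> polys I) \<Longrightarrow> sum f A \<in> polys I"
  by (induction A rule: infinite_finite_induct) (auto simp: polys_add)

lemma polys_mono: "I \<subseteq> J \<Longrightarrow> p \<in> polys I \<Longrightarrow> p \<in> polys J"
  by (auto simp: polys_def)

lemma mpoly_sum_single:
  fixes p :: "('v, 'k::comm_ring_1) mpoly"
  shows
  "p = (\<Sum>m\<in>Poly_Mapping.keys p. Poly_Mapping.single m (Poly_Mapping.lookup p m))"
proof (rule poly_mapping_eqI)
  fix m
  have "Poly_Mapping.lookup (\<Sum>m\<in>Poly_Mapping.keys p. Poly_Mapping.single m (Poly_Mapping.lookup p m)) m
      = (\<Sum>m'\<in>Poly_Mapping.keys p. if m' = m then Poly_Mapping.lookup p m else 0)"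
    unfolding lookup_sum by (intro sum.cong) (auto simp: lookup_single when_def)
  also have "\<dots> = Poly_Mapping.lookup p m"
    by (auto simp: in_keys_iff)
  finally show "Poly_Mapping.lookup p m =
      Poly_Mapping.lookup (\<Sum>m\<in>Poly_Mapping.keys p. Poly_Mapping.single m (Poly_Mapping.lookup p m)) m" ..
qed

text \<open>The monomial case keeps \<open>m \<in> Poly_Mapping.keys p\<close>, so that a property
  shared by all monomials of \<open>p\<close>, such as their weight, is available there.\<close>

lemma mpoly_single_induct:
  fixes p :: "('v, 'k::comm_ring_1) mpoly"
  assumes "P 0"
    and "\<And>m c. m \<in> Poly_Mapping.keys p \<Longrightarrow> P (Poly_Mapping.single m c)"
    and "\<And>p q. P p \<Longrightarrow> P q \<Longrightarrow> P (p + q)"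
  shows "P p"
proof -
  have "P (\<Sum>m\<in>A. Poly_Mapping.single m (Poly_Mapping.lookup p m))"
    if "A \<subseteq> Poly_Mapping.keys p" for A
    using that by (induction A rule: infinite_finite_induct) (auto intro: assms)
  from this[OF order_refl] show ?thesis
    by (simp flip: mpoly_sum_single)
qed

lemma polys_single_induct [consumes 1, case_names zero single add]:
  assumes "p \<in> polys I"
    and "P 0"
    and "\<And>m c. Poly_Mapping.keys m \<subseteq> I \<Longrightarrow> P (Poly_Mapping.single m c)"
    and "\<And>p q. p \<in> polys I \<Longrightarrow> q \<in> polys I \<Longrightarrow> P p \<Longrightarrow> P q \<Longrightarrow> P (p + q)"
  shows "P p"
proof -
  have "p \<in> polys I \<and> P p"
  proof (rule mpoly_single_induct)
    show "\<And>m c. m \<in> Poly_Mapping.keys p \<Longrightarrow>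
        Poly_Mapping.single m c \<in> polys I \<and> P (Poly_Mapping.single m c)"
      using assms(1,3) by (auto simp: polys_def)
  qed (use assms(2,4) polys_add in auto)
  then show ?thesis by simp
qed

lemma monom_induct [consumes 1, case_names zero var]:
  fixes m :: "'v \<Rightarrow>\<^sub>0 nat"
  assumes "Poly_Mapping.keys m \<subseteq> I"
    and "P 0"
    and "\<And>m j. j \<in> I \<Longrightarrow> Poly_Mapping.keys m \<subseteq> I \<Longrightarrow> P m \<Longrightarrow> P (m + Poly_Mapping.single j 1)"
  shows "P m"
  using assms(1)
proof (induction "\<Sum>j\<in>Poly_Mapping.keys m. Poly_Mapping.lookup m j" arbitrary: m)
  case 0
  then have "\<forall>j\<in>Poly_Mapping.keys m. Poly_Mapping.lookup m j = 0"
    by (metis sum_eq_0_iff finite_keys)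
  then have "m = 0"
    by (intro poly_mapping_eqI) (auto simp: in_keys_iff)
  then show ?case using assms(2) by simp
next
  case (Suc n)
  then obtain j where j: "j \<in> Poly_Mapping.keys m"
    by (metis Zero_neq_Suc all_not_in_conv sum.empty)
  define m' where "m' = m - Poly_Mapping.single j 1"
  have m: "m = m' + Poly_Mapping.single j 1"
    unfolding m'_def using j
    by (intro poly_mapping_eqI) (auto simp: lookup_add lookup_minus lookup_single when_def in_keys_iff)
  have k: "Poly_Mapping.keys m' \<subseteq> Poly_Mapping.keys m"
    using keys_add_nat[of m' "Poly_Mapping.single j 1"] m by auto
  have "(\<Sum>k\<in>Poly_Mapping.keys m. Poly_Mapping.lookup m k)
      = (\<Sum>k\<in>Poly_Mapping.keys m. Poly_Mapping.lookup m' k) + (\<Sum>k\<in>Poly_Mapping.keys m. if k = j then 1 else 0)"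
    unfolding sum.distrib[symmetric]
    by (intro sum.cong refl) (subst m, auto simp: lookup_add lookup_single when_def)
  moreover have "(\<Sum>k\<in>Poly_Mapping.keys m. Poly_Mapping.lookup m' k) = (\<Sum>k\<in>Poly_Mapping.keys m'. Poly_Mapping.lookup m' k)"
    using k by (intro sum.mono_neutral_right) (auto simp: in_keys_iff)
  ultimately have "n = (\<Sum>k\<in>Poly_Mapping.keys m'. Poly_Mapping.lookup m' k)"
    using Suc(2) j by simp
  then have "P m'" using Suc(1) Suc.prems k by blast
  then show ?case using m assms(3) j Suc.prems k by blast
qed

lemma single_eq_mconst_mult: "Poly_Mapping.single m c = mconst c * Poly_Mapping.single m 1"
  by (simp add: mult_single)

lemma polys_induct [consumes 1, case_names const var add mult]:
  assumes p: "p \<in> polys I"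
    and const: "\<And>c. P (mconst c)"
    and var: "\<And>j. j \<in> I \<Longrightarrow> P (mvar j)"
    and add: "\<And>p q. p \<in> polys I \<Longrightarrow> q \<in> polys I \<Longrightarrow> P p \<Longrightarrow> P q \<Longrightarrow> P (p + q)"
    and mult: "\<And>p q. p \<in> polys I \<Longrightarrow> q \<in> polys I \<Longrightarrow> P p \<Longrightarrow> P q \<Longrightarrow> P (p * q)"
  shows "P p"
  using p
proof (induction rule: polys_single_induct)
  case zero
  show ?case using const[of 0] by simp
next
  case (single m c)
  have "P (Poly_Mapping.single m 1)"
    using single
  proof (induction rule: monom_induct)
    case zero
    show ?case using const[of 1] .
  next
    case (var m j)
    then have "P (Poly_Mapping.single m 1 * mvar j)"
      by (intro mult assms(3) polys_single polys_mvar) auto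
    then show ?case by (simp add: mult_single mvar_def)
  qed
  then show ?case
    using single by (subst single_eq_mconst_mult) (intro mult const polys_single, auto)
next
  case (add p q)
  then show ?case by (simp add: assms(4))
qed

section \<open>Ring homomorphisms and evaluation of polynomials\<close>

locale rhom =
  fixes h :: "'a::comm_ring_1 \<Rightarrow> 'b::comm_ring_1"
  assumes add: "h (x + y) = h x + h y"
    and mult: "h (x * y) = h x * h y"
    and one: "h 1 = 1"
begin

lemma zero: "h 0 = 0"
  using add[of 0 0] by simp

lemma uminus: "h (- x) = - h x"
  using add[of x "- x"] zero by (simp add: eq_neg_iff_add_eq_0 add.commute)

lemma diff: "h (x - y) = h x - h y"
  using add[of x "- y"] uminus by simp

lemma power: "h (x ^ n) = h x ^ n"
  by (induction n) (auto simp: one mult)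

lemma sum: "h (sum g A) = (\<Sum>x\<in>A. h (g x))"
  by (induction A rule: infinite_finite_induct) (auto simp: zero add)

lemmas hom = add mult one zero uminus diff power sum

end

lemma rhom_comp: "rhom g \<Longrightarrow> rhom h \<Longrightarrow> rhom (\<lambda>x. g (h x))"
  by (simp add: rhom_def)

lemma rhom_mconst: "rhom (mconst :: 'k \<Rightarrow> ('v, 'k::comm_ring_1) mpoly)"
  by unfold_locales (auto simp: single_add mult_single)

lemma rhom_fps_const: "rhom (fps_const :: 'k::comm_ring_1 \<Rightarrow> 'k fps)"
  by unfold_locales auto

definition monom_eval :: "('v \<Rightarrow> 'r::comm_ring_1) \<Rightarrow> ('v \<Rightarrow>\<^sub>0 nat) \<Rightarrow> 'r" where
  "monom_eval \<xi> m = (\<Prod>j\<in>Poly_Mapping.keys m. \<xi> j ^ Poly_Mapping.lookup m j)"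

definition mp_eval :: "('k::comm_ring_1 \<Rightarrow> 'r::comm_ring_1) \<Rightarrow> ('v \<Rightarrow> 'r) \<Rightarrow> ('v, 'k) mpoly \<Rightarrow> 'r" where
  "mp_eval \<kappa> \<xi> p = (\<Sum>m\<in>Poly_Mapping.keys p. \<kappa> (Poly_Mapping.lookup p m) * monom_eval \<xi> m)"

lemma monom_eval_superset:
  "finite A \<Longrightarrow> Poly_Mapping.keys m \<subseteq> A \<Longrightarrow>
    monom_eval \<xi> m = (\<Prod>j\<in>A. \<xi> j ^ Poly_Mapping.lookup m j)"
  unfolding monom_eval_def by (rule prod.mono_neutral_left) (auto simp: in_keys_iff)

lemma monom_eval_0 [simp]: "monom_eval \<xi> 0 = 1"
  by (simp add: monom_eval_def)

lemma monom_eval_single [simp]: "monom_eval \<xi> (Poly_Mapping.single j n) = \<xi> j ^ n"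
  by (simp add: monom_eval_def)

lemma monom_eval_add: "monom_eval \<xi> (m + m') = monom_eval \<xi> m * monom_eval \<xi> m'"
proof -
  let ?A = "Poly_Mapping.keys m \<union> Poly_Mapping.keys m'"
  have "monom_eval \<xi> (m + m') = (\<Prod>j\<in>?A. \<xi> j ^ Poly_Mapping.lookup (m + m') j)"
    by (rule monom_eval_superset) (auto simp: keys_add_nat)
  also have "\<dots> = (\<Prod>j\<in>?A. \<xi> j ^ Poly_Mapping.lookup m j) * (\<Prod>j\<in>?A. \<xi> j ^ Poly_Mapping.lookup m' j)"
    by (simp add: lookup_add power_add prod.distrib)
  also have "\<dots> = monom_eval \<xi> m * monom_eval \<xi> m'"
    using monom_eval_superset[of ?A m \<xi>] monom_eval_superset[of ?A m' \<xi>] by simp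
  finally show ?thesis .
qed

context
  fixes \<kappa> :: "'k::comm_ring_1 \<Rightarrow> 'r::comm_ring_1"
  assumes \<kappa>: "rhom \<kappa>"
begin

lemma mp_eval_superset:
  assumes "finite A" "Poly_Mapping.keys p \<subseteq> A"
  shows "mp_eval \<kappa> \<xi> p = (\<Sum>m\<in>A. \<kappa> (Poly_Mapping.lookup p m) * monom_eval \<xi> m)"
  unfolding mp_eval_def using assms
  by (intro sum.mono_neutral_left) (auto simp: in_keys_iff rhom.zero[OF \<kappa>])

lemma mp_eval_add: "mp_eval \<kappa> \<xi> (p + q) = mp_eval \<kappa> \<xi> p + mp_eval \<kappa> \<xi> q"
proof -
  let ?A = "Poly_Mapping.keys p \<union> Poly_Mapping.keys q"
  have "mp_eval \<kappa> \<xi> (p + q) = (\<Sum>m\<in>?A. \<kappa> (Poly_Mapping.lookup (p + q) m) * monom_eval \<xi> m)"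
    using keys_add[of p q] by (intro mp_eval_superset) auto
  also have "\<dots> = mp_eval \<kappa> \<xi> p + mp_eval \<kappa> \<xi> q"
    using mp_eval_superset[of ?A p] mp_eval_superset[of ?A q]
    by (simp add: lookup_add rhom.add[OF \<kappa>] distrib_right sum.distrib)
  finally show ?thesis .
qed

lemma mp_eval_single: "mp_eval \<kappa> \<xi> (Poly_Mapping.single m c) = \<kappa> c * monom_eval \<xi> m"
  by (subst mp_eval_superset[of "{m}"]) auto

lemma mp_eval_mconst: "mp_eval \<kappa> \<xi> (mconst c) = \<kappa> c"
  by (simp add: mp_eval_single)

lemma mp_eval_mvar: "mp_eval \<kappa> \<xi> (mvar j) = \<xi> j"
  by (simp add: mp_eval_single rhom.one[OF \<kappa>] mvar_def)

lemma mp_eval_mult: "mp_eval \<kappa> \<xi> (p * q) = mp_eval \<kappa> \<xi> p * mp_eval \<kappa> \<xi> q"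
proof (induction p rule: mpoly_single_induct)
  case 1
  show ?case by (simp add: mp_eval_def)
next
  case (2 m c)
  show ?case
  proof (induction q rule: mpoly_single_induct)
    case 1
    show ?case by (simp add: mp_eval_def)
  next
    case (2 m' c')
    show ?case
      by (simp add: mult_single mp_eval_single monom_eval_add rhom.mult[OF \<kappa>] ac_simps)
  next
    case (3 p q)
    then show ?case by (simp add: distrib_left mp_eval_add)
  qed
next
  case (3 p q)
  then show ?case by (simp add: distrib_right mp_eval_add)
qed

lemma rhom_mp_eval: "rhom (mp_eval \<kappa> \<xi>)"
  using mp_eval_mconst[of \<xi> 1]
  by unfold_locales (auto simp: mp_eval_add mp_eval_mult rhom.one[OF \<kappa>])

end

text \<open>Only variables in \<open>I\<close> are compared: the evaluations that build the
  embedding agree on a subset of the variables and differ elsewhere.\<close>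

lemma rhom_eq_on_polys:
  assumes "rhom g" "rhom h"
    and "\<And>c. g (mconst c) = h (mconst c)"
    and "\<And>j. j \<in> I \<Longrightarrow> g (mvar j) = h (mvar j)"
    and "p \<in> polys I"
  shows "g p = h p"
  using assms(5)
  by (induction rule: polys_induct) (simp_all only: assms(3,4) rhom.add[OF assms(1)] rhom.add[OF assms(2)]
      rhom.mult[OF assms(1)] rhom.mult[OF assms(2)])

text \<open>
  The derivation along an evaluation homomorphism that sends the \<open>j\<close>-th variable to \<open>u j\<close>, as the
  \<open>\<epsilon>\<close>-coefficient of the evaluation at \<open>\<xi> + u \<epsilon>\<close>.
\<close>

definition mderiv ::
    "('k::comm_ring_1 \<Rightarrow> 'r::comm_ring_1) \<Rightarrow> ('v \<Rightarrow> 'r) \<Rightarrow> ('v \<Rightarrow> 'r) \<Rightarrow> ('v, 'k) mpoly \<Rightarrow> 'r" where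
  "mderiv \<kappa> \<xi> u p =
     fps_nth (mp_eval (\<lambda>c. fps_const (\<kappa> c)) (\<lambda>j. fps_const (\<xi> j) + fps_const (u j) * fps_X) p) 1"

context
  fixes \<kappa> :: "'k::comm_ring_1 \<Rightarrow> 'r::comm_ring_1"
  assumes \<kappa>: "rhom \<kappa>"
begin

private lemma \<kappa>': "rhom (\<lambda>c. fps_const (\<kappa> c))"
  by (rule rhom_comp[OF rhom_fps_const \<kappa>])

text \<open>Reducing modulo \<open>fps_X\<close> gives back the evaluation at \<open>\<xi>\<close>;
  this is what turns the formula for the first coefficient of a product into the Leibniz
  rule.\<close>

private lemma eval_nth_0:
  "fps_nth (mp_eval (\<lambda>c. fps_const (\<kappa> c)) (\<lambda>j. fps_const (\<xi> j) + fps_const (u j) * fps_X) p) 0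
    = mp_eval \<kappa> \<xi> p"
proof (rule rhom_eq_on_polys[of _ _ UNIV])
  show "rhom (\<lambda>p. fps_nth (mp_eval (\<lambda>c. fps_const (\<kappa> c))
      (\<lambda>j. fps_const (\<xi> j) + fps_const (u j) * fps_X) p) 0)"
    by (rule rhom_comp[OF _ rhom_mp_eval[OF \<kappa>']]) (simp add: rhom_def)
qed (simp_all add: rhom_mp_eval[OF \<kappa>] mp_eval_mconst[OF \<kappa>] mp_eval_mconst[OF \<kappa>'] mp_eval_mvar[OF \<kappa>]
    mp_eval_mvar[OF \<kappa>'] polys_def)

lemma mderiv_add: "mderiv \<kappa> \<xi> u (p + q) = mderiv \<kappa> \<xi> u p + mderiv \<kappa> \<xi> u q"
  by (simp add: mderiv_def mp_eval_add[OF \<kappa>'])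

lemma mderiv_mult:
  "mderiv \<kappa> \<xi> u (p * q) = mderiv \<kappa> \<xi> u p * mp_eval \<kappa> \<xi> q + mp_eval \<kappa> \<xi> p * mderiv \<kappa> \<xi> u q"
  unfolding mderiv_def mp_eval_mult[OF \<kappa>'] fps_mult_nth_1 eval_nth_0 by (rule add.commute)

lemma mderiv_mconst: "mderiv \<kappa> \<xi> u (mconst c) = 0"
  by (simp add: mderiv_def mp_eval_single[OF \<kappa>'])

lemma mderiv_mvar: "mderiv \<kappa> \<xi> u (mvar j) = u j"
  by (simp add: mderiv_def mp_eval_mvar[OF \<kappa>'])

lemma mderiv_0: "mderiv \<kappa> \<xi> u 0 = 0"
  using mderiv_mconst[of _ _ 0] by simp

lemma mderiv_uminus: "mderiv \<kappa> \<xi> u (- p) = - mderiv \<kappa> \<xi> u p"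
  using mderiv_add[of \<xi> u p "- p"] by (simp add: mderiv_0 eq_neg_iff_add_eq_0 add.commute)

lemma mderiv_diff: "mderiv \<kappa> \<xi> u (p - q) = mderiv \<kappa> \<xi> u p - mderiv \<kappa> \<xi> u q"
  using mderiv_add[of \<xi> u p "- q"] by (simp add: mderiv_uminus)

end

lemma mderiv_power:
  fixes \<kappa> :: "'k::comm_ring_1 \<Rightarrow> 'r::comm_ring_1"
  assumes \<kappa>: "rhom \<kappa>"
  shows "mderiv \<kappa> \<xi> u (p ^ n) = of_nat n * (mp_eval \<kappa> \<xi> p ^ (n - 1) * mderiv \<kappa> \<xi> u p)"
proof (induction n)
  case 0
  show ?case using mderiv_mconst[OF \<kappa>, of \<xi> u 1] by simp
next
  case (Suc n)
  have "mderiv \<kappa> \<xi> u (p ^ Suc n) = mderiv \<kappa> \<xi> u p * mp_eval \<kappa> \<xi> p ^ n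
      + mp_eval \<kappa> \<xi> p * (of_nat n * (mp_eval \<kappa> \<xi> p ^ (n - 1) * mderiv \<kappa> \<xi> u p))"
    by (simp add: mderiv_mult[OF \<kappa>] Suc rhom.power[OF rhom_mp_eval[OF \<kappa>]])
  also have "\<dots> = of_nat (Suc n) * (mp_eval \<kappa> \<xi> p ^ n * mderiv \<kappa> \<xi> u p)"
    by (cases n) (simp_all add: algebra_simps)
  finally show ?case by simp
qed

lemma mp_eval_mvar_id: "mp_eval mconst mvar p = p"
  by (rule rhom_eq_on_polys[where I = UNIV, OF rhom_mp_eval[OF rhom_mconst]])
    (auto simp: rhom_def mp_eval_mconst[OF rhom_mconst] mp_eval_mvar[OF rhom_mconst] polys_def)

text \<open>Evaluation at the variables themselves is the identity, so this is the derivation of the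
  polynomial ring that kills the constants and has prescribed values at the variables.\<close>

abbreviation pderiv_along :: "('v \<Rightarrow> ('v, 'k::comm_ring_1) mpoly) \<Rightarrow> ('v, 'k) mpoly \<Rightarrow> ('v, 'k) mpoly" where
  "pderiv_along \<equiv> mderiv mconst mvar"

lemma pderiv_along_mult: "pderiv_along V (p * q) = pderiv_along V p * q + p * pderiv_along V q"
  using mderiv_mult[OF rhom_mconst, of mvar V p q] by (simp add: mp_eval_mvar_id)

lemmas pderiv_along_simps = mderiv_add[OF rhom_mconst, of mvar] mderiv_mconst[OF rhom_mconst, of mvar]
  mderiv_mvar[OF rhom_mconst, of mvar] mderiv_0[OF rhom_mconst, of mvar]

lemma pderiv_along_polys:
  assumes "\<And>j. j \<in> I \<Longrightarrow> V j \<in> polys I" "p \<in> polys I"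
  shows "pderiv_along V p \<in> polys I"
  using assms(2)
  by (induction rule: polys_induct)
    (auto simp: pderiv_along_simps pderiv_along_mult assms(1) intro: polys_add polys_mult)

lemma pderiv_along_pow_polys:
  "(\<And>j. j \<in> I \<Longrightarrow> V j \<in> polys I) \<Longrightarrow> p \<in> polys I \<Longrightarrow> (pderiv_along V ^^ n) p \<in> polys I"
  by (induction n) (auto simp: pderiv_along_polys)

section \<open>Polynomials in one distinguished variable, and division with remainder\<close>

lemma mvar_power: "mvar j ^ n = Poly_Mapping.single (Poly_Mapping.single j n) 1"
  by (induction n) (auto simp: mvar_def mult_single simp flip: single_add)

text \<open>The coefficients are a total sequence that vanishes from \<open>N\<close> on, so
  expansions of different lengths can be padded and added.\<close>

lemma polys_mvar_decomp:
  assumes "i \<in> I" "p \<in> polys I"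
  obtains N q where "\<And>j. q j \<in> polys (I - {i})" "\<And>j. j \<ge> N \<Longrightarrow> q j = 0"
    "p = (\<Sum>j<N. q j * mvar i ^ j)"
proof -
  have "\<exists>N q. (\<forall>j. q j \<in> polys (I - {i})) \<and> (\<forall>j\<ge>N. q j = 0) \<and> p = (\<Sum>j<N. q j * mvar i ^ j)"
    using assms(2)
  proof (induction rule: polys_single_induct)
    case zero
    show ?case by (intro exI[of _ 0] exI[of _ "\<lambda>_. 0"]) auto
  next
    case (single m c)
    define k where "k = Poly_Mapping.lookup m i"
    define m' where "m' = m - Poly_Mapping.single i k"
    have m: "m = m' + Poly_Mapping.single i k"
      by (intro poly_mapping_eqI)
        (auto simp: m'_def k_def lookup_add lookup_minus lookup_single when_def)
    have "i \<notin> Poly_Mapping.keys m'"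
      by (auto simp: m'_def k_def in_keys_iff lookup_minus)
    moreover have "Poly_Mapping.keys m' \<subseteq> I"
      using single keys_add_nat[of m' "Poly_Mapping.single i k"] m by auto
    ultimately have m': "Poly_Mapping.keys m' \<subseteq> I - {i}" by auto
    have "Poly_Mapping.single m c = Poly_Mapping.single m' c * mvar i ^ k"
      by (simp add: mvar_power mult_single flip: m)
    also have "\<dots> = (\<Sum>j<Suc k. (if j = k then Poly_Mapping.single m' c else 0) * mvar i ^ j)"
      by (simp add: if_distrib[of "\<lambda>x. x * _"] sum.delta cong: if_cong)
    finally show ?case using m'
      by (intro exI[of _ "Suc k"] exI[of _ "\<lambda>j. if j = k then Poly_Mapping.single m' c else 0"])
        (auto simp: polys_single)
  next
    case (add p p')
    then obtain N q N' q'
      where q: "\<And>j. q j \<in> polys (I - {i})" "\<And>j. j \<ge> N \<Longrightarrow> q j = 0" "p = (\<Sum>j<N. q j * mvar i ^ j)"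
        and q': "\<And>j. q' j \<in> polys (I - {i})" "\<And>j. j \<ge> N' \<Longrightarrow> q' j = 0" "p' = (\<Sum>j<N'. q' j * mvar i ^ j)"
      by blast
    have "p = (\<Sum>j<N + N'. q j * mvar i ^ j)"
      unfolding q(3) by (rule sum.mono_neutral_left) (auto simp: q(2))
    moreover have "p' = (\<Sum>j<N + N'. q' j * mvar i ^ j)"
      unfolding q'(3) by (rule sum.mono_neutral_left) (auto simp: q'(2))
    ultimately show ?case
      by (intro exI[of _ "N + N'"] exI[of _ "\<lambda>j. q j + q' j"])
        (auto simp: sum.distrib distrib_right q q' polys_add)
  qed
  then show ?thesis using that by blast
qed

text \<open>Division by a polynomial monic in \<open>x_i\<close>: replacing \<open>x_i ^ e\<close>
  by \<open>- g\<close> lowers the exponent of any power \<open>x_i ^ n\<close> with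
  \<open>n \<ge> e\<close>, and the polynomials that have such a remainder form a module over the
  other variables.\<close>

lemma polys_reduce_monic:
  assumes i: "i \<in> I" and e: "e > 0" and g: "g \<in> polys (I - {i})" and p: "p \<in> polys I"
  obtains h q where "h \<in> polys I" "\<And>j. q j \<in> polys (I - {i})"
    "p = (mvar i ^ e + g) * h + (\<Sum>j<e. q j * mvar i ^ j)"
proof -
  define T where "T = {p. \<exists>h q. h \<in> polys I \<and> (\<forall>j. q j \<in> polys (I - {i})) \<and>
    p = (mvar i ^ e + g) * h + (\<Sum>j<e. q j * mvar i ^ j)}"
  have TI: "(mvar i ^ e + g) * h + (\<Sum>j<e. q j * mvar i ^ j) \<in> T"
    if "h \<in> polys I" "\<And>j. q j \<in> polys (I - {i})" for h q
    unfolding T_def using that by blast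
  have T_add: "p + p' \<in> T" if "p \<in> T" "p' \<in> T" for p p'
  proof -
    from that obtain h q h' q' where "h \<in> polys I" "\<And>j. q j \<in> polys (I - {i})"
      "p = (mvar i ^ e + g) * h + (\<Sum>j<e. q j * mvar i ^ j)"
      "h' \<in> polys I" "\<And>j. q' j \<in> polys (I - {i})"
      "p' = (mvar i ^ e + g) * h' + (\<Sum>j<e. q' j * mvar i ^ j)"
      unfolding T_def by blast
    then show ?thesis
      using TI[of "h + h'" "\<lambda>j. q j + q' j"] by (simp add: polys_add algebra_simps sum.distrib)
  qed
  have T_scale: "r * p \<in> T" if "p \<in> T" "r \<in> polys (I - {i})" for p r
  proof -
    from that obtain h q where "h \<in> polys I" "\<And>j. q j \<in> polys (I - {i})"
      "p = (mvar i ^ e + g) * h + (\<Sum>j<e. q j * mvar i ^ j)"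
      unfolding T_def by blast
    then show ?thesis
      using TI[of "r * h" "\<lambda>j. r * q j"] that(2) polys_mono[of "I - {i}" I r]
      by (simp add: polys_mult algebra_simps sum_distrib_left)
  qed
  have T_0: "0 \<in> T"
    using TI[of 0 "\<lambda>_. 0"] by simp
  have T_power: "mvar i ^ n \<in> T" for n
  proof (induction n rule: less_induct)
    case (less n)
    show ?case
    proof (cases "n < e")
      case True
      have "(mvar i ^ e + g) * 0 + (\<Sum>j<e. (if j = n then 1 else 0) * mvar i ^ j) \<in> T"
        by (rule TI) auto
      then show ?thesis
        using True by (simp add: if_distrib[of "\<lambda>x. x * _"] sum.delta cong: if_cong)
    next
      case False
      then have "mvar i ^ n = mvar i ^ e * mvar i ^ (n - e)"
        by (simp flip: power_add)
      also have "\<dots> = ((mvar i ^ e + g) * mvar i ^ (n - e)) + (- g) * mvar i ^ (n - e)"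
        by (simp add: algebra_simps)
      finally have eq: "mvar i ^ n = ((mvar i ^ e + g) * mvar i ^ (n - e)) + (- g) * mvar i ^ (n - e)" .
      have "(- g) * mvar i ^ (n - e) \<in> T"
        using less False e g by (intro T_scale polys_uminus less) auto
      moreover have "(mvar i ^ e + g) * mvar i ^ (n - e) \<in> T"
        using TI[of "mvar i ^ (n - e)" "\<lambda>_. 0"] i by (simp add: polys_power polys_mvar)
      ultimately show ?thesis unfolding eq using T_add by blast
    qed
  qed
  obtain N q where q: "\<And>j. q j \<in> polys (I - {i})" "p = (\<Sum>j<N. q j * mvar i ^ j)"
    using polys_mvar_decomp[OF i p] by metis
  have "(\<Sum>j<M. q j * mvar i ^ j) \<in> T" for M
    by (induction M) (auto simp: T_0 intro!: T_add T_scale T_power q)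
  then have "p \<in> T" using q by simp
  then show ?thesis using that unfolding T_def by blast
qed

section \<open>Reduction modulo a variable, with the subring in the other variables as the
  quotient\<close>

definition set_zero :: "'v \<Rightarrow> ('v, 'k::comm_ring_1) mpoly \<Rightarrow> ('v, 'k) mpoly" where
  "set_zero i = mp_eval mconst (mvar(i := 0))"

lemma rhom_set_zero: "rhom (set_zero i)"
  unfolding set_zero_def by (rule rhom_mp_eval[OF rhom_mconst])

lemma set_zero_mconst [simp]: "set_zero i (mconst c) = mconst c"
  unfolding set_zero_def by (rule mp_eval_mconst[OF rhom_mconst])

lemma set_zero_mvar: "set_zero i (mvar j) = (if j = i then 0 else mvar j)"
  unfolding set_zero_def by (simp add: mp_eval_mvar[OF rhom_mconst])

lemmas set_zero_hom = rhom.hom[OF rhom_set_zero]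

lemma set_zero_polys: "p \<in> polys I \<Longrightarrow> set_zero i p \<in> polys (I - {i})"
  by (induction rule: polys_induct)
    (auto simp: set_zero_mvar set_zero_hom polys_add polys_mult polys_mvar)

lemma set_zero_id: "p \<in> polys I \<Longrightarrow> i \<notin> I \<Longrightarrow> set_zero i p = p"
  by (induction rule: polys_induct) (auto simp: set_zero_mvar set_zero_hom)

lemma set_zero_decomp:
  assumes "p \<in> polys I" "i \<in> I"
  obtains r where "r \<in> polys I" "p = set_zero i p + mvar i * r"
proof -
  have "\<exists>r\<in>polys I. p = set_zero i p + mvar i * r"
    using assms(1)
  proof (induction rule: polys_induct)
    case (const c)
    show ?case by (intro bexI[of _ 0]) auto
  next
    case (var j)
    show ?case
      by (intro bexI[of _ "if j = i then 1 else 0"]) (auto simp: set_zero_mvar)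
  next
    case (add p q)
    then obtain r s where "r \<in> polys I" "s \<in> polys I"
      "p = set_zero i p + mvar i * r" "q = set_zero i q + mvar i * s" by blast
    then show ?case
      by (intro bexI[of _ "r + s"]) (auto simp: set_zero_hom polys_add algebra_simps)
  next
    case (mult p q)
    then obtain r s where rs: "r \<in> polys I" "s \<in> polys I"
      and p: "p = set_zero i p + mvar i * r" and q: "q = set_zero i q + mvar i * s" by blast
    have "p * q = (set_zero i p + mvar i * r) * q"
      using p by simp
    also have "\<dots> = set_zero i p * (set_zero i q + mvar i * s) + mvar i * (r * q)"
      using q by (simp add: algebra_simps)
    also have "\<dots> = set_zero i (p * q) + mvar i * (set_zero i p * s + r * q)"
      by (simp add: set_zero_hom algebra_simps)
    finally show ?case using rs mult polys_mono[OF _ set_zero_polys[OF \<open>p \<in> polys I\<close>, of i], of I]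
      by (intro bexI[of _ "set_zero i p * s + r * q"]) (auto intro!: polys_add polys_mult)
  qed
  then show ?thesis using that by blast
qed

section \<open>Homogeneous components for a weight\<close>

definition homog :: "(('v \<Rightarrow>\<^sub>0 nat) \<Rightarrow> nat) \<Rightarrow> nat \<Rightarrow> ('v, 'k::comm_ring_1) mpoly \<Rightarrow> bool" where
  "homog wt e p \<longleftrightarrow> (\<forall>m\<in>Poly_Mapping.keys p. wt m = e)"

definition hcomp :: "(('v \<Rightarrow>\<^sub>0 nat) \<Rightarrow> nat) \<Rightarrow> nat \<Rightarrow> ('v, 'k::comm_ring_1) mpoly \<Rightarrow> ('v, 'k) mpoly" where
  "hcomp wt e p = Poly_Mapping.mapp (\<lambda>m c. if wt m = e then c else 0) p"

lemma lookup_hcomp: "Poly_Mapping.lookup (hcomp wt e p) m = (if wt m = e then Poly_Mapping.lookup p m else 0)"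
  by (auto simp: hcomp_def lookup_mapp when_def in_keys_iff)

lemma hcomp_add: "hcomp wt e (p + q) = hcomp wt e p + hcomp wt e q"
  by (intro poly_mapping_eqI) (simp add: lookup_hcomp lookup_add)

lemma hcomp_diff: "hcomp wt e (p - q) = hcomp wt e p - hcomp wt e q"
  by (intro poly_mapping_eqI) (simp add: lookup_hcomp lookup_minus)

lemma hcomp_0 [simp]: "hcomp wt e 0 = 0"
  by (intro poly_mapping_eqI) (simp add: lookup_hcomp)

lemma hcomp_single: "hcomp wt e (Poly_Mapping.single m c) = (if wt m = e then Poly_Mapping.single m c else 0)"
  by (intro poly_mapping_eqI) (auto simp: lookup_hcomp lookup_single when_def)

lemma homog_hcomp: "homog wt e (hcomp wt e p)"
  by (auto simp: homog_def in_keys_iff lookup_hcomp split: if_splits)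

lemma hcomp_homog: "homog wt e p \<Longrightarrow> hcomp wt d p = (if d = e then p else 0)"
  by (intro poly_mapping_eqI) (auto simp: lookup_hcomp homog_def in_keys_iff)

lemma hcomp_polys: "p \<in> polys I \<Longrightarrow> hcomp wt e p \<in> polys I"
  by (auto simp: polys_def in_keys_iff lookup_hcomp split: if_splits)

lemma homog_0 [simp]: "homog wt e 0"
  by (simp add: homog_def)

lemma homog_single: "wt m = e \<Longrightarrow> homog wt e (Poly_Mapping.single m c)"
  by (simp add: homog_def)

lemma homog_add: "homog wt e p \<Longrightarrow> homog wt e q \<Longrightarrow> homog wt e (p + q)"
  using keys_add[of p q] by (auto simp: homog_def)

lemma homog_sum: "(\<And>x. x \<in> A \<Longrightarrow> homog wt e (f x)) \<Longrightarrow> homog wt e (sum f A)"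
  by (induction A rule: infinite_finite_induct) (auto intro: homog_add)

locale additive_weight =
  fixes wt :: "('v \<Rightarrow>\<^sub>0 nat) \<Rightarrow> nat"
  assumes wt_add: "wt (m + m') = wt m + wt m'"
begin

lemma wt_0: "wt 0 = 0"
  using wt_add[of 0 0] by simp

lemma homog_mult: "homog wt d p \<Longrightarrow> homog wt e q \<Longrightarrow> homog wt (d + e) (p * q)"
  using keys_mult[of p q] by (force simp: homog_def wt_add)

lemma homog_mconst: "homog wt 0 (mconst c)"
  by (rule homog_single) (rule wt_0)

lemma homog_1: "homog wt 0 1"
  using homog_mconst[of 1] by simp

lemma homog_power: "homog wt d p \<Longrightarrow> homog wt (n * d) (p ^ n)"
  by (induction n) (auto intro: homog_mult simp: homog_1)

lemma hcomp_mult: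
  assumes "homog wt d q"
  shows "hcomp wt (d + e) (q * p) = q * hcomp wt e p"
proof (induction p rule: mpoly_single_induct)
  case 1
  show ?case by simp
next
  case (2 m c)
  have "homog wt (d + wt m) (q * Poly_Mapping.single m c)"
    by (intro homog_mult assms homog_single refl)
  from hcomp_homog[OF this, of "d + e"] show ?case
    by (simp add: hcomp_single)
next
  case (3 p p')
  then show ?case by (simp add: distrib_left hcomp_add)
qed

lemma hcomp_mult_less:
  assumes "homog wt d q" "e < d"
  shows "hcomp wt e (q * p) = 0"
proof (induction p rule: mpoly_single_induct)
  case 1
  show ?case by simp
next
  case (2 m c)
  have "homog wt (d + wt m) (q * Poly_Mapping.single m c)"
    by (intro homog_mult assms homog_single refl)
  from hcomp_homog[OF this, of e] show ?case
    using assms(2) by simp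
next
  case (3 p p')
  then show ?case by (simp add: distrib_left hcomp_add)
qed

text \<open>An ideal generated by a homogeneous element contains the components of its elements, so
  the component of weight \<open>d + e\<close> of the relation is again a relation modulo
  \<open>g\<close>. It lets a solution be replaced by a homogeneous one.\<close>

lemma homog_solution:
  assumes "homog wt d q" "homog wt (d + e) q'" "homog wt l g"
    and "q * p - q' = g * h" "h \<in> polys I"
  obtains h' where "h' \<in> polys I" "q * hcomp wt e p - q' = g * h'"
proof -
  have "hcomp wt (d + e) (q * p - q') = q * hcomp wt e p - q'"
    by (simp add: hcomp_diff hcomp_mult[OF assms(1)] hcomp_homog[OF assms(2)])
  moreover have "\<exists>h'\<in>polys I. hcomp wt (d + e) (g * h) = g * h'"
  proof (cases "l \<le> d + e")
    case True
    then show ?thesis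
      using hcomp_mult[OF assms(3), of "d + e - l" h] assms(5) hcomp_polys by force
  next
    \<comment> \<open>Weights are natural numbers, so a multiple of \<open>g\<close> has no
      component below the weight of \<open>g\<close>.\<close>
    case False
    then show ?thesis
      using hcomp_mult_less[OF assms(3), of "d + e" h] by (intro bexI[of _ 0]) auto
  qed
  ultimately show ?thesis using that assms(4) by metis
qed

end

text \<open>A derivation that kills \<open>x_i\<close> maps multiples of \<open>x_i\<close> to
  multiples of \<open>x_i\<close> and hence descends to the quotient by it.\<close>

lemma set_zero_pderiv_along:
  assumes "V i = 0" "p \<in> polys I"
  shows "set_zero i (pderiv_along V p) = pderiv_along (\<lambda>j. set_zero i (V j)) (set_zero i p)"
  using assms(2)
  by (induction rule: polys_induct)
    (auto simp: pderiv_along_simps pderiv_along_mult set_zero_hom set_zero_mvar assms(1))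

section \<open>Embedding a Pham-Brieskorn ring into a field\<close>

abbreviation pb_poly :: "'v set \<Rightarrow> ('v \<Rightarrow> nat) \<Rightarrow> ('v, 'k::comm_ring_1) mpoly" where
  "pb_poly I a \<equiv> (\<Sum>j\<in>I. mvar j ^ a j)"

text \<open>Positive exponents keep the pure powers of different variables distinct as monomials, so
  nothing can cancel and the coefficient of \<open>mvar j ^ a j\<close> is 1.\<close>

lemma pb_poly_nonzero:
  assumes "finite I" "I \<noteq> {}" "\<And>j. j \<in> I \<Longrightarrow> a j > 0"
  shows "(pb_poly I a :: ('v, 'k::field_char_0) mpoly) \<noteq> 0"
proof -
  obtain j where j: "j \<in> I" using assms(2) by blast
  have "Poly_Mapping.lookup (pb_poly I a :: ('v, 'k) mpoly) (Poly_Mapping.single j (a j))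
      = (\<Sum>k\<in>I. if k = j then 1 else 0)"
    unfolding lookup_sum mvar_power
  proof (intro sum.cong refl)
    fix k assume k: "k \<in> I"
    have *: "k = j" if eq: "Poly_Mapping.single k (a k) = Poly_Mapping.single j (a j)"
    proof -
      have "Poly_Mapping.lookup (Poly_Mapping.single j (a j)) k = a k"
        by (simp flip: eq)
      then show ?thesis
        using assms(3)[OF k] by (auto simp: lookup_single when_def split: if_splits)
    qed
    show "Poly_Mapping.lookup (Poly_Mapping.single (Poly_Mapping.single k (a k)) (1::'k))
        (Poly_Mapping.single j (a j)) = (if k = j then 1 else 0)"
    proof (cases "k = j")
      case True
      then show ?thesis by simp
    next
      case False
      then have "Poly_Mapping.single k (a k) \<noteq> Poly_Mapping.single j (a j)" using * by blast
      then show ?thesis using False by (simp add: lookup_single when_def)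
    qed
  qed
  also have "\<dots> = 1" using j assms(1) by simp
  finally have "Poly_Mapping.lookup (pb_poly I a :: ('v, 'k) mpoly) (Poly_Mapping.single j (a j)) \<noteq>
      Poly_Mapping.lookup 0 (Poly_Mapping.single j (a j))" by simp
  then show ?thesis by metis
qed

instance fract :: ("{idom, ring_char_0}") field_char_0
proof
  show "inj (of_nat :: nat \<Rightarrow> 'a fract)"
    by (auto simp: inj_def of_nat_fract eq_fract)
qed

text \<open>An algebraically closed field in which all the variables are algebraically independent.\<close>

definition generic :: "('v::linorder, 'k::field_char_0) mpoly \<Rightarrow> ('v, 'k) mpoly fract alg_closure" where
  "generic p = to_ac (Fract p 1)"

lemma rhom_generic: "rhom generic"
  by unfold_locales
    (simp_all add: generic_def flip: to_ac_add to_ac_mult One_fract_def)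

lemma generic_eq_0_iff: "generic p = 0 \<longleftrightarrow> p = 0"
  by (simp add: generic_def Zero_fract_def eq_fract)

text \<open>\<open>Y\<close> is \<open>y + T\<close> with \<open>T\<close> nonzero and without
  constant term, and substituting such a \<open>T\<close> into power series is injective. A relation
  for \<open>Y\<close> is therefore a relation for the polynomial \<open>[:y, 1:]\<close>.\<close>

lemma fps_nonconst_transcendental:
  fixes Y :: "'a::field fps"
  assumes sum: "(\<Sum>j<N. fps_const (c j) * Y ^ j) = 0" and Y: "fps_nth Y 1 \<noteq> 0" and j: "j < N"
  shows "c j = 0"
proof -
  define y where "y = fps_nth Y 0"
  define T where "T = Y - fps_const y"
  have T0: "fps_nth T 0 = 0" by (simp add: T_def y_def)
  have T1: "T \<noteq> 0" using Y by (auto simp: T_def)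
  define g where "g = (\<Sum>j<N. smult (c j) ([:y, 1:] ^ j))"
  have "fps_of_poly g oo T = (\<Sum>j<N. fps_const (c j) * Y ^ j)"
  proof -
    have "fps_of_poly [:y, 1:] oo T = Y"
      using T0 by (simp add: fps_of_poly_pCons fps_compose_add_distrib T_def)
    then have "fps_of_poly ([:y, 1:] ^ j) oo T = Y ^ j" for j
      using fps_compose_power[OF T0, of "fps_of_poly [:y, 1:]" j] by (simp add: fps_of_poly_power)
    then show ?thesis
      unfolding g_def fps_of_poly_sum fps_compose_sum_distrib fps_of_poly_smult
      by (intro sum.cong refl) (subst fps_compose_mult_distrib[OF T0], simp)
  qed
  with sum have "fps_of_poly g oo T = 0" by simp
  then have "fps_of_poly g = 0"
    using fps_compose_eq_0_iff[OF T0, of "fps_of_poly g"] T1 by simp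
  then have "g = 0" by simp
  \<comment> \<open>The opposite shift recovers the coefficients \<open>c j\<close> from
    \<open>g\<close>.\<close>
  have pc: "pcompose [:y, 1:] [:- y, 1:] = [:0, 1:]" by (simp add: pcompose_pCons)
  have pow: "pcompose ([:y, 1:] ^ j) [:- y, 1:] = [:0, 1:] ^ j" for j
    by (induction j) (simp_all only: power_0 power_Suc pcompose_1 pcompose_mult pc)
  have "pcompose g [:- y, 1:] = (\<Sum>j<N. smult (c j) ([:0, 1:] ^ j))"
    unfolding g_def pcompose_sum pcompose_smult pow ..
  also have "\<dots> = (\<Sum>j<N. Polynomial.monom (c j) j)"
    by (intro sum.cong refl) (simp flip: monom_altdef)
  finally have "(\<Sum>j<N. Polynomial.monom (c j) j) = 0"
    using \<open>g = 0\<close> by simp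
  then have "poly.coeff (\<Sum>j<N. Polynomial.monom (c j) j) j = 0" by simp
  then show ?thesis
    using j by (simp add: coeff_sum)
qed

text \<open>Three variables leave at least one besides \<open>i\<close> and \<open>b\<close>, so the
  radicand for the image of \<open>x_b\<close> has the nonzero constant term \<open>- r\<close> and
  its root exists among power series. In the last conclusion \<open>q\<close> may be any polynomial:
  all values are power series, without negative exponents, so divisibility by powers of
  \<open>x_i\<close> is bounded by the order.\<close>

theorem pb_embedding:
  fixes I :: "'v::linorder set" and a :: "'v \<Rightarrow> nat"
  assumes fin: "finite I" and card: "card I \<ge> 3" and i: "i \<in> I"
    and apos: "\<And>j. j \<in> I \<Longrightarrow> a j > 0"
  obtains \<kappa> :: "'k::field_char_0 \<Rightarrow> ('v, 'k) mpoly fract alg_closure fls" and \<xi>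
  where "rhom \<kappa>" "\<And>j. \<xi> j \<noteq> 0"
    "\<And>p. p \<in> polys I \<Longrightarrow> mp_eval \<kappa> \<xi> p = 0 \<longleftrightarrow> (\<exists>h\<in>polys I. p = pb_poly I a * h)"
    "\<And>p. mp_eval \<kappa> \<xi> p \<noteq> 0 \<Longrightarrow> \<exists>N. \<forall>q. mp_eval \<kappa> \<xi> p \<noteq> \<xi> i ^ N * mp_eval \<kappa> \<xi> q"
proof -
  have "card (I - {i}) \<ge> 2" using card i fin by simp
  then have "I - {i} \<noteq> {}" by (metis card.empty not_numeral_le_zero)
  then obtain b where b: "b \<in> I" "b \<noteq> i" by blast
  define J where "J = I - {i} - {b}"
  have "card J \<ge> 1" using card i b fin by (simp add: J_def)
  then have "J \<noteq> {}" by auto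
  moreover have "finite J" using fin by (simp add: J_def)
  ultimately have J: "J \<noteq> {}" "finite J" by auto
  define r where "r = generic (pb_poly J a :: ('v, 'k) mpoly)"
  have r0: "r \<noteq> 0"
    using pb_poly_nonzero[OF J(2,1), of a] apos by (auto simp: r_def generic_eq_0_iff J_def)
  have I_eq: "I = insert i (insert b J)" and notin: "i \<notin> J" "b \<notin> J"
    using i b by (auto simp: J_def)
  obtain \<rho> where \<rho>: "\<rho> ^ a b = - r"
    using nth_root_exists[of "a b" "- r"] apos[OF b(1)] by auto
  \<comment> \<open>The function given to \<open>fps_radical\<close> has to supply a root of the
    constant coefficient, which is \<open>- r\<close>.\<close>
  define Y where "Y = fps_radical (\<lambda>_ _. \<rho>) (a b) (fps_const (- r) - fps_X)"
  have Y: "Y ^ a b = fps_const (- r) - fps_X"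
    using power_radical[of "fps_const (- r) - fps_X" "\<lambda>_ _. \<rho>" "a b - 1"] r0 apos[OF b(1)] \<rho>
    by (simp add: Y_def)
  \<comment> \<open>The radicand has linear coefficient -1, whereas powers of a series without a
    linear term have none either.\<close>
  have Y1: "fps_nth Y 1 \<noteq> 0"
  proof
    assume "fps_nth Y 1 = 0"
    have "fps_nth (Y ^ n) 1 = 0" for n
      using \<open>fps_nth Y 1 = 0\<close> by (induction n) (auto simp: fps_mult_nth_1)
    from this[of "a b"] show False by (simp add: Y)
  qed
  have Y0: "fps_nth Y 0 \<noteq> 0"
  proof
    assume "fps_nth Y 0 = 0"
    then have "fps_nth (Y ^ a b) 0 = 0" using apos[OF b(1)] by (simp add: fps_nth_power_0)
    then show False using r0 by (simp add: Y)
  qed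
  define e where "e = a i"
  have e: "e > 0" using apos i by (simp add: e_def)
  define \<kappa>0 where "\<kappa>0 = (\<lambda>c. fps_const (generic (mconst c :: ('v, 'k) mpoly)))"
  have \<kappa>0: "rhom \<kappa>0"
    unfolding \<kappa>0_def by (intro rhom_comp[OF rhom_fps_const] rhom_comp[OF rhom_generic rhom_mconst])
  \<comment> \<open>In \<open>\<xi>0\<close> the series variable stands for \<open>x_i ^ e\<close>,
    in \<open>\<xi>1\<close> for \<open>x_i\<close> itself; away from \<open>i\<close> the second
    evaluation is the first one after substituting \<open>fps_X ^ e\<close>.\<close>
  define \<xi>0 where "\<xi>0 = (\<lambda>j. if j = b then Y else fps_const (generic (mvar j :: ('v, 'k) mpoly)))"
  define \<xi>1 where "\<xi>1 = (\<lambda>j. if j = i then fps_X else if j = b then Y oo fps_X ^ e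
    else fps_const (generic (mvar j :: ('v, 'k) mpoly)))"
  define \<phi> where "\<phi> = mp_eval \<kappa>0 \<xi>0"
  define \<psi> where "\<psi> = mp_eval \<kappa>0 \<xi>1"
  have rhom\<phi>: "rhom \<phi>" and rhom\<psi>: "rhom \<psi>"
    unfolding \<phi>_def \<psi>_def by (rule rhom_mp_eval[OF \<kappa>0])+
  have \<phi>_mconst: "\<phi> (mconst c) = fps_const (generic (mconst c))"
    and \<psi>_mconst: "\<psi> (mconst c) = fps_const (generic (mconst c))" for c
    unfolding \<phi>_def \<psi>_def mp_eval_mconst[OF \<kappa>0] by (simp_all add: \<kappa>0_def)
  have \<phi>_mvar: "\<phi> (mvar j) = \<xi>0 j" and \<psi>_mvar: "\<psi> (mvar j) = \<xi>1 j" for j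
    unfolding \<phi>_def \<psi>_def mp_eval_mvar[OF \<kappa>0] by simp_all
  have X0: "fps_nth (fps_X ^ e :: ('v, 'k) mpoly fract alg_closure fps) 0 = 0"
    using e by (simp add: fps_nth_power_0)
  have \<psi>\<phi>: "\<psi> p = \<phi> p oo fps_X ^ e" if "p \<in> polys (I - {i})" for p
  proof (rule rhom_eq_on_polys[OF rhom\<psi> _ _ _ that])
    show "rhom (\<lambda>p. \<phi> p oo fps_X ^ e)"
      by (rule rhom_comp[OF _ rhom\<phi>])
        (simp add: rhom_def fps_compose_add_distrib fps_compose_mult_distrib[OF X0])
    show "\<psi> (mconst c) = \<phi> (mconst c) oo fps_X ^ e" for c
      by (simp add: \<phi>_mconst \<psi>_mconst)
    show "\<psi> (mvar j) = \<phi> (mvar j) oo fps_X ^ e" if "j \<in> I - {i}" for j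
      using that by (simp add: \<phi>_mvar \<psi>_mvar \<xi>0_def \<xi>1_def)
  qed
  have \<phi>_const: "\<phi> p = fps_const (generic p)" if "p \<in> polys (I - {i} - {b})" for p
  proof (rule rhom_eq_on_polys[OF rhom\<phi> rhom_comp[OF rhom_fps_const rhom_generic] _ _ that])
    show "\<phi> (mconst c) = fps_const (generic (mconst c))" for c
      by (simp add: \<phi>_mconst)
    show "\<phi> (mvar j) = fps_const (generic (mvar j))" if "j \<in> I - {i} - {b}" for j
      using that by (simp add: \<phi>_mvar \<xi>0_def)
  qed
  have \<phi>_inj: "p = 0" if p: "p \<in> polys (I - {i})" "\<phi> p = 0" for p
  proof -
    have "b \<in> I - {i}" using b by simp
    from polys_mvar_decomp[OF this p(1)] obtain N q
      where q: "\<And>j. q j \<in> polys (I - {i} - {b})" "p = (\<Sum>j<N. q j * mvar b ^ j)" by metis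
    have "(\<Sum>j<N. fps_const (generic (q j)) * Y ^ j) = \<phi> p"
      unfolding q(2) rhom.hom[OF rhom\<phi>]
      by (intro sum.cong refl) (simp add: \<phi>_const[OF q(1)] \<phi>_mvar \<xi>0_def)
    with p(2) have "(\<Sum>j<N. fps_const (generic (q j)) * Y ^ j) = 0" by simp
    from fps_nonconst_transcendental[OF this Y1] have "\<And>j. j < N \<Longrightarrow> q j = 0"
      by (simp add: generic_eq_0_iff)
    then show ?thesis using q(2) by simp
  qed
  have \<psi>_poly: "\<psi> (pb_poly I a) = 0"
  proof -
    have "\<psi> (pb_poly J a) = fps_const r"
    proof -
      have "(pb_poly J a :: ('v, 'k) mpoly) \<in> polys (I - {i} - {b})"
        by (auto intro!: polys_sum polys_power polys_mvar simp: J_def)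
      then show ?thesis
        using \<psi>\<phi>[of "pb_poly J a"] \<phi>_const[of "pb_poly J a"] polys_mono[of "I - {i} - {b}" "I - {i}"]
        by (auto simp: r_def)
    qed
    moreover have "\<psi> (mvar b ^ a b) = fps_const (- r) - fps_X ^ e"
    proof -
      have "\<psi> (mvar b ^ a b) = (Y oo fps_X ^ e) ^ a b"
        using b by (simp add: rhom.power[OF rhom\<psi>] \<psi>_mvar \<xi>1_def)
      also have "\<dots> = fps_const (- r) - fps_X ^ e"
        using X0 unfolding fps_compose_power[OF X0] Y by (simp add: fps_compose_sub_distrib)
      finally show ?thesis .
    qed
    moreover have "\<psi> (mvar i ^ a i) = fps_X ^ e"
      by (simp add: rhom.power[OF rhom\<psi>] \<psi>_mvar \<xi>1_def e_def)
    moreover have "\<psi> (pb_poly I a) = \<psi> (mvar i ^ a i) + (\<psi> (mvar b ^ a b) + \<psi> (pb_poly J a))"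
      using notin b J(2) by (simp add: I_eq rhom.add[OF rhom\<psi>])
    ultimately show ?thesis by simp
  qed
  have ker: "\<psi> p = 0 \<longleftrightarrow> (\<exists>h\<in>polys I. p = pb_poly I a * h)" if p: "p \<in> polys I" for p
  proof
    assume "\<exists>h\<in>polys I. p = pb_poly I a * h"
    then show "\<psi> p = 0" by (auto simp: rhom.hom(2)[OF rhom\<psi>] \<psi>_poly)
  next
    assume p0: "\<psi> p = 0"
    define g :: "('v, 'k) mpoly" where "g = pb_poly (I - {i}) a"
    have pb: "pb_poly I a = mvar i ^ e + g"
      using fin i by (simp add: g_def e_def sum.remove)
    have "g \<in> polys (I - {i})"
      by (auto simp: g_def intro!: polys_sum polys_power polys_mvar)
    from polys_reduce_monic[OF i e this p] obtain h q
      where hq: "h \<in> polys I" "\<And>j. q j \<in> polys (I - {i})"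
        "p = pb_poly I a * h + (\<Sum>j<e. q j * mvar i ^ j)" unfolding pb by blast
    have "\<psi> p = (\<Sum>j<e. (\<phi> (q j) oo fps_X ^ e) * fps_X ^ j)"
    proof -
      have "\<psi> (mvar i) = fps_X" by (simp add: \<psi>_mvar \<xi>1_def)
      then show ?thesis
        unfolding hq(3) rhom.add[OF rhom\<psi>] rhom.mult[OF rhom\<psi>, of "pb_poly I a"] \<psi>_poly
        by (simp add: rhom.sum[OF rhom\<psi>] rhom.mult[OF rhom\<psi>] rhom.power[OF rhom\<psi>] \<psi>\<phi>[OF hq(2)])
    qed
    with p0 have z: "(\<Sum>j<e. (\<phi> (q j) oo fps_X ^ e) * fps_X ^ j) = 0" by simp
    have "q j = 0" if j: "j < e" for j
    proof (rule \<phi>_inj[OF hq(2)], rule fps_ext)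
      fix n
      \<comment> \<open>The summand with index \<open>j'\<close> only has exponents congruent to
        \<open>j'\<close> modulo \<open>e\<close>, so the coefficient at \<open>e * n + j\<close>
        isolates the summand \<open>j\<close>.\<close>
      have "0 = fps_nth (\<Sum>j<e. (\<phi> (q j) oo fps_X ^ e) * fps_X ^ j) (e * n + j)"
        using z by simp
      also have "\<dots> = (\<Sum>j'<e. if j' = j then fps_nth (\<phi> (q j)) n else 0)"
        unfolding fps_sum_nth
      proof (intro sum.cong refl)
        fix j' assume "j' \<in> {..<e}"
        then have j': "j' < e" by simp
        have *: "j' = j" if "e dvd e * n + j - j'" "j' \<le> e * n + j"
        proof -
          from that(1) obtain k where "e * n + j - j' = e * k" by (auto simp: dvd_def)
          then have "e * n + j = e * k + j'" using that(2) by simp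
          then have "(e * n + j) mod e = (e * k + j') mod e" by simp
          then show ?thesis using j j' by simp
        qed
        show "fps_nth ((\<phi> (q j') oo fps_X ^ e) * fps_X ^ j') (e * n + j)
            = (if j' = j then fps_nth (\<phi> (q j)) n else 0)"
        proof (cases "j' = j")
          case True
          then show ?thesis
            using e by (simp add: fps_X_power_mult_right_nth fps_nth_compose_X_power)
        next
          case False
          then have "\<not> e dvd e * n + j - j' \<or> e * n + j < j'" using * by linarith
          then show ?thesis
            using False by (auto simp: fps_X_power_mult_right_nth fps_nth_compose_X_power)
        qed
      qed
      also have "\<dots> = fps_nth (\<phi> (q j)) n" using j by simp
      finally show "fps_nth (\<phi> (q j)) n = fps_nth 0 n" by simp
    qed
    then show "\<exists>h\<in>polys I. p = pb_poly I a * h" using hq by auto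
  qed
  have fls: "rhom (fps_to_fls :: ('v, 'k) mpoly fract alg_closure fps \<Rightarrow> _)"
    by unfold_locales (auto simp: fls_times_fps_to_fls)
  define \<kappa> where "\<kappa> = (\<lambda>c. fps_to_fls (\<kappa>0 c))"
  define \<xi> where "\<xi> = (\<lambda>j. fps_to_fls (\<xi>1 j))"
  have \<kappa>: "rhom \<kappa>" unfolding \<kappa>_def by (rule rhom_comp[OF fls \<kappa>0])
  have ev: "mp_eval \<kappa> \<xi> p = fps_to_fls (\<psi> p)" for p
  proof (rule rhom_eq_on_polys[OF rhom_mp_eval[OF \<kappa>] rhom_comp[OF fls rhom\<psi>], where I = UNIV])
    show "mp_eval \<kappa> \<xi> (mconst c) = fps_to_fls (\<psi> (mconst c))" for c
      unfolding mp_eval_mconst[OF \<kappa>] \<psi>_mconst by (simp add: \<kappa>_def \<kappa>0_def)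
    show "mp_eval \<kappa> \<xi> (mvar j) = fps_to_fls (\<psi> (mvar j))" for j
      unfolding mp_eval_mvar[OF \<kappa>] \<psi>_mvar by (simp add: \<xi>_def)
  qed (simp add: polys_def)
  show ?thesis
  proof (rule that)
    show "rhom \<kappa>" by (rule \<kappa>)
    show "\<xi> j \<noteq> 0" for j
    proof -
      have "fps_nth (Y oo fps_X ^ e) 0 \<noteq> fps_nth 0 0" using Y0 by simp
      then have "Y oo fps_X ^ e \<noteq> 0" by (rule contrapos_nn) simp
      moreover have "Poly_Mapping.lookup (mvar j :: ('v, 'k) mpoly) (Poly_Mapping.single j 1) \<noteq> 0"
        by (simp add: mvar_def)
      then have "(mvar j :: ('v, 'k) mpoly) \<noteq> 0" by auto
      ultimately show ?thesis by (auto simp: \<xi>_def \<xi>1_def generic_eq_0_iff)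
    qed
    show "mp_eval \<kappa> \<xi> p = 0 \<longleftrightarrow> (\<exists>h\<in>polys I. p = pb_poly I a * h)" if "p \<in> polys I" for p
      using ker[OF that] by (simp add: ev)
    show "\<exists>N. \<forall>q. mp_eval \<kappa> \<xi> p \<noteq> \<xi> i ^ N * mp_eval \<kappa> \<xi> q" if "mp_eval \<kappa> \<xi> p \<noteq> 0" for p
    proof (intro exI allI notI)
      fix q
      have "\<xi> i = fps_to_fls fps_X" by (simp add: \<xi>_def \<xi>1_def)
      \<comment> \<open>One more than the order of \<open>\<psi> p\<close>, so the coefficient at
        that order would have to vanish.\<close>
      let ?N = "Suc (subdegree (\<psi> p))"
      assume "mp_eval \<kappa> \<xi> p = \<xi> i ^ ?N * mp_eval \<kappa> \<xi> q"
      also have "\<dots> = fps_to_fls (fps_X ^ ?N * \<psi> q)"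
        using \<open>\<xi> i = fps_to_fls fps_X\<close> by (simp only: ev rhom.mult[OF fls] rhom.power[OF fls])
      finally have "\<psi> p = fps_X ^ ?N * \<psi> q" by (simp only: ev fps_to_fls_eq_iff)
      then have "fps_nth (\<psi> p) (subdegree (\<psi> p)) = fps_nth (fps_X ^ ?N * \<psi> q) (subdegree (\<psi> p))"
        by simp
      also have "\<dots> = 0"
        unfolding fps_X_power_mult_nth by simp
      finally have "fps_nth (\<psi> p) (subdegree (\<psi> p)) = 0" .
      then show False using that by (simp add: ev)
    qed
  qed
qed

section \<open>Omitting a variable, and regularity of pairs of variables\<close>

lemma set_zero_pb_poly:
  assumes "finite I" "k \<in> I" "a k > 0"
  shows "set_zero k (pb_poly I a) = pb_poly (I - {k}) a"
proof -
  have "set_zero k (pb_poly I a) = (\<Sum>j\<in>I. if j = k then 0 else mvar j ^ a j)"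
    unfolding set_zero_hom using assms(3) by (intro sum.cong) (auto simp: set_zero_mvar zero_power)
  also have "\<dots> = pb_poly (I - {k}) a"
    using assms(1) by (intro sum.mono_neutral_cong_right) auto
  finally show ?thesis .
qed

lemma pb_poly_polys: "pb_poly I a \<in> polys I"
  by (intro polys_sum polys_power polys_mvar)

lemma pb_poly_remove: "finite I \<Longrightarrow> k \<in> I \<Longrightarrow> pb_poly I a = mvar k ^ a k + pb_poly (I - {k}) a"
  by (rule sum.remove)

text \<open>The defining polynomials for \<open>I\<close> and \<open>I - {k}\<close> differ by
  \<open>mvar k ^ a k\<close>, a multiple of \<open>x_k\<close>. Hence an element that vanishes in
  the smaller ring is divisible by \<open>x_k\<close> in the larger one.\<close>

lemma pb_poly_lift:
  assumes "finite I" "k \<in> I" "a k > 0" "p \<in> polys I" "set_zero k p = pb_poly (I - {k}) a * h" "h \<in> polys I"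
  obtains r where "r \<in> polys I" "p = pb_poly I a * h + mvar k * r"
proof -
  obtain r where r: "r \<in> polys I" "p = set_zero k p + mvar k * r"
    using set_zero_decomp[OF assms(4,2)] by blast
  obtain n where n: "a k = Suc n" using assms(3) gr0_implies_Suc by blast
  show ?thesis
  proof (rule that)
    show "r - mvar k ^ n * h \<in> polys I"
      using r assms by (intro polys_diff polys_mult polys_power polys_mvar) auto
    have "pb_poly I a * h + mvar k * (r - mvar k ^ n * h) = pb_poly (I - {k}) a * h + mvar k * r"
      unfolding pb_poly_remove[OF assms(1,2)] n by (simp add: algebra_simps)
    also have "\<dots> = p"
      using r(2) unfolding assms(5) by (rule sym)
    finally show "p = pb_poly I a * h + mvar k * (r - mvar k ^ n * h)" by (rule sym)
  qed
qed

text \<open>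
  Any two of the variables form a regular sequence in the Pham-Brieskorn ring, because setting one
  of them to zero gives a Pham-Brieskorn ring in at least three variables, hence a domain.
\<close>

lemma pb_regular:
  fixes p q :: "('v::linorder, 'k::field_char_0) mpoly"
  assumes fin: "finite I" and card: "card I \<ge> 4" and apos: "\<And>j. j \<in> I \<Longrightarrow> a j > 0"
    and jk: "j \<in> I" "k \<in> I" "j \<noteq> k"
    and pq: "p \<in> polys I" "q \<in> polys I" "h \<in> polys I"
    and eq: "mvar j * p - mvar k * q = pb_poly I a * h"
  obtains r s where "r \<in> polys I" "s \<in> polys I" "p = pb_poly I a * s + mvar k * r"
proof -
  have "card (I - {k}) \<ge> 3" "finite (I - {k})" "j \<in> I - {k}" and apos': "\<And>l. l \<in> I - {k} \<Longrightarrow> a l > 0"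
    using fin card jk apos by auto
  show ?thesis
  proof (rule pb_embedding[of "I - {k}" j a, OF \<open>finite (I - {k})\<close> \<open>card (I - {k}) \<ge> 3\<close> \<open>j \<in> I - {k}\<close> apos'])
    fix \<kappa> :: "'k \<Rightarrow> ('v, 'k) mpoly fract alg_closure fls" and \<xi>
    assume \<kappa>: "rhom \<kappa>" and \<xi>: "\<And>j. \<xi> j \<noteq> 0"
      and ker: "\<And>p. p \<in> polys (I - {k}) \<Longrightarrow>
        mp_eval \<kappa> \<xi> p = 0 \<longleftrightarrow> (\<exists>h\<in>polys (I - {k}). p = pb_poly (I - {k}) a * h)"
  \<comment> \<open>Modulo \<open>x_k\<close> the second product disappears, and \<open>x_j\<close>
    can be cancelled because the remaining ring embeds into a field.\<close>
  have "set_zero k (mvar j * p - mvar k * q) = pb_poly (I - {k}) a * set_zero k h"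
    unfolding eq rhom.mult[OF rhom_set_zero] set_zero_pb_poly[of I k a, OF fin jk(2) apos[OF jk(2)]] ..
  then have "mvar j * set_zero k p = pb_poly (I - {k}) a * set_zero k h"
    using jk(3) by (simp add: rhom.diff[OF rhom_set_zero] rhom.mult[OF rhom_set_zero] set_zero_mvar)
  moreover have "mvar j * set_zero k p \<in> polys (I - {k})"
    using jk pq by (intro polys_mult polys_mvar set_zero_polys) auto
  ultimately have "mp_eval \<kappa> \<xi> (mvar j * set_zero k p) = 0"
    using ker set_zero_polys[OF pq(3)] by blast
  then have "mp_eval \<kappa> \<xi> (set_zero k p) = 0"
    using \<xi> by (simp add: mp_eval_mult[OF \<kappa>] mp_eval_mvar[OF \<kappa>])
  then obtain s where s: "s \<in> polys (I - {k})" "set_zero k p = pb_poly (I - {k}) a * s"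
    using ker set_zero_polys[OF pq(1)] by blast
  have s': "s \<in> polys I" using s(1) by (rule polys_mono[rotated]) auto
  obtain r where "r \<in> polys I" "p = pb_poly I a * s + mvar k * r"
    by (rule pb_poly_lift[of I k a, OF fin jk(2) apos[OF jk(2)] pq(1) s(2) s'])
  then show ?thesis using s' by (intro that)
  qed
qed

section \<open>Locally nilpotent derivations of subrings of a field\<close>

text \<open>\<open>D\<close> is a function on the whole field that is constrained only on the
  subring \<open>A\<close>. Having \<open>A\<close> inside a field provides the absence of zero
  divisors on which additivity of degrees rests.\<close>

locale field_lnd =
  fixes A :: "'f::field_char_0 set" and D :: "'f \<Rightarrow> 'f"
  assumes A_1: "1 \<in> A"
    and A_add: "x \<in> A \<Longrightarrow> y \<in> A \<Longrightarrow> x + y \<in> A"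
    and A_mult: "x \<in> A \<Longrightarrow> y \<in> A \<Longrightarrow> x * y \<in> A"
    and D_A: "x \<in> A \<Longrightarrow> D x \<in> A"
    and D_add: "x \<in> A \<Longrightarrow> y \<in> A \<Longrightarrow> D (x + y) = D x + D y"
    and D_mult: "x \<in> A \<Longrightarrow> y \<in> A \<Longrightarrow> D (x * y) = D x * y + x * D y"
    and D_nilpotent: "x \<in> A \<Longrightarrow> \<exists>n. (D ^^ n) x = 0"
begin

lemma D_1: "D 1 = 0"
  using D_mult[OF A_1 A_1] by simp

text \<open>The iterates of \<open>D\<close> at \<open>1\<close> stay in \<open>A\<close> and reach
  zero.\<close>

lemma A_0: "0 \<in> A"
proof -
  have "(D ^^ n) 1 \<in> A" for n by (induction n) (auto simp: A_1 D_A)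
  moreover obtain n where "(D ^^ n) 1 = 0" using D_nilpotent[OF A_1] by blast
  ultimately show ?thesis by metis
qed

lemma D_0: "D 0 = 0"
  using D_add[OF A_0 A_0] by simp

lemma A_of_nat: "of_nat n \<in> A"
  by (induction n) (auto simp: A_0 A_1 A_add)

lemma D_of_nat: "D (of_nat n) = 0"
  by (induction n) (simp_all add: D_0 D_1 D_add A_1 A_of_nat)

lemma A_sum: "(\<And>x. x \<in> S \<Longrightarrow> g x \<in> A) \<Longrightarrow> sum g S \<in> A"
  by (induction S rule: infinite_finite_induct) (auto simp: A_0 A_add)

lemma D_sum: "(\<And>x. x \<in> S \<Longrightarrow> g x \<in> A) \<Longrightarrow> D (sum g S) = (\<Sum>x\<in>S. D (g x))"
  by (induction S rule: infinite_finite_induct) (auto simp: D_0 D_add A_sum)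

lemma D_pow_A: "x \<in> A \<Longrightarrow> (D ^^ n) x \<in> A"
  by (induction n) (auto simp: D_A)

lemma D_pow_0: "(D ^^ n) 0 = 0"
  by (induction n) (auto simp: D_0)

lemma Leibniz:
  assumes x: "x \<in> A" and y: "y \<in> A"
  shows "(D ^^ n) (x * y) = (\<Sum>k\<le>n. of_nat (n choose k) * ((D ^^ k) x * (D ^^ (n - k)) y))"
proof (induction n)
  case 0
  show ?case by simp
next
  case (Suc n)
  define u where "u = (\<lambda>k. (D ^^ k) x)"
  define v where "v = (\<lambda>k. (D ^^ k) y)"
  have uv: "u k \<in> A" "v k \<in> A" "D (u k) = u (Suc k)" "D (v k) = v (Suc k)" for k
    using x y by (auto simp: u_def v_def D_pow_A)
  have "(D ^^ Suc n) (x * y) = D (\<Sum>k\<le>n. of_nat (n choose k) * (u k * v (n - k)))"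
    using Suc by (simp add: u_def v_def)
  also have "\<dots> = (\<Sum>k\<le>n. of_nat (n choose k) * (u (Suc k) * v (n - k) + u k * v (Suc n - k)))"
    by (subst D_sum)
      (auto simp: uv A_mult A_of_nat D_of_nat D_mult Suc_diff_le intro!: sum.cong)
  also have "\<dots> = (\<Sum>k\<le>n. of_nat (n choose k) * (u (Suc k) * v (n - k)))
      + (\<Sum>k\<le>n. of_nat (n choose k) * (u k * v (Suc n - k)))"
    by (simp add: distrib_left sum.distrib)
  also have "(\<Sum>k\<le>n. of_nat (n choose k) * (u k * v (Suc n - k)))
      = (\<Sum>k\<le>Suc n. of_nat (n choose k) * (u k * v (Suc n - k)))"
    by simp
  also have "\<dots> = u 0 * v (Suc n) + (\<Sum>k\<le>n. of_nat (n choose Suc k) * (u (Suc k) * v (n - k)))"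
    by (subst sum.atMost_Suc_shift) simp
  also have "(\<Sum>k\<le>n. of_nat (n choose k) * (u (Suc k) * v (n - k))) + \<dots>
      = u 0 * v (Suc n) + (\<Sum>k\<le>n. of_nat (Suc n choose Suc k) * (u (Suc k) * v (Suc n - Suc k)))"
    by (simp add: sum.distrib distrib_right)
  also have "\<dots> = (\<Sum>k\<le>Suc n. of_nat (Suc n choose k) * (u k * v (Suc n - k)))"
    by (subst sum.atMost_Suc_shift) simp
  finally show ?case by (simp add: u_def v_def)
qed

text \<open>The degree function of a locally nilpotent derivation, as a relation so that zero needs
  no conventional degree.\<close>

definition has_deg :: "'f \<Rightarrow> nat \<Rightarrow> bool" where
  "has_deg x n \<longleftrightarrow> x \<in> A \<and> (D ^^ n) x \<noteq> 0 \<and> (D ^^ Suc n) x = 0"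

lemma D_pow_eq_0_mono: "(D ^^ n) x = 0 \<Longrightarrow> n \<le> m \<Longrightarrow> (D ^^ m) x = 0"
proof -
  assume *: "(D ^^ n) x = 0" "n \<le> m"
  have "(D ^^ (m - n + n)) x = (D ^^ (m - n)) ((D ^^ n) x)"
    by (simp only: funpow_add comp_apply)
  then show ?thesis using * by (simp add: D_pow_0)
qed

lemma has_deg_exists: "x \<in> A \<Longrightarrow> x \<noteq> 0 \<Longrightarrow> \<exists>n. has_deg x n"
proof -
  assume x: "x \<in> A" "x \<noteq> 0"
  define m where "m = (LEAST n. (D ^^ n) x = 0)"
  have m: "(D ^^ m) x = 0" using D_nilpotent[OF x(1)] unfolding m_def by (rule LeastI_ex)
  then have "m \<noteq> 0" using x by (intro notI) simp
  then obtain k where k: "m = Suc k" using not0_implies_Suc by blast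
  then have "(D ^^ k) x \<noteq> 0" using not_less_Least[of k "\<lambda>n. (D ^^ n) x = 0"] unfolding m_def by simp
  then show ?thesis using m k x by (auto simp: has_deg_def)
qed

lemma has_deg_unique: "has_deg x m \<Longrightarrow> has_deg x n \<Longrightarrow> m = n"
  using D_pow_eq_0_mono[of "Suc m" x n] D_pow_eq_0_mono[of "Suc n" x m]
  by (cases m n rule: linorder_cases) (auto simp: has_deg_def Suc_le_eq simp del: funpow.simps)

text \<open>In the Leibniz expansion of order \<open>m + n\<close> only the term
  \<open>k = m\<close> survives. Its binomial coefficient is nonzero in characteristic 0; one order
  higher, every term has a vanishing factor.\<close>

lemma has_deg_mult:
  assumes x: "has_deg x m" and y: "has_deg y n"
  shows "has_deg (x * y) (m + n)"
proof -
  have A: "x \<in> A" "y \<in> A" using x y by (auto simp: has_deg_def)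
  have u: "(D ^^ k) x = 0" if "k > m" for k
    using x D_pow_eq_0_mono[of "Suc m" x k] that by (auto simp: has_deg_def)
  have v: "(D ^^ k) y = 0" if "k > n" for k
    using y D_pow_eq_0_mono[of "Suc n" y k] that by (auto simp: has_deg_def)
  have "(D ^^ (m + n)) (x * y) = (\<Sum>k\<le>m + n. if k = m then of_nat (m + n choose m) * ((D ^^ m) x * (D ^^ n) y) else 0)"
    unfolding Leibniz[OF A]
  proof (intro sum.cong refl)
    fix k
    show "of_nat (m + n choose k) * ((D ^^ k) x * (D ^^ (m + n - k)) y)
        = (if k = m then of_nat (m + n choose m) * ((D ^^ m) x * (D ^^ n) y) else 0)"
      using u[of k] v[of "m + n - k"] by (cases k m rule: linorder_cases) auto
  qed
  also have "\<dots> = of_nat (m + n choose m) * ((D ^^ m) x * (D ^^ n) y)" by simp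
  also have "\<dots> \<noteq> 0" using x y by (simp add: has_deg_def)
  finally have "(D ^^ (m + n)) (x * y) \<noteq> 0" .
  moreover have "(D ^^ Suc (m + n)) (x * y) = 0"
    unfolding Leibniz[OF A]
  proof (intro sum.neutral ballI)
    fix k
    show "of_nat (Suc (m + n) choose k) * ((D ^^ k) x * (D ^^ (Suc (m + n) - k)) y) = 0"
      using u[of k] v[of "Suc (m + n) - k"] by (cases "k > m") auto
  qed
  ultimately show ?thesis using A by (simp add: has_deg_def A_mult)
qed

lemma has_deg_of_nat: "n > 0 \<Longrightarrow> has_deg (of_nat n) 0"
  by (simp add: has_deg_def A_of_nat D_of_nat)

lemma has_deg_power: "has_deg x m \<Longrightarrow> has_deg (x ^ n) (n * m)"
  using has_deg_of_nat[of 1] by (induction n) (auto intro: has_deg_mult)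

text \<open>The degrees of \<open>x\<close> and \<open>y\<close> are natural numbers that add up to
  the degree 0 of \<open>1\<close>.\<close>

lemma D_unit:
  assumes "x \<in> A" "y \<in> A" "x * y = 1"
  shows "D x = 0"
proof -
  have "x \<noteq> 0" "y \<noteq> 0" using assms(3) by auto
  then obtain m n where "has_deg x m" "has_deg y n" using has_deg_exists assms by blast
  then have "has_deg 1 (m + n)" and "has_deg x m" using has_deg_mult[of x m y n] assms(3) by auto
  then show ?thesis
    using has_deg_unique[OF has_deg_of_nat[of 1], of "m + n"] by (simp add: has_deg_def)
qed

text \<open>
  The recurrence is satisfied by the \<open>d\<close>-th powers of the iterated derivatives of an element \<open>b\<close> with
  \<open>b ^ d \<in> A\<close>, under an extension of \<open>D\<close>. It lowers the degree by \<open>d\<close> in each step, so the extension is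
  nilpotent at \<open>b\<close>.
\<close>

lemma root_recurrence_terminates:
  assumes d: "d > 0" and A: "\<And>k. z k \<in> A"
    and rec: "\<And>k. D (z k) ^ d = of_nat (d ^ d) * (z k ^ (d - 1) * z (Suc k))"
  shows "\<exists>k. z k = 0"
proof -
  have "\<exists>k. z k = 0" if "has_deg (z k) m" for m k
    using that
  proof (induction m arbitrary: k rule: less_induct)
    case (less m)
    have z: "z k \<noteq> 0" using less.prems by (auto simp: has_deg_def D_pow_0)
    show ?case
    proof (cases "z (Suc k) = 0")
      case False
      then obtain n where n: "has_deg (z (Suc k)) n" using has_deg_exists A by blast
      have "D (z k) \<noteq> 0" using rec[of k] False z d by (auto simp: zero_power)
      then obtain m' where m': "m = Suc m'"
        using less.prems by (cases m) (auto simp: has_deg_def)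
      have "has_deg (D (z k)) m'"
        using less.prems by (simp add: m' has_deg_def D_A funpow_swap1)
      then have "has_deg (D (z k) ^ d) (d * m')" by (rule has_deg_power)
      moreover have "has_deg (of_nat (d ^ d) * (z k ^ (d - 1) * z (Suc k))) (0 + ((d - 1) * m + n))"
        by (intro has_deg_mult has_deg_of_nat has_deg_power less.prems n) (use d in simp)
      \<comment> \<open>Since \<open>m = Suc m'\<close>, this amounts to
        \<open>n + d = m\<close>.\<close>
      ultimately have "d * m' = (d - 1) * m + n"
        using has_deg_unique by (simp add: rec)
      moreover obtain d' where "d = Suc d'" using d by (cases d) auto
      ultimately have "n < m" by (simp add: m')
      then show ?thesis using less.IH n by blast
    qed blast
  qed
  then show ?thesis using has_deg_exists[OF A[of 0]] by blast
qed

end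

section \<open>Extension to the localization\<close>

text \<open>Bezout coefficients may be negative; modulo \<open>d\<close> they can be replaced by
  their remainders. Natural coefficients are needed because they become exponents of a
  monomial.\<close>

lemma Gcd_combination_mod:
  fixes w :: "'v \<Rightarrow> nat"
  assumes "finite T" "d > 0"
  obtains c where "[(\<Sum>k\<in>T. c k * w k) = Gcd (w ` T)] (mod d)"
proof -
  have "\<exists>c. [(\<Sum>k\<in>T. c k * w k) = Gcd (w ` T)] (mod d)"
    using assms(1)
  proof (induction T rule: finite_induct)
    case empty
    show ?case by simp
  next
    case (insert x T)
    then obtain c where c: "[(\<Sum>k\<in>T. c k * w k) = Gcd (w ` T)] (mod d)" by blast
    obtain y z where yz: "[y * w x + z * Gcd (w ` T) = gcd (w x) (Gcd (w ` T))] (mod d)"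
    proof -
      obtain p q where pq: "p * int (w x) + q * int (Gcd (w ` T)) = gcd (int (w x)) (int (Gcd (w ` T)))"
        using bezout_int by blast
      show ?thesis
      proof
        have "[int (nat (p mod int d) * w x + nat (q mod int d) * Gcd (w ` T))
            = p * int (w x) + q * int (Gcd (w ` T))] (mod int d)"
          using assms(2) by (auto simp: cong_def mod_add_eq mod_mult_left_eq intro!: mod_add_cong)
        then show "[nat (p mod int d) * w x + nat (q mod int d) * Gcd (w ` T) = gcd (w x) (Gcd (w ` T))] (mod d)"
          unfolding pq by (simp flip: cong_int_iff)
      qed
    qed
    have "[(\<Sum>k\<in>T. z * c k * w k) = z * Gcd (w ` T)] (mod d)"
      using cong_scalar_left[OF c, of z] by (simp add: sum_distrib_left mult.assoc)
    then have "[y * w x + (\<Sum>k\<in>T. z * c k * w k) = gcd (w x) (Gcd (w ` T))] (mod d)"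
      using cong_trans[OF cong_add[OF cong_refl] yz] by blast
    moreover have "(\<Sum>k\<in>T. (if k = x then y else z * c k) * w k) = (\<Sum>k\<in>T. z * c k * w k)"
      using insert by (intro sum.cong) auto
    ultimately show ?case
      using insert by (intro exI[of _ "\<lambda>k. if k = x then y else z * c k"]) simp
  qed
  then show ?thesis using that by blast
qed

text \<open>Of the embedding only the kernel on \<open>polys I\<close> is kept, so the rest does not
  depend on Laurent series. That every \<open>\<xi> j\<close> is nonzero, even outside
  \<open>I\<close>, allows division by any monomial.\<close>

locale pb_model =
  fixes I :: "'v set" and a :: "'v \<Rightarrow> nat" and i :: 'v
    and \<kappa> :: "'k::field_char_0 \<Rightarrow> 'f::field_char_0" and \<xi> :: "'v \<Rightarrow> 'f"
  assumes fin: "finite I" and i: "i \<in> I" and apos: "\<And>j. j \<in> I \<Longrightarrow> a j > 0"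
    and \<kappa>: "rhom \<kappa>" and \<xi>: "\<And>j. \<xi> j \<noteq> 0"
    and ker: "\<And>p. p \<in> polys I \<Longrightarrow> mp_eval \<kappa> \<xi> p = 0 \<longleftrightarrow> (\<exists>h\<in>polys I. p = pb_poly I a * h)"
begin

section \<open>Weights, and the localization and its degree-0 part as subsets of the field\<close>

definition \<psi> :: "('v, 'k) mpoly \<Rightarrow> 'f" where "\<psi> = mp_eval \<kappa> \<xi>"

definition w :: "'v \<Rightarrow> nat" where "w j = Lcm (a ` I) div a j"

abbreviation "wt \<equiv> weighted_degree I a"
abbreviation "J \<equiv> I - {i}"
abbreviation "f \<equiv> \<xi> i"
abbreviation "d \<equiv> w i"

definition B\<^sub>f :: "'f set" where
  "B\<^sub>f = {v. \<exists>M. \<exists>p\<in>polys I. f ^ M * v = \<psi> p}"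

definition A\<^sub>0 :: "'f set" where
  "A\<^sub>0 = {\<psi> q / f ^ k | q k. q \<in> polys I \<and> homog wt (k * d) q}"

lemma rhom_\<psi>: "rhom \<psi>"
  unfolding \<psi>_def by (rule rhom_mp_eval[OF \<kappa>])

lemmas \<psi>_hom = rhom.hom[OF rhom_\<psi>]

lemma \<psi>_mconst: "\<psi> (mconst c) = \<kappa> c"
  unfolding \<psi>_def by (rule mp_eval_mconst[OF \<kappa>])

lemma \<psi>_mvar: "\<psi> (mvar j) = \<xi> j"
  unfolding \<psi>_def by (rule mp_eval_mvar[OF \<kappa>])

lemma \<psi>_single: "\<psi> (Poly_Mapping.single m c) = \<kappa> c * monom_eval \<xi> m"
  unfolding \<psi>_def by (rule mp_eval_single[OF \<kappa>])

lemma ker': "p \<in> polys I \<Longrightarrow> \<psi> p = 0 \<longleftrightarrow> (\<exists>h\<in>polys I. p = pb_poly I a * h)"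
  unfolding \<psi>_def by (rule ker)

lemma \<psi>_pb_poly: "\<psi> (pb_poly I a) = 0"
  unfolding ker'[OF pb_poly_polys] by (rule bexI[of _ 1]) auto

lemma w_mult: "j \<in> I \<Longrightarrow> a j * w j = Lcm (a ` I)"
  by (simp add: w_def)

lemma Lcm_pos: "Lcm (a ` I) > 0"
proof -
  have "0 \<notin> a ` I" using apos by fastforce
  then show ?thesis using fin by (simp add: Lcm_0_iff zero_less_iff_neq_zero)
qed

lemma w_pos: "j \<in> I \<Longrightarrow> w j > 0"
  using w_mult[of j] Lcm_pos by (cases "w j = 0") auto

lemma d_pos: "d > 0"
  by (rule w_pos[OF i])

lemma wt_eq: "wt m = (\<Sum>j\<in>I. Poly_Mapping.lookup m j * w j)"
  by (simp add: weighted_degree_def w_def)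

sublocale additive_weight wt
  by unfold_locales (simp add: wt_eq lookup_add distrib_right sum.distrib)

lemma wt_single: "j \<in> I \<Longrightarrow> wt (Poly_Mapping.single j n) = n * w j"
  using fin by (simp add: wt_eq lookup_single when_def if_distrib[of "\<lambda>x. x * _"] cong: if_cong)

lemma homog_mvar_power: "j \<in> I \<Longrightarrow> homog wt (n * w j) (mvar j ^ n)"
  by (simp add: mvar_power homog_single wt_single)

lemma homog_pb_poly: "homog wt (Lcm (a ` I)) (pb_poly I a)"
proof (intro homog_sum)
  fix j assume "j \<in> I"
  then show "homog wt (Lcm (a ` I)) (mvar j ^ a j)"
    using homog_mvar_power[of j "a j"] by (simp add: w_mult)
qed

text \<open>The relation ideal is homogeneous, so \<open>p\<close> can be replaced by its component
  of weight \<open>e'\<close> in the relation, and cancelling \<open>\<psi> q\<close> in the field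
  shows that the value is unchanged.\<close>

lemma homog_lift:
  assumes "q \<in> polys I" "q' \<in> polys I" "p \<in> polys I" "homog wt e q" "homog wt (e + e') q'"
    and eq: "\<psi> q * \<psi> p = \<psi> q'" and nz: "\<psi> q \<noteq> 0"
  obtains p' where "p' \<in> polys I" "homog wt e' p'" "\<psi> p' = \<psi> p"
proof -
  have "q * p - q' \<in> polys I" "\<psi> (q * p - q') = 0"
    using assms by (auto simp: \<psi>_hom intro!: polys_diff polys_mult)
  then obtain h where h: "q * p - q' = pb_poly I a * h" "h \<in> polys I"
    using ker' by blast
  obtain h' where h': "h' \<in> polys I" "q * hcomp wt e' p - q' = pb_poly I a * h'"
    using homog_solution[OF assms(4,5) homog_pb_poly h] by blast
  have "\<psi> q * \<psi> (hcomp wt e' p) - \<psi> q' = 0"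
    using arg_cong[OF h'(2), of \<psi>] unfolding rhom.diff[OF rhom_\<psi>] rhom.mult[OF rhom_\<psi>] \<psi>_pb_poly by simp
  then have "\<psi> (hcomp wt e' p) = \<psi> p"
    using eq nz by (metis eq_iff_diff_eq_0 mult_left_cancel)
  then show ?thesis using that hcomp_polys assms(3) homog_hcomp by blast
qed

text \<open>If the weights differed, the component of weight \<open>e\<close> of
  \<open>p - q\<close> would be \<open>p\<close>, which would then lie in the homogeneous ideal of
  relations.\<close>

lemma homog_unique:
  assumes "p \<in> polys I" "q \<in> polys I" "homog wt e p" "homog wt e' q" "\<psi> p = \<psi> q" "\<psi> p \<noteq> 0"
  shows "e = e'"
proof (rule ccontr)
  assume "e \<noteq> e'"
  have "p - q \<in> polys I" "\<psi> (p - q) = 0"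
    using assms by (auto simp: \<psi>_hom intro!: polys_diff)
  then obtain h where h: "p - q = pb_poly I a * h" "h \<in> polys I"
    using ker' by blast
  have "1 * (p - q) - 0 = pb_poly I a * h" using h by simp
  from homog_solution[OF homog_1 _ homog_pb_poly this h(2), of e] obtain h'
    where "h' \<in> polys I" "hcomp wt e (p - q) = pb_poly I a * h'" by auto
  then have "p = pb_poly I a * h'" "h' \<in> polys I"
    using \<open>e \<noteq> e'\<close> by (auto simp: hcomp_diff hcomp_homog[OF assms(3)] hcomp_homog[OF assms(4)])
  then show False using ker' assms(1,6) by blast
qed

lemma B\<^sub>f_I: "p \<in> polys I \<Longrightarrow> \<psi> p / f ^ k \<in> B\<^sub>f"
  unfolding B\<^sub>f_def using \<xi> by (intro CollectI exI[of _ k] bexI[of _ p]) auto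

lemma A\<^sub>0_B\<^sub>f: "v \<in> A\<^sub>0 \<Longrightarrow> v \<in> B\<^sub>f"
  using B\<^sub>f_I by (auto simp: A\<^sub>0_def)

lemma B\<^sub>f_\<psi>: "p \<in> polys I \<Longrightarrow> \<psi> p \<in> B\<^sub>f"
  using B\<^sub>f_I[of p 0] by simp

lemma B\<^sub>f_\<xi>: "j \<in> I \<Longrightarrow> \<xi> j \<in> B\<^sub>f"
  using B\<^sub>f_\<psi>[OF polys_mvar] by (simp add: \<psi>_mvar)

lemma B\<^sub>f_\<kappa>: "\<kappa> c \<in> B\<^sub>f"
  using B\<^sub>f_\<psi>[OF polys_mconst] by (simp add: \<psi>_mconst)

lemma B\<^sub>f_1: "1 \<in> B\<^sub>f"
  using B\<^sub>f_\<psi>[OF polys_1] by (simp add: \<psi>_hom)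

lemma B\<^sub>f_0: "0 \<in> B\<^sub>f"
  using B\<^sub>f_\<psi>[OF polys_0] by (simp add: \<psi>_hom)

lemma B\<^sub>f_mono:
  assumes "f ^ M * v = \<psi> p" "p \<in> polys I" "M \<le> N"
  obtains p' where "f ^ N * v = \<psi> p'" "p' \<in> polys I"
proof
  have "f ^ N * v = f ^ (N - M) * (f ^ M * v)"
    using assms(3) by (metis le_add_diff_inverse2 mult.assoc power_add)
  then show "f ^ N * v = \<psi> (mvar i ^ (N - M) * p)"
    unfolding assms(1) \<psi>_hom \<psi>_mvar .
  show "mvar i ^ (N - M) * p \<in> polys I"
    using i assms by (intro polys_mult polys_power polys_mvar)
qed

lemma B\<^sub>f_add: "u \<in> B\<^sub>f \<Longrightarrow> v \<in> B\<^sub>f \<Longrightarrow> u + v \<in> B\<^sub>f"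
proof -
  assume "u \<in> B\<^sub>f" "v \<in> B\<^sub>f"
  then obtain M N p q where pq: "f ^ M * u = \<psi> p" "p \<in> polys I" "f ^ N * v = \<psi> q" "q \<in> polys I"
    unfolding B\<^sub>f_def by blast
  obtain p' where p': "f ^ (M + N) * u = \<psi> p'" "p' \<in> polys I"
    using B\<^sub>f_mono[OF pq(1,2)] le_add1 by blast
  obtain q' where q': "f ^ (M + N) * v = \<psi> q'" "q' \<in> polys I"
    using B\<^sub>f_mono[OF pq(3,4)] le_add2 by blast
  show ?thesis unfolding B\<^sub>f_def
    by (intro CollectI exI[of _ "M + N"] bexI[of _ "p' + q'"])
      (use p' q' in \<open>auto simp: distrib_left \<psi>_hom polys_add\<close>)
qed

lemma B\<^sub>f_mult: "u \<in> B\<^sub>f \<Longrightarrow> v \<in> B\<^sub>f \<Longrightarrow> u * v \<in> B\<^sub>f"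
proof -
  assume "u \<in> B\<^sub>f" "v \<in> B\<^sub>f"
  then obtain M N p q where pq: "f ^ M * u = \<psi> p" "p \<in> polys I" "f ^ N * v = \<psi> q" "q \<in> polys I"
    unfolding B\<^sub>f_def by blast
  have "f ^ (M + N) * (u * v) = (f ^ M * u) * (f ^ N * v)"
    by (simp add: power_add)
  also have "\<dots> = \<psi> (p * q)"
    unfolding pq(1,3) by (rule rhom.mult[OF rhom_\<psi>, symmetric])
  finally have "f ^ (M + N) * (u * v) = \<psi> (p * q)" .
  then show ?thesis unfolding B\<^sub>f_def using pq polys_mult by blast
qed

lemma B\<^sub>f_uminus: "v \<in> B\<^sub>f \<Longrightarrow> - v \<in> B\<^sub>f"
  using B\<^sub>f_mult[OF B\<^sub>f_\<kappa>[of "- 1"], of v] by (simp add: rhom.uminus[OF \<kappa>] rhom.one[OF \<kappa>])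

lemma B\<^sub>f_power: "v \<in> B\<^sub>f \<Longrightarrow> v ^ n \<in> B\<^sub>f"
  by (induction n) (auto simp: B\<^sub>f_1 B\<^sub>f_mult)

lemma B\<^sub>f_prod: "(\<And>x. x \<in> S \<Longrightarrow> g x \<in> B\<^sub>f) \<Longrightarrow> prod g S \<in> B\<^sub>f"
  by (induction S rule: infinite_finite_induct) (auto simp: B\<^sub>f_1 B\<^sub>f_mult)

lemma B\<^sub>f_sum: "(\<And>x. x \<in> S \<Longrightarrow> g x \<in> B\<^sub>f) \<Longrightarrow> sum g S \<in> B\<^sub>f"
  by (induction S rule: infinite_finite_induct) (auto simp: B\<^sub>f_0 B\<^sub>f_add)

lemma B\<^sub>f_of_nat: "of_nat n \<in> B\<^sub>f"
  by (induction n) (auto simp: B\<^sub>f_0 B\<^sub>f_1 B\<^sub>f_add)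

lemma \<kappa>_of_nat_inverse: "n > 0 \<Longrightarrow> \<kappa> (1 / of_nat n) = 1 / of_nat n"
proof -
  assume n: "n > 0"
  have of_nat: "\<kappa> (of_nat m) = of_nat m" for m
    by (induction m) (auto simp: rhom.hom[OF \<kappa>])
  have "of_nat n * \<kappa> (1 / of_nat n) = \<kappa> (of_nat n * (1 / of_nat n))"
    by (simp only: rhom.mult[OF \<kappa>] of_nat)
  also have "\<dots> = 1" using n by (simp add: rhom.one[OF \<kappa>])
  finally show ?thesis using n by (simp add: field_simps)
qed

lemma B\<^sub>f_div_of_nat: "v \<in> B\<^sub>f \<Longrightarrow> n > 0 \<Longrightarrow> v / of_nat n \<in> B\<^sub>f"
  using B\<^sub>f_mult[OF B\<^sub>f_\<kappa>[of "1 / of_nat n"], of v] \<kappa>_of_nat_inverse[of n] by simp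

end

text \<open>\<open>regular\<close> is supplied by the domains that arise on setting a variable to
  zero; \<open>Gcd_w\<close> is the condition on \<open>S(a)\<close> expressed by the degrees of the
  variables.\<close>

locale pb_lnd = pb_model I a i \<kappa> \<xi> + field_lnd "pb_model.A\<^sub>0 I a i \<kappa> \<xi>" D
  for I :: "'v set" and a :: "'v \<Rightarrow> nat" and i :: 'v
    and \<kappa> :: "'k::field_char_0 \<Rightarrow> 'f::field_char_0" and \<xi> :: "'v \<Rightarrow> 'f" and D :: "'f \<Rightarrow> 'f" +
  assumes regular: "\<And>j k p q. j \<in> J \<Longrightarrow> k \<in> J \<Longrightarrow> j \<noteq> k \<Longrightarrow> p \<in> polys I \<Longrightarrow> q \<in> polys I \<Longrightarrow>
      \<xi> j * \<psi> p = \<xi> k * \<psi> q \<Longrightarrow> \<exists>r\<in>polys I. \<psi> p = \<xi> k * \<psi> r"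
    and Gcd_w: "\<And>j. j \<in> J \<Longrightarrow> Gcd (w ` (I - {j})) = 1"
begin

section \<open>Extending the derivation by logarithmic derivatives\<close>

lemma A\<^sub>0_I: "q \<in> polys I \<Longrightarrow> homog wt (k * d) q \<Longrightarrow> \<psi> q / f ^ k \<in> A\<^sub>0"
  unfolding A\<^sub>0_def by blast

lemma A\<^sub>0_\<kappa>: "\<kappa> c \<in> A\<^sub>0"
  using A\<^sub>0_I[of "mconst c" 0] by (simp add: \<psi>_mconst homog_mconst)

text \<open>Derivations are not assumed to be linear over the ground field. Nonzero constants are
  units of \<open>A\<^sub>0\<close>, and a locally nilpotent derivation kills units.\<close>

lemma D_\<kappa>: "D (\<kappa> c) = 0"
proof (cases "c = 0")
  case True
  then show ?thesis by (simp add: rhom.zero[OF \<kappa>] D_0)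
next
  case False
  have "\<kappa> c * \<kappa> (1 / c) = 1"
    using False by (simp add: rhom.one[OF \<kappa>] flip: rhom.mult[OF \<kappa>])
  then show ?thesis by (rule D_unit[OF A\<^sub>0_\<kappa> A\<^sub>0_\<kappa>])
qed

text \<open>The natural-number division is exact on \<open>M\<^sub>0\<close>, where this is a
  degree-0 fraction.\<close>

definition mfrac :: "('v \<Rightarrow>\<^sub>0 nat) \<Rightarrow> 'f" where
  "mfrac m = monom_eval \<xi> m / f ^ (wt m div d)"

definition logd :: "('v \<Rightarrow>\<^sub>0 nat) \<Rightarrow> 'f" where
  "logd m = D (mfrac m) / mfrac m"

definition M\<^sub>0 :: "('v \<Rightarrow>\<^sub>0 nat) set" where
  "M\<^sub>0 = {m. Poly_Mapping.keys m \<subseteq> I \<and> d dvd wt m}"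

lemma monom_eval_nonzero: "monom_eval \<xi> m \<noteq> 0"
  using \<xi> by (simp add: monom_eval_def)

lemma mfrac_nonzero: "mfrac m \<noteq> 0"
  using \<xi> monom_eval_nonzero by (simp add: mfrac_def)

lemma mfrac_A\<^sub>0: "m \<in> M\<^sub>0 \<Longrightarrow> mfrac m \<in> A\<^sub>0"
  using A\<^sub>0_I[of "Poly_Mapping.single m 1" "wt m div d"]
  by (simp add: M\<^sub>0_def mfrac_def \<psi>_single rhom.one[OF \<kappa>] polys_single homog_single)

lemma M\<^sub>0_add: "m \<in> M\<^sub>0 \<Longrightarrow> m' \<in> M\<^sub>0 \<Longrightarrow> m + m' \<in> M\<^sub>0"
  by (simp add: M\<^sub>0_def keys_add_nat wt_add)

lemma M\<^sub>0_0: "0 \<in> M\<^sub>0"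
  by (simp add: M\<^sub>0_def wt_0)

lemma logd_add:
  assumes "m \<in> M\<^sub>0" "m' \<in> M\<^sub>0"
  shows "logd (m + m') = logd m + logd m'"
proof -
  have "mfrac (m + m') = mfrac m * mfrac m'"
    using assms d_pos
    by (auto simp: mfrac_def monom_eval_add wt_add M\<^sub>0_def power_add)
  then show ?thesis
    unfolding logd_def
    using mfrac_nonzero[of m] mfrac_nonzero[of m'] D_mult[OF mfrac_A\<^sub>0[OF assms(1)] mfrac_A\<^sub>0[OF assms(2)]]
    by (simp add: field_simps)
qed

lemma logd_0: "logd 0 = 0"
  using logd_add[OF M\<^sub>0_0 M\<^sub>0_0] by simp

text \<open>The repeated sum stands for the \<open>n\<close>-fold multiple of an exponent vector,
  that is, for the \<open>n\<close>-th power of a monomial.\<close>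

lemma M\<^sub>0_multiple: "m \<in> M\<^sub>0 \<Longrightarrow> (\<Sum>k<(n::nat). m) \<in> M\<^sub>0"
  by (induction n) (auto simp: M\<^sub>0_0 M\<^sub>0_add)

lemma logd_multiple: "m \<in> M\<^sub>0 \<Longrightarrow> logd (\<Sum>k<n. m) = of_nat n * logd m"
  by (induction n) (auto simp: logd_0 logd_add M\<^sub>0_multiple distrib_right simp del: sum_constant)

lemma M\<^sub>0_d_multiple: "Poly_Mapping.keys m \<subseteq> I \<Longrightarrow> (\<Sum>k<d. m) \<in> M\<^sub>0"
proof -
  assume m: "Poly_Mapping.keys m \<subseteq> I"
  have "Poly_Mapping.keys (\<Sum>k<(n::nat). m) \<subseteq> I \<and> wt (\<Sum>k<n. m) = n * wt m" for n
    using m by (induction n) (auto simp: wt_0 keys_add_nat wt_add simp del: sum_constant)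
  then show ?thesis by (simp add: M\<^sub>0_def)
qed

text \<open>If \<open>f\<close> is to be a constant, the logarithmic derivative of
  \<open>x_j ^ d / f ^ w j\<close> must be \<open>d\<close> times that of \<open>x_j\<close>. This
  makes \<open>\<nu> j\<close> the only possible logarithmic derivative of
  \<open>x_j\<close>.\<close>

definition \<nu> :: "'v \<Rightarrow> 'f" where
  "\<nu> j = logd (\<Sum>k<d. Poly_Mapping.single j 1) / of_nat d"

definition u :: "'v \<Rightarrow> 'f" where
  "u j = \<xi> j * \<nu> j"

lemma sum_single: "(\<Sum>k<n. Poly_Mapping.single j 1) = Poly_Mapping.single j (n :: nat)"
  by (induction n) (auto simp: single_add[symmetric] simp del: sum_constant)

lemma sum_lookup_add_single:
  assumes "j \<in> I"
  shows "(\<Sum>l\<in>I. of_nat (Poly_Mapping.lookup (m + Poly_Mapping.single j 1) l) * \<nu> l)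
    = (\<Sum>l\<in>I. of_nat (Poly_Mapping.lookup m l) * \<nu> l) + \<nu> j"
proof -
  have "(\<Sum>l\<in>I. of_nat (Poly_Mapping.lookup (m + Poly_Mapping.single j 1) l) * \<nu> l)
      = (\<Sum>l\<in>I. of_nat (Poly_Mapping.lookup m l) * \<nu> l + (if l = j then \<nu> l else 0))"
    by (intro sum.cong refl) (auto simp: lookup_add lookup_single when_def algebra_simps)
  then show ?thesis using fin assms by (simp add: sum.distrib)
qed

lemma logd_d_multiple:
  assumes "Poly_Mapping.keys m \<subseteq> I"
  shows "logd (\<Sum>k<d. m) = of_nat d * (\<Sum>l\<in>I. of_nat (Poly_Mapping.lookup m l) * \<nu> l)"
  using assms
proof (induction rule: monom_induct)
  case zero
  show ?case by (simp add: logd_0)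
next
  case (var m j)
  have "logd (\<Sum>k<d. m + Poly_Mapping.single j 1)
      = logd (\<Sum>k<d. m) + logd (\<Sum>k<d. Poly_Mapping.single j 1)"
    unfolding sum.distrib using var by (intro logd_add M\<^sub>0_d_multiple) auto
  also have "logd (\<Sum>k<d. Poly_Mapping.single j 1) = of_nat d * \<nu> j"
    using d_pos by (simp add: \<nu>_def del: sum_constant)
  finally show ?case
    unfolding sum_lookup_add_single[OF var(1)] var.IH by (simp add: distrib_left)
qed

text \<open>The \<open>d\<close>-fold multiples of all exponent vectors lie in
  \<open>M\<^sub>0\<close>, even those of single variables. There additivity decomposes
  \<open>logd\<close> into the contributions of the variables, and \<open>d\<close> can be
  cancelled.\<close>

lemma logd_eq:
  assumes "m \<in> M\<^sub>0"
  shows "logd m = (\<Sum>l\<in>I. of_nat (Poly_Mapping.lookup m l) * \<nu> l)"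
proof -
  have "of_nat d * logd m = of_nat d * (\<Sum>l\<in>I. of_nat (Poly_Mapping.lookup m l) * \<nu> l)"
    using logd_multiple[OF assms, of d] logd_d_multiple[of m] assms by (simp add: M\<^sub>0_def)
  then show ?thesis using d_pos by simp
qed

text \<open>The fraction that defines \<open>\<nu> i\<close> is \<open>f ^ d / f ^ d\<close>, hence
  1: the extension does treat \<open>f\<close> as a constant.\<close>

lemma u_i: "u i = 0"
proof -
  have "mfrac (Poly_Mapping.single i d) = 1"
    using i \<xi> d_pos by (simp add: mfrac_def wt_single)
  then show ?thesis
    unfolding u_def \<nu>_def sum_single logd_def by (simp add: D_1)
qed

text \<open>Defined on polynomials, with values in the field; \<open>E_cong\<close> shows afterwards
  that it depends only on the value under \<open>\<psi>\<close>.\<close>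

definition E :: "('v, 'k) mpoly \<Rightarrow> 'f" where
  "E = mderiv \<kappa> \<xi> u"

lemma E_add: "E (p + q) = E p + E q"
  unfolding E_def by (rule mderiv_add[OF \<kappa>])

lemma E_diff: "E (p - q) = E p - E q"
  unfolding E_def by (rule mderiv_diff[OF \<kappa>])

lemma E_mult: "E (p * q) = E p * \<psi> q + \<psi> p * E q"
  unfolding E_def \<psi>_def by (rule mderiv_mult[OF \<kappa>])

lemma E_mconst: "E (mconst c) = 0"
  unfolding E_def by (rule mderiv_mconst[OF \<kappa>])

lemma E_0: "E 0 = 0"
  unfolding E_def by (rule mderiv_0[OF \<kappa>])

lemma E_mvar: "E (mvar j) = u j"
  unfolding E_def by (rule mderiv_mvar[OF \<kappa>])

lemma E_power: "E (p ^ n) = of_nat n * (\<psi> p ^ (n - 1) * E p)"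
  unfolding E_def \<psi>_def by (rule mderiv_power[OF \<kappa>])

lemma E_mvar_i_power: "E (mvar i ^ n) = 0"
  by (simp add: E_power E_mvar u_i)

lemma E_monom:
  assumes "Poly_Mapping.keys m \<subseteq> I"
  shows "E (Poly_Mapping.single m 1) = monom_eval \<xi> m * (\<Sum>l\<in>I. of_nat (Poly_Mapping.lookup m l) * \<nu> l)"
  using assms
proof (induction rule: monom_induct)
  case zero
  show ?case using E_mconst[of 1] by simp
next
  case (var m j)
  have "E (Poly_Mapping.single (m + Poly_Mapping.single j 1) 1) = E (Poly_Mapping.single m 1 * mvar j)"
    by (simp add: mult_single mvar_def)
  also have "\<dots> = E (Poly_Mapping.single m 1) * \<xi> j + monom_eval \<xi> m * u j"
    by (simp add: E_mult E_mvar \<psi>_mvar \<psi>_single rhom.one[OF \<kappa>])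
  also have "\<dots> = monom_eval \<xi> (m + Poly_Mapping.single j 1)
      * ((\<Sum>l\<in>I. of_nat (Poly_Mapping.lookup m l) * \<nu> l) + \<nu> j)"
    unfolding var.IH monom_eval_add monom_eval_single u_def by (simp add: algebra_simps)
  finally show ?case unfolding sum_lookup_add_single[OF var(1)] .
qed

lemma D_mfrac:
  assumes "m \<in> M\<^sub>0"
  shows "D (mfrac m) = E (Poly_Mapping.single m 1) / f ^ (wt m div d)"
proof -
  have "Poly_Mapping.keys m \<subseteq> I" using assms by (simp add: M\<^sub>0_def)
  have "D (mfrac m) = mfrac m * logd m"
    using mfrac_nonzero[of m] by (simp add: logd_def)
  then show ?thesis
    unfolding E_monom[OF \<open>Poly_Mapping.keys m \<subseteq> I\<close>] logd_eq[OF assms] by (simp add: mfrac_def)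
qed

text \<open>Both sides are additive and linear over the constants, so monomials of weight
  \<open>k * d\<close> suffice, and for them \<open>D_mfrac\<close> applies.\<close>

lemma D_eq_E:
  assumes "q \<in> polys I" "homog wt (k * d) q"
  shows "D (\<psi> q / f ^ k) = E q / f ^ k"
proof -
  have "q \<in> polys I \<and> homog wt (k * d) q \<and> D (\<psi> q / f ^ k) = E q / f ^ k"
  proof (rule mpoly_single_induct)
    show "0 \<in> polys I \<and> homog wt (k * d) 0 \<and> D (\<psi> 0 / f ^ k) = E 0 / f ^ k"
      by (simp add: \<psi>_hom D_0 E_0)
  next
    fix m c assume "m \<in> Poly_Mapping.keys q"
    then have m: "Poly_Mapping.keys m \<subseteq> I" "wt m = k * d"
      using assms by (auto simp: polys_def homog_def)
    then have M: "m \<in> M\<^sub>0" by (simp add: M\<^sub>0_def)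
    have k: "wt m div d = k" using d_pos by (simp add: m(2))
    have "\<psi> (Poly_Mapping.single m c) / f ^ k = \<kappa> c * mfrac m"
      by (simp add: \<psi>_single mfrac_def k)
    then have "D (\<psi> (Poly_Mapping.single m c) / f ^ k) = \<kappa> c * D (mfrac m)"
      using D_mult[OF A\<^sub>0_\<kappa> mfrac_A\<^sub>0[OF M], of c] by (simp add: D_\<kappa>)
    also have "\<dots> = E (Poly_Mapping.single m c) / f ^ k"
      unfolding D_mfrac[OF M] single_eq_mconst_mult[of m c] E_mult
      by (simp add: E_mconst \<psi>_mconst k)
    finally show "Poly_Mapping.single m c \<in> polys I \<and> homog wt (k * d) (Poly_Mapping.single m c) \<and>
        D (\<psi> (Poly_Mapping.single m c) / f ^ k) = E (Poly_Mapping.single m c) / f ^ k"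
      using m by (simp add: polys_single homog_single)
  next
    fix p q
    assume p: "p \<in> polys I \<and> homog wt (k * d) p \<and> D (\<psi> p / f ^ k) = E p / f ^ k"
      and q: "q \<in> polys I \<and> homog wt (k * d) q \<and> D (\<psi> q / f ^ k) = E q / f ^ k"
    have "D (\<psi> p / f ^ k + \<psi> q / f ^ k) = E p / f ^ k + E q / f ^ k"
      using p q D_add[OF A\<^sub>0_I A\<^sub>0_I, of p k q k] by simp
    then show "p + q \<in> polys I \<and> homog wt (k * d) (p + q) \<and> D (\<psi> (p + q) / f ^ k) = E (p + q) / f ^ k"
      using p q by (simp add: polys_add homog_add rhom.add[OF rhom_\<psi>] E_add add_divide_distrib)
  qed
  then show ?thesis by simp
qed

text \<open>The weight of the defining polynomial is \<open>a i * d\<close>. Divided by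
  \<open>f ^ a i\<close> it is therefore the zero element of \<open>A\<^sub>0\<close>, to which
  \<open>D_eq_E\<close> applies.\<close>

lemma E_pb_poly: "E (pb_poly I a) = 0"
proof -
  have "homog wt (a i * d) (pb_poly I a)"
    using homog_pb_poly w_mult[OF i] by simp
  from D_eq_E[OF pb_poly_polys this] show ?thesis
    using \<xi> by (simp add: \<psi>_pb_poly D_0)
qed

lemma E_ker: "p \<in> polys I \<Longrightarrow> \<psi> p = 0 \<Longrightarrow> E p = 0"
  using ker' by (auto simp: E_mult E_pb_poly \<psi>_pb_poly)

lemma E_cong: "p \<in> polys I \<Longrightarrow> q \<in> polys I \<Longrightarrow> \<psi> p = \<psi> q \<Longrightarrow> E p = E q"
  using E_ker[of "p - q"] by (simp add: polys_diff E_diff \<psi>_hom)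

section \<open>Removing the denominators of the values \<open>u j\<close>\<close>

lemma B\<^sub>f_\<xi>_power_u:
  assumes j: "j \<in> J"
  shows "\<xi> j ^ (d - 1) * u j \<in> B\<^sub>f"
proof -
  define m where "m = (\<Sum>k<d. Poly_Mapping.single j (1::nat))"
  have m: "m = Poly_Mapping.single j d" unfolding m_def by (rule sum_single)
  have "m \<in> M\<^sub>0" unfolding m_def using j by (intro M\<^sub>0_d_multiple) auto
  have fr: "mfrac m = \<xi> j ^ d / f ^ w j"
    using j d_pos by (simp add: mfrac_def m wt_single)
  have "of_nat d * \<nu> j = D (mfrac m) / mfrac m"
    using d_pos unfolding \<nu>_def logd_def m_def by simp
  then have "of_nat d * (\<nu> j * mfrac m) = D (mfrac m)"
    using mfrac_nonzero[of m] by (simp add: field_simps)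
  then have "of_nat d * (\<nu> j * \<xi> j ^ d) = D (mfrac m) * f ^ w j"
    using \<xi> by (simp add: fr field_simps)
  moreover have "\<xi> j ^ d = \<xi> j ^ (d - 1) * \<xi> j"
    using d_pos by (cases d) auto
  \<comment> \<open>This is the derivative of \<open>x_j ^ d\<close>, with \<open>f\<close> treated
    as a constant.\<close>
  ultimately have eq: "of_nat d * (\<xi> j ^ (d - 1) * u j) = D (mfrac m) * f ^ w j"
    by (simp add: u_def mult_ac)
  have "D (mfrac m) * f ^ w j \<in> B\<^sub>f"
    by (intro B\<^sub>f_mult A\<^sub>0_B\<^sub>f D_A mfrac_A\<^sub>0 B\<^sub>f_power B\<^sub>f_\<xi> i \<open>m \<in> M\<^sub>0\<close>)
  from B\<^sub>f_div_of_nat[OF this d_pos] show ?thesis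
    unfolding eq[symmetric] using d_pos by simp
qed

lemma B\<^sub>f_power_u:
  assumes "j \<in> J" "n \<ge> d - 1"
  shows "\<xi> j ^ n * u j \<in> B\<^sub>f"
proof -
  have eq: "\<xi> j ^ n * u j = \<xi> j ^ (n - (d - 1)) * (\<xi> j ^ (d - 1) * u j)"
    using assms(2) by (simp add: mult.assoc[symmetric] power_add[symmetric])
  show ?thesis
    unfolding eq using assms(1) by (intro B\<^sub>f_mult B\<^sub>f_power B\<^sub>f_\<xi> B\<^sub>f_\<xi>_power_u) auto
qed

text \<open>A denominator that is a power of \<open>cofactor l\<close> avoids \<open>x_l\<close>.
  Such denominators of \<open>u j\<close> for all \<open>l\<close> in \<open>J\<close> are combined
  in \<open>u_B\<^sub>f\<close>.\<close>

definition cofactor :: "'v \<Rightarrow> 'f" where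
  "cofactor l = (\<Prod>k\<in>J - {l}. \<xi> k)"

lemma B\<^sub>f_cofactor: "cofactor l \<in> B\<^sub>f"
  unfolding cofactor_def by (intro B\<^sub>f_prod B\<^sub>f_\<xi>) auto

lemma B\<^sub>f_cofactor_mono:
  assumes "cofactor l ^ n * v \<in> B\<^sub>f" "n \<le> N"
  shows "cofactor l ^ N * v \<in> B\<^sub>f"
proof -
  have eq: "cofactor l ^ N * v = cofactor l ^ (N - n) * (cofactor l ^ n * v)"
    using assms(2) by (simp add: mult.assoc[symmetric] power_add[symmetric])
  show ?thesis unfolding eq by (intro B\<^sub>f_mult B\<^sub>f_power B\<^sub>f_cofactor assms(1))
qed

text \<open>For \<open>l \<noteq> j\<close> the variable \<open>x_j\<close> is a factor of
  \<open>cofactor l\<close>, and a power of \<open>x_j\<close> already clears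
  \<open>u j\<close>.\<close>

lemma cofactor_power_u_other:
  assumes "j \<in> J" "l \<in> J" "l \<noteq> j"
  shows "cofactor l ^ d * u j \<in> B\<^sub>f"
proof -
  have "cofactor l = \<xi> j * (\<Prod>k\<in>J - {l} - {j}. \<xi> k)"
    unfolding cofactor_def using assms fin by (subst prod.remove[of _ j]) auto
  then have eq: "cofactor l ^ d * u j = (\<Prod>k\<in>J - {l} - {j}. \<xi> k) ^ d * (\<xi> j ^ d * u j)"
    by (simp add: power_mult_distrib mult_ac)
  show ?thesis
    unfolding eq by (intro B\<^sub>f_mult B\<^sub>f_power B\<^sub>f_prod B\<^sub>f_\<xi> B\<^sub>f_power_u assms(1)) auto
qed

text \<open>
  This is where the hypothesis on \<open>S(a)\<close> enters: it yields a monomial that is linear in \<open>x\<^sub>j\<close>, involves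
  neither \<open>x\<^sub>i\<close> nor another power of \<open>x\<^sub>j\<close>, and has weight divisible by the weight of \<open>x\<^sub>i\<close>.
\<close>

lemma monomial_exists:
  assumes j: "j \<in> J"
  obtains m where "Poly_Mapping.keys m \<subseteq> J - {j}" "m + Poly_Mapping.single j 1 \<in> M\<^sub>0"
proof -
  define T where "T = J - {j}"
  have T: "finite T" using fin by (simp add: T_def)
  obtain c where c: "[(\<Sum>k\<in>insert i T. c k * w k) = Gcd (w ` insert i T)] (mod d)"
    using Gcd_combination_mod[of "insert i T" d w] T d_pos by auto
  have "insert i T = I - {j}" using i j by (auto simp: T_def)
  then have "[(\<Sum>k\<in>insert i T. c k * w k) = 1] (mod d)"
    using c Gcd_w[OF j] by simp
  moreover have "(\<Sum>k\<in>insert i T. c k * w k) = c i * d + (\<Sum>k\<in>T. c k * w k)"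
    using T by (simp add: T_def)
  \<comment> \<open>The contribution of \<open>x_i\<close> is a multiple of its weight
    \<open>d\<close> and drops out, so the monomial needs no \<open>x_i\<close>.\<close>
  ultimately have c1: "[(\<Sum>k\<in>T. c k * w k) = 1] (mod d)"
    by (simp add: cong_def)
  \<comment> \<open>Modulo \<open>d\<close> this is \<open>- w j\<close>, written without
    subtraction from zero.\<close>
  define n where "n = (d - 1) * w j"
  define m where "m = (\<Sum>k\<in>T. Poly_Mapping.single k (n * c k))"
  have lookup_m: "Poly_Mapping.lookup m l = (if l \<in> T then n * c l else 0)" for l
    using T by (simp add: m_def lookup_sum lookup_single when_def sum.delta)
  have keys: "Poly_Mapping.keys m \<subseteq> T"
    by (auto simp: in_keys_iff lookup_m split: if_splits)
  have "wt m = (\<Sum>l\<in>T. n * c l * w l)"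
    unfolding wt_eq using fin by (intro sum.mono_neutral_cong_right) (auto simp: lookup_m T_def)
  also have "\<dots> = n * (\<Sum>k\<in>T. c k * w k)"
    by (simp add: sum_distrib_left mult.assoc)
  finally have "[wt m = n * 1] (mod d)"
    using cong_scalar_left[OF c1, of n] by simp
  then have "[wt m + w j = n * 1 + w j] (mod d)"
    by (intro cong_add cong_refl)
  moreover have "n * 1 + w j = d * w j"
    using d_pos by (cases d) (simp_all add: n_def)
  ultimately have "[wt m + w j = d * w j] (mod d)" by simp
  then have "d dvd wt m + w j" by (simp add: cong_def dvd_eq_mod_eq_0)
  then have "m + Poly_Mapping.single j 1 \<in> M\<^sub>0"
    using keys j by (auto simp: M\<^sub>0_def keys_add_nat wt_add wt_single T_def)
  then show ?thesis using that keys by (simp add: T_def)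
qed

text \<open>Take the logarithmic derivative of a degree-0 fraction whose numerator is linear in
  \<open>x_j\<close>. It expresses \<open>\<nu> j\<close> by the derivative of that fraction and the
  \<open>\<nu> l\<close> with \<open>l \<noteq> j\<close>, whose denominators involve only
  \<open>x_l\<close> and \<open>f\<close>. No denominator \<open>x_j\<close> is left in
  \<open>u j\<close>.\<close>

lemma cofactor_power_u_self:
  assumes j: "j \<in> J"
  shows "\<exists>N. cofactor j ^ N * u j \<in> B\<^sub>f"
proof -
  obtain m where m: "Poly_Mapping.keys m \<subseteq> J - {j}" and m': "m + Poly_Mapping.single j 1 \<in> M\<^sub>0"
    using monomial_exists[OF j] by blast
  define \<mu> where "\<mu> = m + Poly_Mapping.single j 1"
  define K where "K = wt \<mu> div d"
  define s where "s = (\<Sum>l\<in>J - {j}. of_nat (Poly_Mapping.lookup m l) * \<nu> l)"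
  have fr: "mfrac \<mu> = monom_eval \<xi> m * \<xi> j / f ^ K"
    by (simp add: mfrac_def \<mu>_def monom_eval_add K_def)
  have "(\<Sum>l\<in>I. of_nat (Poly_Mapping.lookup m l) * \<nu> l) = s"
    unfolding s_def using m fin by (intro sum.mono_neutral_right ballI) (auto simp flip: not_in_keys_iff_lookup_eq_zero)
  then have "logd \<mu> = s + \<nu> j"
    using j sum_lookup_add_single[of j m] unfolding logd_eq[OF m', folded \<mu>_def] by (simp add: \<mu>_def)
  then have D: "D (mfrac \<mu>) = mfrac \<mu> * (s + \<nu> j)"
    using mfrac_nonzero[of \<mu>] by (simp add: logd_def field_simps)
  have u: "monom_eval \<xi> m * u j = f ^ K * D (mfrac \<mu>) - monom_eval \<xi> m * \<xi> j * s"
    unfolding D unfolding fr using \<xi> by (simp add: u_def field_simps)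
  have s: "cofactor j ^ d * s \<in> B\<^sub>f"
    unfolding s_def sum_distrib_left
  proof (rule B\<^sub>f_sum)
    fix l assume l: "l \<in> J - {j}"
    have "cofactor j = \<xi> l * (\<Prod>k\<in>J - {j} - {l}. \<xi> k)"
      unfolding cofactor_def using l fin by (subst prod.remove[of _ l]) auto
    moreover have "\<xi> l ^ d = \<xi> l ^ (d - 1) * \<xi> l"
      using d_pos by (cases d) auto
    ultimately have "cofactor j ^ d * (of_nat (Poly_Mapping.lookup m l) * \<nu> l)
        = (\<Prod>k\<in>J - {j} - {l}. \<xi> k) ^ d * (of_nat (Poly_Mapping.lookup m l) * (\<xi> l ^ (d - 1) * u l))"
      by (simp add: power_mult_distrib u_def mult_ac)
    also have "\<dots> \<in> B\<^sub>f"
      using l by (intro B\<^sub>f_mult B\<^sub>f_power B\<^sub>f_prod B\<^sub>f_\<xi> B\<^sub>f_of_nat B\<^sub>f_\<xi>_power_u) auto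
    finally show "cofactor j ^ d * (of_nat (Poly_Mapping.lookup m l) * \<nu> l) \<in> B\<^sub>f" .
  qed
  have monom: "monom_eval \<xi> m \<in> B\<^sub>f"
    using m unfolding monom_eval_def by (intro B\<^sub>f_prod B\<^sub>f_power B\<^sub>f_\<xi>) auto
  have "cofactor j ^ d * (monom_eval \<xi> m * u j)
      = cofactor j ^ d * (f ^ K * D (mfrac \<mu>)) + - (monom_eval \<xi> m * \<xi> j * (cofactor j ^ d * s))"
    unfolding u by (simp add: algebra_simps)
  also have "\<dots> \<in> B\<^sub>f"
    using m' j by (intro B\<^sub>f_add B\<^sub>f_uminus B\<^sub>f_mult B\<^sub>f_power B\<^sub>f_cofactor B\<^sub>f_\<xi> i A\<^sub>0_B\<^sub>f D_A mfrac_A\<^sub>0 s monom)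
      (auto simp: \<mu>_def)
  finally have *: "cofactor j ^ d * (monom_eval \<xi> m * u j) \<in> B\<^sub>f" .
  \<comment> \<open>A common bound for the exponents of \<open>m\<close>, so that the monomial
    divides \<open>cofactor j ^ n\<close>.\<close>
  define n where "n = (\<Sum>l\<in>J - {j}. Poly_Mapping.lookup m l)"
  have n: "Poly_Mapping.lookup m l \<le> n" if "l \<in> J - {j}" for l
    unfolding n_def using fin that by (intro member_le_sum) auto
  have "cofactor j ^ n = (\<Prod>l\<in>J - {j}. \<xi> l ^ (n - Poly_Mapping.lookup m l)) * monom_eval \<xi> m"
  proof -
    have "monom_eval \<xi> m = (\<Prod>l\<in>J - {j}. \<xi> l ^ Poly_Mapping.lookup m l)"
      using fin m by (intro monom_eval_superset) auto
    then show ?thesis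
      unfolding cofactor_def prod_power_distrib
      by (auto simp: n simp flip: prod.distrib power_add intro!: prod.cong)
  qed
  then have "cofactor j ^ (n + d) * u j = (\<Prod>l\<in>J - {j}. \<xi> l ^ (n - Poly_Mapping.lookup m l))
      * (cofactor j ^ d * (monom_eval \<xi> m * u j))"
    by (simp add: power_add mult_ac)
  also have "\<dots> \<in> B\<^sub>f"
    by (intro B\<^sub>f_mult[OF _ *] B\<^sub>f_prod B\<^sub>f_power B\<^sub>f_\<xi>) auto
  finally show ?thesis ..
qed

lemma regular_B\<^sub>f:
  assumes "j \<in> J" "k \<in> J" "j \<noteq> k" "c \<in> B\<^sub>f" "b \<in> B\<^sub>f" "\<xi> j * c = \<xi> k * b"
  shows "\<exists>b'\<in>B\<^sub>f. c = \<xi> k * b'"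
proof -
  from assms(4,5) obtain M N p q where pq: "f ^ M * c = \<psi> p" "p \<in> polys I" "f ^ N * b = \<psi> q" "q \<in> polys I"
    unfolding B\<^sub>f_def by blast
  obtain p' where p': "f ^ (M + N) * c = \<psi> p'" "p' \<in> polys I"
    using B\<^sub>f_mono[OF pq(1,2)] le_add1 by blast
  obtain q' where q': "f ^ (M + N) * b = \<psi> q'" "q' \<in> polys I"
    using B\<^sub>f_mono[OF pq(3,4)] le_add2 by blast
  have "\<xi> j * \<psi> p' = f ^ (M + N) * (\<xi> j * c)"
    unfolding p'(1)[symmetric] by (simp add: mult_ac)
  also have "\<dots> = \<xi> k * \<psi> q'"
    unfolding assms(6) q'(1)[symmetric] by (simp add: mult_ac)
  finally obtain r where r: "r \<in> polys I" "\<psi> p' = \<xi> k * \<psi> r"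
    using regular[OF assms(1-3) p'(2) q'(2)] by blast
  have "c = \<xi> k * (\<psi> r / f ^ (M + N))"
    using p'(1) r(2) \<xi> by (simp add: field_simps)
  then show ?thesis using B\<^sub>f_I[OF r(1)] by blast
qed

text \<open>Regularity passes to products of powers by stripping off one variable at a time from the
  left factor.\<close>

lemma regular_prod:
  assumes l: "l \<in> J" and T: "finite T" "T \<subseteq> J - {l}"
    and c: "c \<in> B\<^sub>f" and b: "b \<in> B\<^sub>f" "(\<Prod>k\<in>T. \<xi> k ^ N) * c = \<xi> l * b"
  shows "\<exists>b'\<in>B\<^sub>f. c = \<xi> l * b'"
proof -
  have pow: "\<exists>b'\<in>B\<^sub>f. c = \<xi> l * b'"
    if "k \<in> J - {l}" "c \<in> B\<^sub>f" "b \<in> B\<^sub>f" "\<xi> k ^ n * c = \<xi> l * b" for k n b c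
    using that(2-)
  proof (induction n arbitrary: c b)
    case 0
    then show ?case by auto
  next
    case (Suc n)
    have "\<xi> k ^ n * (\<xi> k * c) = \<xi> l * b" using Suc.prems by (simp add: mult_ac)
    moreover have "\<xi> k * c \<in> B\<^sub>f" using Suc.prems that(1) by (intro B\<^sub>f_mult B\<^sub>f_\<xi>) auto
    ultimately obtain b' where "b' \<in> B\<^sub>f" "\<xi> k * c = \<xi> l * b'" using Suc by blast
    then show ?case using regular_B\<^sub>f[of k l c b'] that(1) l Suc.prems by blast
  qed
  show ?thesis
    using T c b
  proof (induction T arbitrary: c b rule: finite_induct)
    case empty
    then show ?case by auto
  next
    case (insert k T)
    have "(\<Prod>k\<in>T. \<xi> k ^ N) * (\<xi> k ^ N * c) = \<xi> l * b"
      using insert.prems insert.hyps by (simp add: mult_ac)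
    moreover have "\<xi> k ^ N * c \<in> B\<^sub>f" using insert.prems by (intro B\<^sub>f_mult B\<^sub>f_power B\<^sub>f_\<xi>) auto
    ultimately obtain b' where "b' \<in> B\<^sub>f" "\<xi> k ^ N * c = \<xi> l * b'" using insert by blast
    then show ?case using pow[of k c b' N] insert.prems by blast
  qed
qed

lemma regular_prod_power:
  assumes l: "l \<in> J" and T: "finite T" "T \<subseteq> J - {l}"
    and c: "c \<in> B\<^sub>f" and b: "b \<in> B\<^sub>f" "(\<Prod>k\<in>T. \<xi> k ^ N) * c = \<xi> l ^ n * b"
  shows "\<exists>b'\<in>B\<^sub>f. c = \<xi> l ^ n * b'"
  using c b
proof (induction n arbitrary: c)
  case 0
  then show ?case by auto
next
  case (Suc n)
  have "(\<Prod>k\<in>T. \<xi> k ^ N) * c = \<xi> l * (\<xi> l ^ n * b)" using Suc.prems by (simp add: mult_ac)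
  moreover have "\<xi> l ^ n * b \<in> B\<^sub>f" using Suc.prems l by (intro B\<^sub>f_mult B\<^sub>f_power B\<^sub>f_\<xi>) auto
  ultimately obtain c' where c': "c' \<in> B\<^sub>f" "c = \<xi> l * c'"
    using regular_prod[OF l T Suc.prems(1)] by blast
  have "(\<Prod>k\<in>T. \<xi> k ^ N) * c' = \<xi> l ^ n * b"
    using Suc.prems(3) \<xi>[of l] by (simp add: c'(2) mult_ac)
  then obtain b' where "b' \<in> B\<^sub>f" "c' = \<xi> l ^ n * b'" using Suc.IH[OF c'(1) b(1)] by blast
  then show ?case using c'(2) by (auto simp: mult_ac)
qed

text \<open>The product \<open>c\<close> of \<open>u j\<close> with the \<open>N\<close>-th powers
  of all variables in \<open>J\<close> is divisible by each \<open>x_l ^ N\<close>, because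
  \<open>cofactor l ^ N\<close> clears \<open>u j\<close>. By regularity it is divisible by the
  whole product, which is then cancelled.\<close>

lemma u_B\<^sub>f:
  assumes j: "j \<in> J"
  shows "u j \<in> B\<^sub>f"
proof -
  obtain n where n: "cofactor j ^ n * u j \<in> B\<^sub>f" using cofactor_power_u_self[OF j] by blast
  define N where "N = n + d"
  have N: "cofactor l ^ N * u j \<in> B\<^sub>f" if "l \<in> J" for l
  proof (cases "l = j")
    case True
    then show ?thesis using B\<^sub>f_cofactor_mono[OF n, of N] by (simp add: N_def)
  next
    case False
    then show ?thesis
      using B\<^sub>f_cofactor_mono[OF cofactor_power_u_other[OF j that False], of N] by (simp add: N_def)
  qed
  define c where "c = (\<Prod>k\<in>J. \<xi> k ^ N) * u j"
  have c: "c = \<xi> l ^ N * (cofactor l ^ N * u j)" if "l \<in> J" for l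
    using that fin by (simp add: c_def cofactor_def prod.remove[of J l] prod_power_distrib mult_ac)
  have c_in: "c \<in> B\<^sub>f"
    using c[OF j] N[OF j] j B\<^sub>f_mult B\<^sub>f_power B\<^sub>f_\<xi> by auto
  have "\<exists>c'\<in>B\<^sub>f. c = (\<Prod>k\<in>T. \<xi> k ^ N) * c'" if "T \<subseteq> J" for T
  proof -
    have "finite T" using that fin by (meson finite_Diff finite_subset)
    then show ?thesis using that
    proof (induction T rule: finite_induct)
      case empty
      then show ?case using c_in by auto
    next
      case (insert l T)
      then obtain c' where c': "c' \<in> B\<^sub>f" "c = (\<Prod>k\<in>T. \<xi> k ^ N) * c'" by blast
      have l: "l \<in> J" "T \<subseteq> J - {l}" using insert by auto
      have "(\<Prod>k\<in>T. \<xi> k ^ N) * c' = \<xi> l ^ N * (cofactor l ^ N * u j)"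
        using c[OF l(1)] c'(2) by simp
      from regular_prod_power[OF l(1) insert.hyps(1) l(2) c'(1) N[OF l(1)] this]
      obtain b' where "b' \<in> B\<^sub>f" "c' = \<xi> l ^ N * b'" by blast
      then show ?case using c'(2) insert.hyps by (intro bexI[of _ b']) (auto simp: mult_ac)
    qed
  qed
  from this[OF order_refl] obtain c' where "c' \<in> B\<^sub>f" "c = (\<Prod>k\<in>J. \<xi> k ^ N) * c'" by blast
  moreover have "(\<Prod>k\<in>J. \<xi> k ^ N) \<noteq> 0" using fin \<xi> by simp
  ultimately show ?thesis by (simp add: c_def)
qed

lemma common_denominator:
  obtains M where "\<And>j. j \<in> I \<Longrightarrow> \<exists>p\<in>polys I. f ^ M * u j = \<psi> p"
proof -
  have "\<exists>M. \<forall>j\<in>T. \<exists>p\<in>polys I. f ^ M * u j = \<psi> p" if "T \<subseteq> I" for T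
  proof -
    have "finite T" using that fin by (rule finite_subset)
    then show ?thesis using that
    proof (induction T rule: finite_induct)
      case empty
      then show ?case by simp
    next
      case (insert j T)
      then obtain M where M: "\<And>j. j \<in> T \<Longrightarrow> \<exists>p\<in>polys I. f ^ M * u j = \<psi> p" by blast
      have "u j \<in> B\<^sub>f" using u_B\<^sub>f u_i B\<^sub>f_0 insert by (cases "j = i") auto
      then obtain N p where p: "f ^ N * u j = \<psi> p" "p \<in> polys I" unfolding B\<^sub>f_def by blast
      have "\<exists>p\<in>polys I. f ^ (M + N) * u l = \<psi> p" if l: "l \<in> insert j T" for l
      proof (cases "l = j")
        case True
        then show ?thesis using B\<^sub>f_mono[OF p, of "M + N"] by auto
      next
        case False
        then obtain q where "f ^ M * u l = \<psi> q" "q \<in> polys I" using M l by blast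
        from B\<^sub>f_mono[OF this, of "M + N"] show ?thesis by auto
      qed
      then show ?case by blast
    qed
  qed
  from this[OF order_refl] that show ?thesis by blast
qed

end

section \<open>Reduction modulo the inverted variable\<close>

context pb_lnd
begin

text \<open>The factor \<open>g\<close> is any field element, so the lemma covers
  \<open>f ^ M\<close> as well as the quotient \<open>f ^ M / f ^ s\<close> left after dividing by a
  power of \<open>f\<close>.\<close>

lemma \<psi>_pderiv_along:
  assumes V: "\<And>j. j \<in> I \<Longrightarrow> V j \<in> polys I" "\<And>j. j \<in> I \<Longrightarrow> \<psi> (V j) = g * u j" and p: "p \<in> polys I"
  shows "\<psi> (pderiv_along V p) = g * E p"
  using p
  by (induction rule: polys_induct)
    (auto simp: pderiv_along_simps pderiv_along_mult \<psi>_hom E_add E_mult E_mvar E_mconst V(2) algebra_simps)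

lemma homog_pderiv_along:
  assumes V: "\<And>j. j \<in> I \<Longrightarrow> homog wt (w j + c) (V j)" and p: "p \<in> polys I" "homog wt e p"
  shows "homog wt (e + c) (pderiv_along V p)"
proof -
  have mon: "homog wt (wt m + c) (pderiv_along V (Poly_Mapping.single m 1))" if "Poly_Mapping.keys m \<subseteq> I" for m
    using that
  proof (induction rule: monom_induct)
    case zero
    show ?case using pderiv_along_simps(2)[of V 1] by simp
  next
    case (var m j)
    have eq: "pderiv_along V (Poly_Mapping.single (m + Poly_Mapping.single j 1) 1)
        = pderiv_along V (Poly_Mapping.single m 1) * mvar j + Poly_Mapping.single m 1 * V j"
      unfolding pderiv_along_simps(3)[of V j, symmetric] pderiv_along_mult[symmetric]
      by (simp add: mult_single mvar_def)
    have "homog wt (wt m + c + 1 * w j) (pderiv_along V (Poly_Mapping.single m 1) * mvar j)"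
      using homog_mvar_power[OF var(1), of 1] by (intro homog_mult var.IH) simp
    moreover have "homog wt (wt m + (w j + c)) (Poly_Mapping.single m 1 * V j)"
      by (intro homog_mult homog_single V var refl)
    ultimately show ?case
      unfolding eq using var(1) by (intro homog_add) (simp_all add: wt_add wt_single add_ac)
  qed
  have "homog wt (e + c) (pderiv_along V p)"
  proof (rule mpoly_single_induct[where p = p])
    show "homog wt (e + c) (pderiv_along V 0)" by (simp add: pderiv_along_simps)
  next
    fix m c' assume "m \<in> Poly_Mapping.keys p"
    then have m: "Poly_Mapping.keys m \<subseteq> I" "wt m = e" using p by (auto simp: polys_def homog_def)
    have "homog wt (0 + (e + c)) (mconst c' * pderiv_along V (Poly_Mapping.single m 1))"
      using mon[OF m(1)] m(2) by (intro homog_mult homog_mconst) simp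
    then show "homog wt (e + c) (pderiv_along V (Poly_Mapping.single m c'))"
      unfolding single_eq_mconst_mult[of m c'] pderiv_along_mult by (simp add: pderiv_along_simps)
  next
    fix q r assume "homog wt (e + c) (pderiv_along V q)" "homog wt (e + c) (pderiv_along V r)"
    then show "homog wt (e + c) (pderiv_along V (q + r))"
      by (simp add: pderiv_along_simps homog_add)
  qed
  then show ?thesis .
qed

text \<open>\<open>u j\<close> is homogeneous of the weight of \<open>x_j\<close>: it is obtained
  from the derivative of a degree-0 fraction by multiplying and dividing by homogeneous elements.
  The summand \<open>M * d\<close> is the weight of \<open>f ^ M\<close>.\<close>

lemma homog_lift_u:
  assumes j: "j \<in> I" and p: "p \<in> polys I" "f ^ M * u j = \<psi> p"
  obtains V where "V \<in> polys I" "homog wt (w j + M * d) V" "\<psi> V = f ^ M * u j"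
proof (cases "j = i")
  case True
  then show ?thesis using that[of 0] by (simp add: u_i \<psi>_hom)
next
  case False
  then have j': "j \<in> J" using j by simp
  define m where "m = (\<Sum>k<d. Poly_Mapping.single j (1::nat))"
  have m: "m = Poly_Mapping.single j d" unfolding m_def by (rule sum_single)
  have mM: "m \<in> M\<^sub>0" unfolding m_def using j by (intro M\<^sub>0_d_multiple) auto
  have fr: "mfrac m = \<xi> j ^ d / f ^ w j"
    using j d_pos by (simp add: mfrac_def m wt_single)
  have "D (mfrac m) \<in> A\<^sub>0" by (intro D_A mfrac_A\<^sub>0 mM)
  then obtain q k where q: "D (mfrac m) = \<psi> q / f ^ k" "q \<in> polys I" "homog wt (k * d) q"
    unfolding A\<^sub>0_def by blast
  have "of_nat d * \<nu> j = D (mfrac m) / mfrac m"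
    using d_pos unfolding \<nu>_def logd_def m_def by simp
  then have "of_nat d * (\<nu> j * mfrac m) = D (mfrac m)"
    using mfrac_nonzero[of m] by (simp add: field_simps)
  then have "of_nat d * (\<nu> j * mfrac m) * f ^ k = \<psi> q"
    unfolding q(1) using \<xi> by simp
  then have nu: "of_nat d * (\<nu> j * \<xi> j ^ d * f ^ k) = \<psi> q * f ^ w j"
    unfolding fr using \<xi> by (simp add: field_simps)
  have xd: "\<xi> j ^ d = \<xi> j ^ (d - 1) * \<xi> j"
    using d_pos by (cases d) auto
  \<comment> \<open>Numerator and denominator of \<open>f ^ M * u j\<close> after clearing fractions
    in \<open>nu\<close>; their weights differ by \<open>w j + M * d\<close>.\<close>
  define Q :: "('v, 'k) mpoly" where "Q = mvar j ^ (d - 1) * mvar i ^ k"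
  define Q' where "Q' = mconst (1 / of_nat d) * (mvar i ^ (M + w j) * q)"
  have "homog wt ((d - 1) * w j + k * d) Q"
    unfolding Q_def by (intro homog_mult homog_mvar_power j i)
  moreover have "homog wt (0 + ((M + w j) * d + k * d)) Q'"
    unfolding Q'_def by (intro homog_mult homog_mvar_power homog_mconst i q)
  moreover have "0 + ((M + w j) * d + k * d) = ((d - 1) * w j + k * d) + (w j + M * d)"
    using d_pos by (cases d) (simp_all add: algebra_simps)
  moreover have "Q \<in> polys I" "Q' \<in> polys I"
    unfolding Q_def Q'_def using i j q(2) by (auto intro!: polys_mult polys_power polys_mvar)
  moreover have "\<psi> Q * \<psi> p = \<psi> Q'"
  proof -
    have "\<psi> Q' = \<kappa> (1 / of_nat d) * (f ^ M * (\<psi> q * f ^ w j))"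
      by (simp add: Q'_def \<psi>_hom \<psi>_mvar \<psi>_mconst power_add mult_ac)
    also have "\<dots> = \<xi> j ^ (d - 1) * f ^ k * (f ^ M * u j)"
      unfolding nu[symmetric] xd \<kappa>_of_nat_inverse[OF d_pos] using d_pos by (simp add: u_def mult_ac)
    finally show ?thesis by (simp add: Q_def \<psi>_hom \<psi>_mvar p(2))
  qed
  moreover have "\<psi> Q \<noteq> 0" using \<xi> by (simp add: Q_def \<psi>_hom \<psi>_mvar)
  ultimately obtain V where "V \<in> polys I" "homog wt (w j + M * d) V" "\<psi> V = \<psi> p"
    using homog_lift[of Q Q' p "(d - 1) * w j + k * d" "w j + M * d"] p(1) by metis
  then show ?thesis using that p(2) by simp
qed

text \<open>Starting from a monomial, all iterates are homogeneous, so their \<open>d\<close>-th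
  powers yield elements of \<open>A\<^sub>0\<close> and the recurrence for roots applies. Sums of
  monomials follow by additivity.\<close>

lemma \<psi>_pow_pderiv_along_nilpotent:
  assumes V: "\<And>j. j \<in> I \<Longrightarrow> V j \<in> polys I" "\<And>j. j \<in> I \<Longrightarrow> \<psi> (V j) = f ^ M * u j"
      "\<And>j. j \<in> I \<Longrightarrow> homog wt (w j + M * d) (V j)"
    and p: "p \<in> polys I"
  shows "\<exists>N. \<psi> ((pderiv_along V ^^ N) p) = 0"
  using p
proof (induction rule: polys_single_induct)
  case zero
  show ?case by (rule exI[of _ 0]) (simp add: \<psi>_hom)
next
  case (single m c)
  define b where "b k = (pderiv_along V ^^ k) (Poly_Mapping.single m c)" for k
  define e where "e k = wt m + k * (M * d)" for k
  have b: "b k \<in> polys I" for k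
    unfolding b_def by (intro pderiv_along_pow_polys V polys_single single)
  have b_Suc: "b (Suc k) = pderiv_along V (b k)" for k by (simp add: b_def)
  have hb: "homog wt (e k) (b k)" for k
  proof (induction k)
    case 0
    show ?case by (simp add: b_def e_def homog_single)
  next
    case (Suc k)
    show ?case
      using homog_pderiv_along[OF V(3) b Suc] unfolding b_Suc by (simp add: e_def add_ac)
  qed
  \<comment> \<open>The numerator has weight \<open>e k * d\<close>. The factor \<open>f ^ M\<close>
    that enters \<open>b (Suc k)\<close> is cancelled by the growth of \<open>e k\<close> by
    \<open>M * d\<close>.\<close>
  define z where "z k = \<psi> (b k ^ d) / f ^ e k" for k
  have hbd: "homog wt (e k * d) (b k ^ d)" for k
    using homog_power[OF hb, of d k] by (simp add: mult.commute)
  have zA: "z k \<in> A\<^sub>0" for k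
    unfolding z_def by (intro A\<^sub>0_I polys_power b hbd)
  have "D (z k) ^ d = of_nat (d ^ d) * (z k ^ (d - 1) * z (Suc k))" for k
  proof -
    define B where "B = \<psi> (b k)"
    have bS: "\<psi> (b (Suc k)) = f ^ M * E (b k)"
      unfolding b_Suc by (rule \<psi>_pderiv_along[of V, OF V(1,2) b])
    have "D (z k) = of_nat d * (B ^ (d - 1) * E (b k)) / f ^ e k"
      unfolding z_def D_eq_E[OF polys_power[OF b] hbd] E_power B_def ..
    then have "D (z k) ^ d = of_nat (d ^ d) * ((B ^ (d - 1)) ^ d * E (b k) ^ d) / (f ^ e k) ^ d"
      by (simp add: power_mult_distrib power_divide)
    moreover have "z k = B ^ d / f ^ e k"
      by (simp add: z_def B_def \<psi>_hom)
    then have "z k ^ (d - 1) = (B ^ (d - 1)) ^ d / (f ^ e k) ^ (d - 1)"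
      by (simp add: power_divide mult.commute flip: power_mult)
    moreover have "z (Suc k) = (f ^ M) ^ d * E (b k) ^ d / (f ^ e k * (f ^ M) ^ d)"
      unfolding z_def rhom.power[OF rhom_\<psi>] bS
      by (simp add: power_mult_distrib e_def power_add power_mult mult_ac)
    then have "z (Suc k) = E (b k) ^ d / f ^ e k" using \<xi> by simp
    moreover have "(f ^ e k) ^ d = (f ^ e k) ^ (d - 1) * f ^ e k"
      using d_pos by (cases d) auto
    ultimately show ?thesis by simp
  qed
  from root_recurrence_terminates[of d z, OF d_pos zA this] obtain k where "z k = 0" by blast
  then have "\<psi> (b k) = 0" using \<xi> by (simp add: z_def \<psi>_hom)
  then show ?case unfolding b_def by blast
next
  case (add p q)
  \<comment> \<open>\<open>E\<close> respects the kernel of \<open>\<psi>\<close>, so vanishing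
    persists and both summands reach zero at a common exponent.\<close>
  have step: "\<psi> ((pderiv_along V ^^ (n + N)) r) = 0" if "\<psi> ((pderiv_along V ^^ N) r) = 0" "r \<in> polys I" for n N r
  proof (induction n)
    case 0
    then show ?case using that by simp
  next
    case (Suc n)
    have r: "(pderiv_along V ^^ (n + N)) r \<in> polys I" by (intro pderiv_along_pow_polys V that)
    show ?case
      using \<psi>_pderiv_along[of V, OF V(1,2) r] E_ker[OF r Suc] by simp
  qed
  have pow_add: "(pderiv_along V ^^ n) (p + q) = (pderiv_along V ^^ n) p + (pderiv_along V ^^ n) q" for n
    by (induction n) (auto simp: pderiv_along_simps)
  obtain N N' where N: "\<psi> ((pderiv_along V ^^ N) p) = 0" "\<psi> ((pderiv_along V ^^ N') q) = 0"
    using add by blast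
  have "\<psi> ((pderiv_along V ^^ (N' + N)) (p + q)) = 0"
    unfolding pow_add rhom.add[OF rhom_\<psi>]
    using step[OF N(1) add(1), of N'] step[OF N(2) add(2), of N] by (simp add: add.commute)
  then show ?case by blast
qed

text \<open>
  After clearing denominators, divide the derivation by the largest possible power of \<open>x\<^sub>i\<close>. Then it
  induces a nonzero locally nilpotent derivation of the quotient by \<open>x\<^sub>i\<close>.
\<close>

theorem D_zero:
  assumes sep: "\<And>p. \<psi> p \<noteq> 0 \<Longrightarrow> \<exists>N. \<forall>q. \<psi> p \<noteq> f ^ N * \<psi> q"
    and rigid: "\<And>W :: 'v \<Rightarrow> ('v, 'k) mpoly. (\<And>j. j \<in> J \<Longrightarrow> W j \<in> polys J) \<Longrightarrow>
      (\<exists>h\<in>polys J. pderiv_along W (pb_poly J a) = pb_poly J a * h) \<Longrightarrow>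
      (\<And>p. p \<in> polys J \<Longrightarrow> \<exists>N. \<exists>h\<in>polys J. (pderiv_along W ^^ N) p = pb_poly J a * h) \<Longrightarrow>
      (\<And>j. j \<in> J \<Longrightarrow> \<exists>h\<in>polys J. W j = pb_poly J a * h)"
    and x: "x \<in> A\<^sub>0"
  shows "D x = 0"
proof (rule ccontr)
  assume "D x \<noteq> 0"
  obtain q k where q: "x = \<psi> q / f ^ k" "q \<in> polys I" "homog wt (k * d) q"
    using x unfolding A\<^sub>0_def by blast
  have "\<exists>j\<in>I. u j \<noteq> 0"
  proof (rule ccontr)
    assume "\<not> ?thesis"
    then have u0: "u j = 0" if "j \<in> I" for j using that by blast
    have "E p = 0" if "p \<in> polys I" for p
      using that by (induction rule: polys_induct) (auto simp: E_add E_mult E_mconst E_mvar u0)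
    then show False using \<open>D x \<noteq> 0\<close> D_eq_E[OF q(2,3)] q by simp
  qed
  then obtain j0 where j0: "j0 \<in> I" "u j0 \<noteq> 0" by blast
  obtain M where M: "\<And>j. j \<in> I \<Longrightarrow> \<exists>p\<in>polys I. f ^ M * u j = \<psi> p" using common_denominator by blast
  have "\<exists>V. V \<in> polys I \<and> homog wt (w j + M * d) V \<and> \<psi> V = f ^ M * u j" if j: "j \<in> I" for j
  proof -
    obtain p where p: "p \<in> polys I" "f ^ M * u j = \<psi> p" using M[OF j] by blast
    obtain V where "V \<in> polys I" "homog wt (w j + M * d) V" "\<psi> V = f ^ M * u j"
      by (rule homog_lift_u[OF j p])
    then show ?thesis by blast
  qed
  then obtain V where V: "\<And>j. j \<in> I \<Longrightarrow> V j \<in> polys I" "\<And>j. j \<in> I \<Longrightarrow> homog wt (w j + M * d) (V j)"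
    "\<And>j. j \<in> I \<Longrightarrow> \<psi> (V j) = f ^ M * u j" by metis
  define Q where "Q s \<longleftrightarrow> (\<forall>j\<in>I. \<exists>p\<in>polys I. \<psi> (V j) = f ^ s * \<psi> p)" for s
  have "\<psi> (V j0) \<noteq> 0" using j0 V \<xi> by simp
  from sep[OF this] obtain N where "\<not> Q N" using j0(1) unfolding Q_def by blast
  moreover have "Q 0" unfolding Q_def using V(1) by (auto intro!: bexI[of _ "V _"])
  \<comment> \<open>By \<open>sep\<close> the value of \<open>V j0\<close> is not divisible by every
    power of \<open>f\<close>, so the induction starting from \<open>Q 0\<close> breaks down at some
    \<open>s\<close>.\<close>
  ultimately have "\<exists>s. Q s \<and> \<not> Q (Suc s)"
    by (metis nat_induct)
  then obtain s where s: "Q s" "\<not> Q (Suc s)" by blast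
  from s(1) obtain W0 where W0: "\<And>j. j \<in> I \<Longrightarrow> W0 j \<in> polys I" "\<And>j. j \<in> I \<Longrightarrow> \<psi> (V j) = f ^ s * \<psi> (W0 j)"
    unfolding Q_def by metis
  \<comment> \<open>The choice of \<open>W0\<close> only ensures that \<open>\<psi> (W0 i)\<close>
    is zero. For the derivation to descend modulo \<open>x_i\<close>, the polynomial at
    \<open>i\<close> itself has to be zero.\<close>
  define W where "W = W0(i := 0)"
  have W: "W j \<in> polys I" "\<psi> (V j) = f ^ s * \<psi> (W j)" if "j \<in> I" for j
    using W0[OF that] that V(3)[of i] by (auto simp: W_def u_i \<psi>_hom)
  have \<psi>W: "\<psi> (W j) = (f ^ M / f ^ s) * u j" if "j \<in> I" for j
    using W(2)[OF that] V(3)[OF that] \<xi> by (simp add: field_simps)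
  have W_pow: "(pderiv_along W ^^ n) p \<in> polys I" "(pderiv_along V ^^ n) p \<in> polys I"
    if "p \<in> polys I" for n p
    using that W V by (auto intro: pderiv_along_pow_polys)
  \<comment> \<open>\<open>E\<close> treats \<open>f\<close> as a constant, so the division by
    \<open>f ^ s\<close> accumulates to \<open>f ^ (s * n)\<close> and nilpotency carries over from
    \<open>V\<close> to \<open>W\<close>.\<close>
  have pow: "f ^ (s * n) * \<psi> ((pderiv_along W ^^ n) p) = \<psi> ((pderiv_along V ^^ n) p)" if p: "p \<in> polys I" for n p
  proof (induction n)
    case 0
    show ?case by simp
  next
    case (Suc n)
    define r where "r = (pderiv_along W ^^ n) p"
    define r' where "r' = (pderiv_along V ^^ n) p"
    have rr: "r \<in> polys I" "r' \<in> polys I" unfolding r_def r'_def by (intro W_pow p)+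
    have "\<psi> (mvar i ^ (s * n) * r) = \<psi> r'"
      using Suc by (simp add: \<psi>_hom \<psi>_mvar r_def r'_def)
    then have "E (mvar i ^ (s * n) * r) = E r'"
      using i rr by (intro E_cong polys_mult polys_power polys_mvar) auto
    then have E: "f ^ (s * n) * E r = E r'"
      by (simp add: E_mult E_mvar_i_power \<psi>_hom \<psi>_mvar)
    have "\<psi> (pderiv_along W r) = (f ^ M / f ^ s) * E r"
      by (rule \<psi>_pderiv_along[of W, OF W(1) \<psi>W rr(1)])
    then have "f ^ (s * Suc n) * \<psi> (pderiv_along W r) = f ^ M * (f ^ (s * n) * E r)"
      using \<xi> by (simp add: power_add mult_ac)
    also have "\<dots> = \<psi> (pderiv_along V r')"
      unfolding E by (rule \<psi>_pderiv_along[of V, OF V(1,3) rr(2), symmetric])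
    finally show ?case by (simp add: r_def r'_def)
  qed
  define W' where "W' j = set_zero i (W j)" for j
  have Wi: "W i = 0" by (simp add: W_def)
  have sz: "set_zero i ((pderiv_along W ^^ n) p) = (pderiv_along W' ^^ n) (set_zero i p)" if p: "p \<in> polys I" for n p
  proof (induction n)
    case (Suc n)
    show ?case
      using set_zero_pderiv_along[of W i, OF Wi W_pow(1)[OF p, of n]] Suc by (simp add: W'_def[abs_def])
  qed simp
  have sz_F: "set_zero i (pb_poly I a) = (pb_poly J a :: ('v, 'k) mpoly)"
    by (rule set_zero_pb_poly[of I i a, OF fin i apos[OF i]])
  have "\<exists>h\<in>polys J. W' j = pb_poly J a * h" if "j \<in> J" for j
  proof (rule rigid[of W', OF _ _ _ that])
    show "W' j \<in> polys J" if "j \<in> J" for j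
      unfolding W'_def using that by (intro set_zero_polys W) auto
    have "\<psi> (pderiv_along W (pb_poly I a)) = 0"
      using \<psi>_pderiv_along[of W, OF W(1) \<psi>W pb_poly_polys[of a I]] by (simp add: E_pb_poly)
    then obtain h where h: "h \<in> polys I" "pderiv_along W (pb_poly I a) = pb_poly I a * h"
      using ker'[OF pderiv_along_polys[where V = W, OF W(1) pb_poly_polys[of a I]]] by blast
    have "pderiv_along W' (pb_poly J a) = set_zero i (pb_poly I a * h)"
      using set_zero_pderiv_along[of W i, OF Wi pb_poly_polys[of a I]] sz_F by (simp add: h(2) W'_def[abs_def])
    also have "\<dots> = pb_poly J a * set_zero i h"
      by (simp only: rhom.mult[OF rhom_set_zero] sz_F)
    finally show "\<exists>h\<in>polys J. pderiv_along W' (pb_poly J a) = pb_poly J a * h"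
      using set_zero_polys[OF h(1)] by blast
    show "\<exists>N. \<exists>h\<in>polys J. (pderiv_along W' ^^ N) p = pb_poly J a * h" if p: "p \<in> polys J" for p
    proof -
      have p': "p \<in> polys I" using p by (rule polys_mono[rotated]) auto
      obtain N where "\<psi> ((pderiv_along V ^^ N) p) = 0"
        using \<psi>_pow_pderiv_along_nilpotent[OF V(1,3,2) p'] by blast
      then have "\<psi> ((pderiv_along W ^^ N) p) = 0" using pow[OF p', of N] \<xi> by simp
      then obtain h where h: "h \<in> polys I" "(pderiv_along W ^^ N) p = pb_poly I a * h"
        using ker' W_pow(1)[OF p'] by blast
      have "(pderiv_along W' ^^ N) p = set_zero i (pb_poly I a * h)"
        using sz[OF p', of N] set_zero_id[OF p, of i] by (simp add: h(2))
      also have "\<dots> = pb_poly J a * set_zero i h"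
        by (simp only: rhom.mult[OF rhom_set_zero] sz_F)
      finally show ?thesis using set_zero_polys[OF h(1)] by blast
    qed
  qed
  then have red: "\<exists>h\<in>polys J. set_zero i (W j) = pb_poly J a * h" if "j \<in> I" for j
    using that Wi by (cases "j = i") (auto simp: W'_def set_zero_hom intro!: bexI[of _ 0])
  \<comment> \<open>Rigidity makes every \<open>W j\<close> vanish modulo \<open>x_i\<close>, so one
    more factor \<open>f\<close> can be extracted, against the choice of \<open>s\<close>.\<close>
  have "Q (Suc s)"
    unfolding Q_def
  proof
    fix j assume j: "j \<in> I"
    obtain h where h: "h \<in> polys J" "set_zero i (W j) = pb_poly J a * h" using red[OF j] by blast
    have h': "h \<in> polys I" using h(1) by (rule polys_mono[rotated]) auto
    obtain r where r: "r \<in> polys I" "W j = pb_poly I a * h + mvar i * r"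
      by (rule pb_poly_lift[of I i a, OF fin i apos[OF i] W(1)[OF j] h(2) h'])
    have "\<psi> (W j) = f * \<psi> r"
      unfolding r(2) rhom.add[OF rhom_\<psi>] rhom.mult[OF rhom_\<psi>] \<psi>_pb_poly \<psi>_mvar by simp
    then have "\<psi> (V j) = f ^ Suc s * \<psi> r" using W(2)[OF j] by (simp add: mult_ac)
    then show "\<exists>p\<in>polys I. \<psi> (V j) = f ^ Suc s * \<psi> p" using r(1) by blast
  qed
  then show False using s(2) by blast
qed

end

section \<open>Transfer between the rings and the field\<close>

lemma carrier_mpoly_ring: "carrier (mpoly_ring TYPE('k::comm_ring_1) I) = (polys I :: ('v, 'k) mpoly set)"
  by (simp add: mpoly_ring_def polys_def)

lemma cring_mpoly_ring: "cring (mpoly_ring TYPE('k::comm_ring_1) (I :: 'v set))"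
proof (rule cringI)
  show "abelian_group (mpoly_ring TYPE('k) I)"
  proof (rule abelian_groupI)
    fix x :: "('v, 'k) mpoly" assume "x \<in> carrier (mpoly_ring TYPE('k) I)"
    then show "\<exists>y\<in>carrier (mpoly_ring TYPE('k) I). y \<oplus>\<^bsub>mpoly_ring TYPE('k) I\<^esub> x = \<zero>\<^bsub>mpoly_ring TYPE('k) I\<^esub>"
      unfolding carrier_mpoly_ring by (intro bexI[of _ "- x"]) (auto simp: mpoly_ring_def polys_uminus)
  qed (auto simp: carrier_mpoly_ring polys_add, auto simp: mpoly_ring_def polys_add add_ac)
  show "Group.comm_monoid (mpoly_ring TYPE('k) I)"
    by (rule comm_monoidI) (auto simp: carrier_mpoly_ring polys_mult, auto simp: mpoly_ring_def polys_mult mult_ac)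
qed (auto simp: mpoly_ring_def distrib_right)

lemma mpoly_var_eq: "mpoly_var TYPE('k::comm_ring_1) j = (mvar j :: ('v, 'k) mpoly)"
  by (simp add: mpoly_var_def mvar_def)

lemma pb_ideal_eq:
  "pb_ideal TYPE('k::field_char_0) (I :: 'v set) a = {pb_poly I a * h |h. h \<in> (polys I :: ('v, 'k) mpoly set)}"
  unfolding pb_ideal_def cgenideal_def carrier_mpoly_ring mpoly_var_eq
  by (auto simp: mpoly_ring_def mult.commute)

lemma ideal_pb_ideal: "ideal (pb_ideal TYPE('k::field_char_0) (I :: 'v set) a) (mpoly_ring TYPE('k) I)"
  unfolding pb_ideal_def mpoly_var_eq
  by (rule cring.cgenideal_ideal[OF cring_mpoly_ring]) (simp add: carrier_mpoly_ring pb_poly_polys)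

lemma cring_pb_ring: "cring (pb_ring TYPE('k::field_char_0) (I :: 'v set) a)"
  unfolding pb_ring_def by (rule ideal.quotient_is_cring[OF ideal_pb_ideal cring_mpoly_ring])

definition pb_class :: "'v set \<Rightarrow> ('v \<Rightarrow> nat) \<Rightarrow> ('v, 'k::field_char_0) mpoly \<Rightarrow> ('v, 'k) mpoly set" where
  "pb_class I a p = pb_ideal TYPE('k) I a +>\<^bsub>mpoly_ring TYPE('k) I\<^esub> p"

lemma pb_class_eq: "pb_class I a p = {pb_poly I a * h + p |h. h \<in> polys I}"
  unfolding pb_class_def a_r_coset_def' pb_ideal_eq by (auto simp: mpoly_ring_def)

lemma pb_class_eq_iff: "pb_class I a p = pb_class I a q \<longleftrightarrow> (\<exists>h\<in>polys I. p - q = pb_poly I a * h)"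
proof
  assume "pb_class I a p = pb_class I a q"
  moreover have "p \<in> pb_class I a p" unfolding pb_class_eq by (auto intro!: exI[of _ 0])
  ultimately show "\<exists>h\<in>polys I. p - q = pb_poly I a * h" unfolding pb_class_eq by auto
next
  assume "\<exists>h\<in>polys I. p - q = pb_poly I a * h"
  then obtain h where h: "h \<in> polys I" "p = q + pb_poly I a * h" by (auto simp: algebra_simps)
  show "pb_class I a p = pb_class I a q"
  proof (intro equalityI subsetI)
    fix x assume "x \<in> pb_class I a p"
    then obtain h' where "h' \<in> polys I" "x = pb_poly I a * h' + p" unfolding pb_class_eq by blast
    then have "x = pb_poly I a * (h' + h) + q" "h' + h \<in> polys I"
      using h by (auto simp: algebra_simps polys_add)
    then show "x \<in> pb_class I a q" unfolding pb_class_eq by blast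
  next
    fix x assume "x \<in> pb_class I a q"
    then obtain h' where "h' \<in> polys I" "x = pb_poly I a * h' + q" unfolding pb_class_eq by blast
    then have "x = pb_poly I a * (h' - h) + p" "h' - h \<in> polys I"
      using h by (auto simp: algebra_simps polys_diff)
    then show "x \<in> pb_class I a p" unfolding pb_class_eq by blast
  qed
qed

lemma carrier_pb_ring: "carrier (pb_ring TYPE('k::field_char_0) I a) = pb_class I a ` (polys I :: ('v, 'k) mpoly set)"
  unfolding pb_ring_def FactRing_def A_RCOSETS_def' pb_class_def by (auto simp: carrier_mpoly_ring)

lemma pb_class_carrier:
  fixes p :: "('v, 'k::field_char_0) mpoly"
  shows "p \<in> polys I \<Longrightarrow> pb_class I a p \<in> carrier (pb_ring TYPE('k) I a)"
  by (simp add: carrier_pb_ring)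

lemma pb_class_ring_hom: "pb_class I a \<in> ring_hom (mpoly_ring TYPE('k::field_char_0) I) (pb_ring TYPE('k) I a)"
  unfolding pb_class_def[abs_def] pb_ring_def by (rule ideal.rcos_ring_hom[OF ideal_pb_ideal])

context
  fixes I :: "'v set" and a :: "'v \<Rightarrow> nat" and p q :: "('v, 'k::field_char_0) mpoly"
  assumes pq: "p \<in> polys I" "q \<in> polys I"
begin

lemma pb_class_mult:
  "pb_class I a p \<otimes>\<^bsub>pb_ring TYPE('k) I a\<^esub> pb_class I a q = pb_class I a (p * q)"
  using ring_hom_mult[OF pb_class_ring_hom[of I a], of p q] pq
  by (simp add: carrier_mpoly_ring) (simp add: mpoly_ring_def)

lemma pb_class_add:
  "pb_class I a p \<oplus>\<^bsub>pb_ring TYPE('k) I a\<^esub> pb_class I a q = pb_class I a (p + q)"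
  using ring_hom_add[OF pb_class_ring_hom[of I a], of p q] pq
  by (simp add: carrier_mpoly_ring) (simp add: mpoly_ring_def)

end

lemma pb_class_one: "\<one>\<^bsub>pb_ring TYPE('k::field_char_0) I a\<^esub> = pb_class I a (1 :: ('v, 'k) mpoly)"
  using ring_hom_one[OF pb_class_ring_hom[where I = I and a = a and ?'k = 'k]] by (simp add: mpoly_ring_def)

lemma pb_class_zero: "\<zero>\<^bsub>pb_ring TYPE('k::field_char_0) I a\<^esub> = pb_class I a (0 :: ('v, 'k) mpoly)"
  unfolding pb_class_eq pb_ring_def FactRing_def by (simp add: pb_ideal_eq)

text \<open>The first assumption on \<open>pderiv_along W\<close> makes the ideal stable, so the
  derivation passes to the quotient, and the second makes the induced map locally nilpotent;
  rigidity is applied to the classes of the variables.\<close>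

lemma rigid_pb_ringD:
  fixes W :: "'v \<Rightarrow> ('v, 'k::field_char_0) mpoly"
  assumes rigid: "rigid (pb_ring TYPE('k) J a)"
    and W: "\<And>j. j \<in> J \<Longrightarrow> W j \<in> polys J"
    and F: "\<exists>h\<in>polys J. pderiv_along W (pb_poly J a) = pb_poly J a * h"
    and nil: "\<And>p. p \<in> polys J \<Longrightarrow> \<exists>N. \<exists>h\<in>polys J. (pderiv_along W ^^ N) p = pb_poly J a * h"
    and j: "j \<in> J"
  shows "\<exists>h\<in>polys J. W j = pb_poly J a * h"
proof -
  let ?R = "pb_ring TYPE('k) J a"
  let ?F = "pb_poly J a :: ('v, 'k) mpoly"
  let ?cl = "pb_class J a :: ('v, 'k) mpoly \<Rightarrow> _"
  have W_polys: "pderiv_along W p \<in> polys J" if "p \<in> polys J" for p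
    using W that by (rule pderiv_along_polys)
  have pow_polys: "(pderiv_along W ^^ n) p \<in> polys J" if "p \<in> polys J" for n p
    using W that by (rule pderiv_along_pow_polys)
  have ideal: "\<exists>h'\<in>polys J. pderiv_along W (?F * h) = ?F * h'" if "h \<in> polys J" for h
  proof -
    obtain g where g: "g \<in> polys J" "pderiv_along W ?F = ?F * g" using F by blast
    have "pderiv_along W (?F * h) = ?F * (g * h + pderiv_along W h)"
      unfolding pderiv_along_mult g(2) by (simp add: algebra_simps)
    moreover have "g * h + pderiv_along W h \<in> polys J" using g that W_polys by (intro polys_add polys_mult)
    ultimately show ?thesis by blast
  qed
  have cong: "?cl (pderiv_along W p) = ?cl (pderiv_along W q)" if "?cl p = ?cl q" for p q
    using that ideal unfolding pb_class_eq_iff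
    by (auto simp flip: mderiv_diff[OF rhom_mconst])
  define D where "D x = ?cl (pderiv_along W (SOME p. p \<in> polys J \<and> ?cl p = x))" for x
  have D: "D (?cl p) = ?cl (pderiv_along W p)" if "p \<in> polys J" for p
  proof -
    have "?cl (SOME q. q \<in> polys J \<and> ?cl q = ?cl p) = ?cl p"
      using someI[of "\<lambda>q. q \<in> polys J \<and> ?cl q = ?cl p" p] that by blast
    then show ?thesis unfolding D_def by (rule cong)
  qed
  have Dpow: "(D ^^ n) (?cl p) = ?cl ((pderiv_along W ^^ n) p)" if "p \<in> polys J" for n p
    using that by (induction n) (auto simp: D pow_polys)
  have "derivation ?R D"
    unfolding derivation_def
  proof (intro conjI ballI)
    show "D \<in> carrier ?R \<rightarrow> carrier ?R"
      by (auto simp: carrier_pb_ring D W_polys)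
  next
    fix b c assume "b \<in> carrier ?R" "c \<in> carrier ?R"
    then obtain p q where pq: "p \<in> polys J" "q \<in> polys J" "b = ?cl p" "c = ?cl q"
      by (auto simp: carrier_pb_ring)
    show "D (b \<oplus>\<^bsub>?R\<^esub> c) = D b \<oplus>\<^bsub>?R\<^esub> D c"
      using pq by (simp add: pb_class_add D polys_add W_polys mderiv_add[OF rhom_mconst])
    show "D (b \<otimes>\<^bsub>?R\<^esub> c) = D b \<otimes>\<^bsub>?R\<^esub> c \<oplus>\<^bsub>?R\<^esub> b \<otimes>\<^bsub>?R\<^esub> D c"
      using pq by (simp add: pb_class_add pb_class_mult D polys_mult W_polys pderiv_along_mult)
  qed
  moreover have "locally_nilpotent ?R D"
    unfolding locally_nilpotent_def
  proof
    fix b assume "b \<in> carrier ?R"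
    then obtain p where p: "p \<in> polys J" "b = ?cl p" by (auto simp: carrier_pb_ring)
    obtain N h where h: "h \<in> polys J" "(pderiv_along W ^^ N) p = ?F * h" using nil[OF p(1)] by blast
    \<comment> \<open>The extra step guarantees the positive exponent that
      \<open>locally_nilpotent\<close> demands.\<close>
    have "(D ^^ Suc N) b = ?cl (pderiv_along W (?F * h))"
      unfolding p(2) Dpow[OF p(1)] by (simp add: h(2))
    also have "\<dots> = \<zero>\<^bsub>?R\<^esub>"
      unfolding pb_class_zero pb_class_eq_iff using ideal[OF h(1)] by simp
    finally show "\<exists>m>0. (D ^^ m) b = \<zero>\<^bsub>?R\<^esub>" by blast
  qed
  ultimately have "D (?cl (mvar j)) = \<zero>\<^bsub>?R\<^esub>"
    using rigid j unfolding rigid_def by (meson pb_class_carrier polys_mvar)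
  then have "?cl (W j) = ?cl 0"
    using j by (simp add: D polys_mvar mderiv_mvar[OF rhom_mconst] pb_class_zero)
  then show ?thesis by (simp add: pb_class_eq_iff)
qed

context pb_model
begin

section \<open>Values of fractions in the field\<close>

abbreviation "R \<equiv> pb_ring TYPE('k) I a"
abbreviation "S \<equiv> powers R (pb_var TYPE('k) I a i)"
abbreviation "H \<equiv> homogeneous_localization R (pb_component TYPE('k) I a) (pb_var TYPE('k) I a i)"
abbreviation cl :: "('v, 'k) mpoly \<Rightarrow> ('v, 'k) mpoly set" where "cl \<equiv> pb_class I a"

definition \<beta> :: "('v, 'k) mpoly set \<Rightarrow> 'f" where
  "\<beta> x = \<psi> (SOME p. p \<in> polys I \<and> cl p = x)"

lemma \<beta>_class: "p \<in> polys I \<Longrightarrow> \<beta> (cl p) = \<psi> p"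
proof -
  assume p: "p \<in> polys I"
  let ?q = "SOME q. q \<in> polys I \<and> cl q = cl p"
  have q: "?q \<in> polys I \<and> cl ?q = cl p"
    by (rule someI[of _ p]) (use p in blast)
  then obtain h where "h \<in> polys I" "?q - p = pb_poly I a * h"
    unfolding pb_class_eq_iff by blast
  then have "\<psi> (?q - p) = 0"
    using ker'[of "?q - p"] q p polys_diff by blast
  then show ?thesis by (simp add: \<beta>_def \<psi>_hom)
qed

lemma class_eq_iff: "p \<in> polys I \<Longrightarrow> q \<in> polys I \<Longrightarrow> cl p = cl q \<longleftrightarrow> \<psi> p = \<psi> q"
  using ker'[of "p - q"] by (simp add: pb_class_eq_iff polys_diff \<psi>_hom)

lemma pb_var_eq: "pb_var TYPE('k) I a i = cl (mvar i)"
  by (simp add: pb_var_def pb_class_def mpoly_var_eq)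

lemma powers_eq: "S = range (\<lambda>k. cl (mvar i ^ k))"
proof -
  interpret cring R by (rule cring_pb_ring)
  have "cl (mvar i) [^]\<^bsub>R\<^esub> k = cl (mvar i ^ k)" for k :: nat
  proof (induction k)
    case 0
    show ?case by (simp add: pb_class_one)
  next
    case (Suc k)
    then show ?case
      using i by (simp add: pb_class_mult polys_power polys_mvar mult.commute)
  qed
  then show ?thesis by (simp add: powers_def pb_var_eq)
qed

lemma carrier_cases:
  assumes "x \<in> carrier R" obtains p where "p \<in> polys I" "x = cl p"
  using assms by (auto simp: carrier_pb_ring)

lemma S_cases:
  assumes "s \<in> S" obtains k where "s = cl (mvar i ^ k)"
  using assms by (auto simp: powers_eq)

lemma S_I: "cl (mvar i ^ k) \<in> S"
  by (simp add: powers_eq)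

lemma mvar_i_power: "mvar i ^ k \<in> polys I"
  by (intro polys_power polys_mvar i)

lemma \<psi>_mvar_i_power: "\<psi> (mvar i ^ k) = f ^ k"
  by (simp add: \<psi>_hom \<psi>_mvar)

lemma S_carrier: "s \<in> S \<Longrightarrow> s \<in> carrier R"
  using pb_class_carrier mvar_i_power by (auto simp: powers_eq)

lemma \<beta>_S: "s \<in> S \<Longrightarrow> \<beta> s \<noteq> 0"
  using \<xi> by (auto elim!: S_cases simp: \<beta>_class mvar_i_power \<psi>_mvar_i_power)

lemma \<beta>_mult: "x \<in> carrier R \<Longrightarrow> y \<in> carrier R \<Longrightarrow> \<beta> (x \<otimes>\<^bsub>R\<^esub> y) = \<beta> x * \<beta> y"
  by (auto elim!: carrier_cases simp: pb_class_mult \<beta>_class polys_mult \<psi>_hom)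

lemma \<beta>_add: "x \<in> carrier R \<Longrightarrow> y \<in> carrier R \<Longrightarrow> \<beta> (x \<oplus>\<^bsub>R\<^esub> y) = \<beta> x + \<beta> y"
  by (auto elim!: carrier_cases simp: pb_class_add \<beta>_class polys_add \<psi>_hom)

lemma \<beta>_inj: "x \<in> carrier R \<Longrightarrow> y \<in> carrier R \<Longrightarrow> \<beta> x = \<beta> y \<longleftrightarrow> x = y"
  by (elim carrier_cases) (simp only: \<beta>_class class_eq_iff)

lemma \<beta>_zero: "\<beta> \<zero>\<^bsub>R\<^esub> = 0"
  by (simp add: pb_class_zero \<beta>_class \<psi>_hom)

lemma one_S: "\<one>\<^bsub>R\<^esub> \<in> S"
  using S_I[of 0] by (simp add: pb_class_one)

lemma S_mult: "s \<in> S \<Longrightarrow> t \<in> S \<Longrightarrow> s \<otimes>\<^bsub>R\<^esub> t \<in> S"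
  by (auto elim!: S_cases simp: pb_class_mult mvar_i_power S_I simp flip: power_add)

text \<open>The ring embeds into a field and the elements of \<open>S\<close> have nonzero values,
  so the multiplier \<open>t\<close> in \<open>frac_rel\<close> can be cancelled; conversely
  \<open>t\<close> may be the unit.\<close>

lemma frac_rel_iff:
  "((r, s), (r', s')) \<in> frac_rel R S \<longleftrightarrow>
    r \<in> carrier R \<and> s \<in> S \<and> r' \<in> carrier R \<and> s' \<in> S \<and> \<beta> r / \<beta> s = \<beta> r' / \<beta> s'"
proof -
  interpret cring R by (rule cring_pb_ring)
  have "(\<exists>t\<in>S. t \<otimes>\<^bsub>R\<^esub> (r \<otimes>\<^bsub>R\<^esub> s' \<ominus>\<^bsub>R\<^esub> r' \<otimes>\<^bsub>R\<^esub> s) = \<zero>\<^bsub>R\<^esub>) \<longleftrightarrow> \<beta> r / \<beta> s = \<beta> r' / \<beta> s'"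
    if *: "r \<in> carrier R" "s \<in> S" "r' \<in> carrier R" "s' \<in> S"
  proof -
    have c: "s \<in> carrier R" "s' \<in> carrier R" using * S_carrier by auto
    let ?x = "r \<otimes>\<^bsub>R\<^esub> s' \<ominus>\<^bsub>R\<^esub> r' \<otimes>\<^bsub>R\<^esub> s"
    have x: "?x \<in> carrier R" using * c by simp
    have "r \<otimes>\<^bsub>R\<^esub> s' = ?x \<oplus>\<^bsub>R\<^esub> r' \<otimes>\<^bsub>R\<^esub> s"
      using * c by (simp add: a_minus_def a_assoc l_neg)
    then have "\<beta> (r \<otimes>\<^bsub>R\<^esub> s') = \<beta> (?x \<oplus>\<^bsub>R\<^esub> r' \<otimes>\<^bsub>R\<^esub> s)" by (rule arg_cong)
    then have \<beta>x: "\<beta> ?x = \<beta> r * \<beta> s' - \<beta> r' * \<beta> s"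
      using * c x by (simp add: \<beta>_add \<beta>_mult)
    have "t \<otimes>\<^bsub>R\<^esub> ?x = \<zero>\<^bsub>R\<^esub> \<longleftrightarrow> \<beta> t * \<beta> ?x = 0" if "t \<in> S" for t
      using \<beta>_inj[of "t \<otimes>\<^bsub>R\<^esub> ?x" "\<zero>\<^bsub>R\<^esub>"] that x S_carrier[OF that] by (simp add: \<beta>_mult \<beta>_zero)
    then have "(\<exists>t\<in>S. t \<otimes>\<^bsub>R\<^esub> ?x = \<zero>\<^bsub>R\<^esub>) \<longleftrightarrow> \<beta> ?x = 0"
      using one_S \<beta>_S by auto
    also have "\<dots> \<longleftrightarrow> \<beta> r / \<beta> s = \<beta> r' / \<beta> s'"
      unfolding \<beta>x using \<beta>_S *(2,4) by (simp add: frac_eq_eq)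
    finally show ?thesis .
  qed
  then show ?thesis unfolding frac_rel_def by auto
qed

abbreviation "frc \<equiv> fraction R S"

lemma mem_fraction:
  "(r', s') \<in> frc r s \<longleftrightarrow>
    r \<in> carrier R \<and> s \<in> S \<and> r' \<in> carrier R \<and> s' \<in> S \<and> \<beta> r / \<beta> s = \<beta> r' / \<beta> s'"
  unfolding fraction_def by (simp add: frac_rel_iff)

lemma fraction_eq_iff:
  assumes "r \<in> carrier R" "s \<in> S" "r' \<in> carrier R" "s' \<in> S"
  shows "frc r s = frc r' s' \<longleftrightarrow> \<beta> r / \<beta> s = \<beta> r' / \<beta> s'"
proof
  assume "frc r s = frc r' s'"
  moreover have "(r, s) \<in> frc r s" using assms by (simp add: mem_fraction)
  ultimately have "(r, s) \<in> frc r' s'" by simp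
  then show "\<beta> r / \<beta> s = \<beta> r' / \<beta> s'" by (simp add: mem_fraction)
next
  assume "\<beta> r / \<beta> s = \<beta> r' / \<beta> s'"
  then show "frc r s = frc r' s'" using assms by (auto simp: mem_fraction)
qed

definition \<Phi> :: "(('v, 'k) mpoly set \<times> ('v, 'k) mpoly set) set \<Rightarrow> 'f" where
  "\<Phi> x = (let rs = (SOME rs. rs \<in> x) in \<beta> (fst rs) / \<beta> (snd rs))"

lemma \<Phi>_fraction:
  assumes "r \<in> carrier R" "s \<in> S"
  shows "\<Phi> (frc r s) = \<beta> r / \<beta> s"
proof -
  have "(r, s) \<in> frc r s" using assms by (simp add: mem_fraction)
  then have "(SOME rs. rs \<in> frc r s) \<in> frc r s" by (rule someI)
  then show ?thesis
    unfolding \<Phi>_def Let_def by (cases "SOME rs. rs \<in> frc r s") (simp add: mem_fraction)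
qed

text \<open>A union over representatives on which the summand is constant is that constant. It
  evaluates the operations of \<open>localization\<close>.\<close>

lemma UN_fraction:
  assumes "r \<in> carrier R" "s \<in> S" "r' \<in> carrier R" "s' \<in> S"
    and g: "\<And>x y x' y'. (x, y) \<in> frc r s \<Longrightarrow> (x', y') \<in> frc r' s' \<Longrightarrow> g x y x' y' = c"
  shows "(\<Union>(x, y)\<in>frc r s. \<Union>(x', y')\<in>frc r' s'. g x y x' y') = c"
proof -
  have 1: "(r, s) \<in> frc r s" and 2: "(r', s') \<in> frc r' s'"
    using assms by (auto simp: mem_fraction)
  have "(\<Union>(x', y')\<in>frc r' s'. g x y x' y') = c" if "(x, y) \<in> frc r s" for x y
    using g[OF that] 2 by fastforce
  then have "(\<Union>(x, y)\<in>frc r s. \<Union>(x', y')\<in>frc r' s'. g x y x' y') = (\<Union>(x, y)\<in>frc r s. c)"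
    by fastforce
  also have "\<dots> = c" using 1 by auto
  finally show ?thesis .
qed

lemma H_mult:
  assumes "r \<in> carrier R" "s \<in> S" "r' \<in> carrier R" "s' \<in> S"
  shows "frc r s \<otimes>\<^bsub>H\<^esub> frc r' s' = frc (r \<otimes>\<^bsub>R\<^esub> r') (s \<otimes>\<^bsub>R\<^esub> s')"
proof -
  interpret cring R by (rule cring_pb_ring)
  have "(\<Union>(x, y)\<in>frc r s. \<Union>(x', y')\<in>frc r' s'. frc (x \<otimes>\<^bsub>R\<^esub> x') (y \<otimes>\<^bsub>R\<^esub> y')) =
      frc (r \<otimes>\<^bsub>R\<^esub> r') (s \<otimes>\<^bsub>R\<^esub> s')"
  proof (rule UN_fraction[OF assms])
    fix x y x' y' assume *: "(x, y) \<in> frc r s" "(x', y') \<in> frc r' s'"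
    then have "\<beta> (x \<otimes>\<^bsub>R\<^esub> x') / \<beta> (y \<otimes>\<^bsub>R\<^esub> y') = (\<beta> r / \<beta> s) * (\<beta> r' / \<beta> s')"
      by (simp add: mem_fraction \<beta>_mult S_carrier)
    also have "\<dots> = \<beta> (r \<otimes>\<^bsub>R\<^esub> r') / \<beta> (s \<otimes>\<^bsub>R\<^esub> s')"
      using assms by (simp add: \<beta>_mult S_carrier)
    finally show "frc (x \<otimes>\<^bsub>R\<^esub> x') (y \<otimes>\<^bsub>R\<^esub> y') = frc (r \<otimes>\<^bsub>R\<^esub> r') (s \<otimes>\<^bsub>R\<^esub> s')"
      using * assms by (subst fraction_eq_iff) (auto simp: mem_fraction S_mult)
  qed
  then show ?thesis by (simp add: homogeneous_localization_def localization_def)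
qed

lemma H_add:
  assumes "r \<in> carrier R" "s \<in> S" "r' \<in> carrier R" "s' \<in> S"
  shows "frc r s \<oplus>\<^bsub>H\<^esub> frc r' s' = frc (r \<otimes>\<^bsub>R\<^esub> s' \<oplus>\<^bsub>R\<^esub> r' \<otimes>\<^bsub>R\<^esub> s) (s \<otimes>\<^bsub>R\<^esub> s')"
proof -
  interpret cring R by (rule cring_pb_ring)
  have val: "\<beta> (x \<otimes>\<^bsub>R\<^esub> y' \<oplus>\<^bsub>R\<^esub> x' \<otimes>\<^bsub>R\<^esub> y) / \<beta> (y \<otimes>\<^bsub>R\<^esub> y') = \<beta> x / \<beta> y + \<beta> x' / \<beta> y'"
    if "x \<in> carrier R" "y \<in> S" "x' \<in> carrier R" "y' \<in> S" for x y x' y'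
    using that \<beta>_S[of y] \<beta>_S[of y'] by (simp add: \<beta>_mult \<beta>_add S_carrier add_frac_eq)
  have "(\<Union>(x, y)\<in>frc r s. \<Union>(x', y')\<in>frc r' s'. frc (x \<otimes>\<^bsub>R\<^esub> y' \<oplus>\<^bsub>R\<^esub> x' \<otimes>\<^bsub>R\<^esub> y) (y \<otimes>\<^bsub>R\<^esub> y')) =
      frc (r \<otimes>\<^bsub>R\<^esub> s' \<oplus>\<^bsub>R\<^esub> r' \<otimes>\<^bsub>R\<^esub> s) (s \<otimes>\<^bsub>R\<^esub> s')"
  proof (rule UN_fraction[OF assms])
    fix x y x' y' assume *: "(x, y) \<in> frc r s" "(x', y') \<in> frc r' s'"
    then have "\<beta> (x \<otimes>\<^bsub>R\<^esub> y' \<oplus>\<^bsub>R\<^esub> x' \<otimes>\<^bsub>R\<^esub> y) / \<beta> (y \<otimes>\<^bsub>R\<^esub> y')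
        = \<beta> (r \<otimes>\<^bsub>R\<^esub> s' \<oplus>\<^bsub>R\<^esub> r' \<otimes>\<^bsub>R\<^esub> s) / \<beta> (s \<otimes>\<^bsub>R\<^esub> s')"
      by (simp add: mem_fraction val)
    then show "frc (x \<otimes>\<^bsub>R\<^esub> y' \<oplus>\<^bsub>R\<^esub> x' \<otimes>\<^bsub>R\<^esub> y) (y \<otimes>\<^bsub>R\<^esub> y') =
        frc (r \<otimes>\<^bsub>R\<^esub> s' \<oplus>\<^bsub>R\<^esub> r' \<otimes>\<^bsub>R\<^esub> s) (s \<otimes>\<^bsub>R\<^esub> s')"
      using * assms by (subst fraction_eq_iff) (auto simp: mem_fraction S_mult S_carrier)
  qed
  then show ?thesis by (simp add: homogeneous_localization_def localization_def)
qed

lemma H_zero: "\<zero>\<^bsub>H\<^esub> = frc \<zero>\<^bsub>R\<^esub> \<one>\<^bsub>R\<^esub>"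
  by (simp add: homogeneous_localization_def localization_def)

lemma component_eq: "pb_component TYPE('k) I a e = {cl p |p. p \<in> polys I \<and> homog wt e p}"
  by (simp add: pb_component_def pb_class_def carrier_mpoly_ring homog_def)

text \<open>The definition of the component only provides some weight for the denominator. It equals
  \<open>k * d\<close> because \<open>f ^ k\<close> is nonzero and hence has a unique
  weight.\<close>

lemma carrier_H_cases:
  assumes "x \<in> carrier H"
  obtains q k where "q \<in> polys I" "homog wt (k * d) q" "x = frc (cl q) (cl (mvar i ^ k))"
proof -
  obtain r s e e' where x: "x = frc r s" "r \<in> pb_component TYPE('k) I a e" "s \<in> S"
    "s \<in> pb_component TYPE('k) I a e'" "int e - int e' = 0"
    using assms unfolding homogeneous_localization_def localization_component_def by auto
  obtain k where k: "s = cl (mvar i ^ k)" using x(3) by (rule S_cases)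
  obtain q where q: "q \<in> polys I" "homog wt e q" "r = cl q" using x(2) by (auto simp: component_eq)
  obtain p where p: "p \<in> polys I" "homog wt e' p" "s = cl p" using x(4) by (auto simp: component_eq)
  have "\<psi> (mvar i ^ k) = \<psi> p"
    using k p(3) class_eq_iff[OF mvar_i_power p(1), of k] by simp
  from homog_unique[OF mvar_i_power p(1) homog_mvar_power[OF i] p(2) this]
  have "k * d = e'" using \<xi> by (simp add: \<psi>_mvar_i_power)
  then have "homog wt (k * d) q" using q(2) x(5) by simp
  moreover have "x = frc (cl q) (cl (mvar i ^ k))" using x(1) k q(3) by simp
  ultimately show ?thesis by (rule that[OF q(1)])
qed

lemma carrier_H_I:
  assumes "q \<in> polys I" "homog wt (k * d) q"
  shows "frc (cl q) (cl (mvar i ^ k)) \<in> carrier H"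
proof -
  have "cl q \<in> pb_component TYPE('k) I a (k * d)" "cl (mvar i ^ k) \<in> pb_component TYPE('k) I a (k * d)"
    using assms mvar_i_power homog_mvar_power[OF i] by (auto simp: component_eq)
  then show ?thesis
    unfolding homogeneous_localization_def localization_component_def using S_I[of k] by force
qed

lemma \<Phi>_frac: "q \<in> polys I \<Longrightarrow> \<Phi> (frc (cl q) (cl (mvar i ^ k))) = \<psi> q / f ^ k"
  by (simp add: \<Phi>_fraction pb_class_carrier S_I \<beta>_class mvar_i_power \<psi>_mvar_i_power)

lemma \<Phi>_A\<^sub>0: "x \<in> carrier H \<Longrightarrow> \<Phi> x \<in> A\<^sub>0"
  by (erule carrier_H_cases) (auto simp: A\<^sub>0_def \<Phi>_frac)

lemma A\<^sub>0_cases: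
  assumes "v \<in> A\<^sub>0" obtains x where "x \<in> carrier H" "v = \<Phi> x"
  using assms carrier_H_I \<Phi>_frac unfolding A\<^sub>0_def by fastforce

lemma carrier_H_fraction:
  assumes "x \<in> carrier H" obtains r s where "r \<in> carrier R" "s \<in> S" "x = frc r s"
  using assms by (elim carrier_H_cases) (use pb_class_carrier S_I in blast)

lemma \<Phi>_inj: "x \<in> carrier H \<Longrightarrow> y \<in> carrier H \<Longrightarrow> \<Phi> x = \<Phi> y \<Longrightarrow> x = y"
  by (elim carrier_H_fraction) (simp add: \<Phi>_fraction fraction_eq_iff)

lemma A\<^sub>0_one: "1 \<in> A\<^sub>0"
  unfolding A\<^sub>0_def using homog_1 by (intro CollectI exI[of _ 1] exI[of _ 0]) (simp add: \<psi>_hom)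

lemma A\<^sub>0_add: "u \<in> A\<^sub>0 \<Longrightarrow> v \<in> A\<^sub>0 \<Longrightarrow> u + v \<in> A\<^sub>0"
proof -
  assume "u \<in> A\<^sub>0" "v \<in> A\<^sub>0"
  then obtain p k q l where p: "u = \<psi> p / f ^ k" "p \<in> polys I" "homog wt (k * d) p"
    and q: "v = \<psi> q / f ^ l" "q \<in> polys I" "homog wt (l * d) q" unfolding A\<^sub>0_def by blast
  have "u + v = \<psi> (p * mvar i ^ l + mvar i ^ k * q) / f ^ (k + l)"
    unfolding p(1) q(1) using \<xi> by (simp add: \<psi>_hom \<psi>_mvar field_simps power_add)
  moreover have "homog wt ((k + l) * d) (p * mvar i ^ l + mvar i ^ k * q)"
    unfolding distrib_right by (intro homog_add homog_mult p q homog_mvar_power i)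
  moreover have "p * mvar i ^ l + mvar i ^ k * q \<in> polys I"
    by (intro polys_add polys_mult p q mvar_i_power)
  ultimately show ?thesis unfolding A\<^sub>0_def by blast
qed

lemma A\<^sub>0_mult: "u \<in> A\<^sub>0 \<Longrightarrow> v \<in> A\<^sub>0 \<Longrightarrow> u * v \<in> A\<^sub>0"
proof -
  assume "u \<in> A\<^sub>0" "v \<in> A\<^sub>0"
  then obtain p k q l where p: "u = \<psi> p / f ^ k" "p \<in> polys I" "homog wt (k * d) p"
    and q: "v = \<psi> q / f ^ l" "q \<in> polys I" "homog wt (l * d) q" unfolding A\<^sub>0_def by blast
  have "u * v = \<psi> (p * q) / f ^ (k + l)"
    unfolding p(1) q(1) by (simp add: \<psi>_hom power_add)
  moreover have "homog wt ((k + l) * d) (p * q)"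
    unfolding distrib_right by (intro homog_mult p q)
  ultimately show ?thesis unfolding A\<^sub>0_def using p(2) q(2) polys_mult by blast
qed

lemma \<Phi>_add:
  assumes "x \<in> carrier H" "y \<in> carrier H"
  shows "x \<oplus>\<^bsub>H\<^esub> y \<in> carrier H" "\<Phi> (x \<oplus>\<^bsub>H\<^esub> y) = \<Phi> x + \<Phi> y"
proof -
  interpret cring R by (rule cring_pb_ring)
  obtain r s where rs: "r \<in> carrier R" "s \<in> S" "x = frc r s" using carrier_H_fraction[OF assms(1)] .
  obtain r' s' where rs': "r' \<in> carrier R" "s' \<in> S" "y = frc r' s'" using carrier_H_fraction[OF assms(2)] .
  have eq: "x \<oplus>\<^bsub>H\<^esub> y = frc (r \<otimes>\<^bsub>R\<^esub> s' \<oplus>\<^bsub>R\<^esub> r' \<otimes>\<^bsub>R\<^esub> s) (s \<otimes>\<^bsub>R\<^esub> s')"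
    unfolding rs rs' by (rule H_add[OF rs(1,2) rs'(1,2)])
  have c: "r \<otimes>\<^bsub>R\<^esub> s' \<oplus>\<^bsub>R\<^esub> r' \<otimes>\<^bsub>R\<^esub> s \<in> carrier R" "s \<otimes>\<^bsub>R\<^esub> s' \<in> S"
    using rs rs' by (auto simp: S_carrier S_mult)
  show v: "\<Phi> (x \<oplus>\<^bsub>H\<^esub> y) = \<Phi> x + \<Phi> y"
    unfolding eq \<Phi>_fraction[OF c] unfolding rs(3) rs'(3) \<Phi>_fraction[OF rs(1,2)] \<Phi>_fraction[OF rs'(1,2)]
    using rs rs' \<beta>_S[OF rs(2)] \<beta>_S[OF rs'(2)] by (simp add: \<beta>_mult \<beta>_add S_carrier add_frac_eq)
  \<comment> \<open>Closure of the carrier is seen in the field: the sum of the values has a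
    preimage in the carrier, and fractions with equal values coincide.\<close>
  obtain z where z: "z \<in> carrier H" "\<Phi> x + \<Phi> y = \<Phi> z"
    using A\<^sub>0_cases[OF A\<^sub>0_add[OF \<Phi>_A\<^sub>0[OF assms(1)] \<Phi>_A\<^sub>0[OF assms(2)]]] .
  obtain r'' s'' where rs'': "r'' \<in> carrier R" "s'' \<in> S" "z = frc r'' s''" using carrier_H_fraction[OF z(1)] .
  have "x \<oplus>\<^bsub>H\<^esub> y = z"
    using v z(2) unfolding eq rs''(3) fraction_eq_iff[OF c rs''(1,2)] \<Phi>_fraction[OF c] \<Phi>_fraction[OF rs''(1,2)] by simp
  then show "x \<oplus>\<^bsub>H\<^esub> y \<in> carrier H" using z(1) by simp
qed

lemma \<Phi>_mult:
  assumes "x \<in> carrier H" "y \<in> carrier H"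
  shows "x \<otimes>\<^bsub>H\<^esub> y \<in> carrier H" "\<Phi> (x \<otimes>\<^bsub>H\<^esub> y) = \<Phi> x * \<Phi> y"
proof -
  interpret cring R by (rule cring_pb_ring)
  obtain r s where rs: "r \<in> carrier R" "s \<in> S" "x = frc r s" using carrier_H_fraction[OF assms(1)] .
  obtain r' s' where rs': "r' \<in> carrier R" "s' \<in> S" "y = frc r' s'" using carrier_H_fraction[OF assms(2)] .
  have eq: "x \<otimes>\<^bsub>H\<^esub> y = frc (r \<otimes>\<^bsub>R\<^esub> r') (s \<otimes>\<^bsub>R\<^esub> s')"
    unfolding rs rs' by (rule H_mult[OF rs(1,2) rs'(1,2)])
  have c: "r \<otimes>\<^bsub>R\<^esub> r' \<in> carrier R" "s \<otimes>\<^bsub>R\<^esub> s' \<in> S"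
    using rs rs' by (auto simp: S_mult)
  show v: "\<Phi> (x \<otimes>\<^bsub>H\<^esub> y) = \<Phi> x * \<Phi> y"
    unfolding eq \<Phi>_fraction[OF c] unfolding rs(3) rs'(3) \<Phi>_fraction[OF rs(1,2)] \<Phi>_fraction[OF rs'(1,2)]
    using rs rs' by (simp add: \<beta>_mult S_carrier)
  obtain z where z: "z \<in> carrier H" "\<Phi> x * \<Phi> y = \<Phi> z"
    using A\<^sub>0_cases[OF A\<^sub>0_mult[OF \<Phi>_A\<^sub>0[OF assms(1)] \<Phi>_A\<^sub>0[OF assms(2)]]] .
  obtain r'' s'' where rs'': "r'' \<in> carrier R" "s'' \<in> S" "z = frc r'' s''" using carrier_H_fraction[OF z(1)] .
  have "x \<otimes>\<^bsub>H\<^esub> y = z"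
    using v z(2) unfolding eq rs''(3) fraction_eq_iff[OF c rs''(1,2)] \<Phi>_fraction[OF c] \<Phi>_fraction[OF rs''(1,2)] by simp
  then show "x \<otimes>\<^bsub>H\<^esub> y \<in> carrier H" using z(1) by simp
qed

lemma zero_H: "\<zero>\<^bsub>H\<^esub> \<in> carrier H" "\<Phi> \<zero>\<^bsub>H\<^esub> = 0"
  using carrier_H_I[of 0 0] \<Phi>_frac[of 0 0] by (simp_all add: H_zero pb_class_zero pb_class_one \<psi>_hom)

lemma rigid_homogeneous_localizationI:
  assumes "\<And>D x. field_lnd A\<^sub>0 D \<Longrightarrow> x \<in> A\<^sub>0 \<Longrightarrow> D x = 0"
  shows "rigid H"
  unfolding rigid_def
proof (intro allI impI ballI)
  fix \<Delta> b assume \<Delta>: "derivation H \<Delta> \<and> locally_nilpotent H \<Delta>" and b: "b \<in> carrier H"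
  have closed: "\<Delta> x \<in> carrier H" if "x \<in> carrier H" for x
    using \<Delta> that by (auto simp: derivation_def)
  have pow_closed: "(\<Delta> ^^ n) x \<in> carrier H" if "x \<in> carrier H" for n x
    using that by (induction n) (auto simp: closed)
  define D where "D v = \<Phi> (\<Delta> (SOME x. x \<in> carrier H \<and> \<Phi> x = v))" for v
  have D: "D (\<Phi> x) = \<Phi> (\<Delta> x)" if "x \<in> carrier H" for x
  proof -
    have "(SOME y. y \<in> carrier H \<and> \<Phi> y = \<Phi> x) = x"
      using that \<Phi>_inj by (intro some_equality) auto
    then show ?thesis by (simp add: D_def)
  qed
  have Dpow: "(D ^^ n) (\<Phi> x) = \<Phi> ((\<Delta> ^^ n) x)" if "x \<in> carrier H" for n x
    using that by (induction n) (auto simp: D pow_closed)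
  have "field_lnd A\<^sub>0 D"
  proof
    show "D x \<in> A\<^sub>0" if "x \<in> A\<^sub>0" for x
      using that by (auto elim!: A\<^sub>0_cases simp: D \<Phi>_A\<^sub>0 closed)
    show "D (x + y) = D x + D y" if xy: "x \<in> A\<^sub>0" "y \<in> A\<^sub>0" for x y
    proof -
      obtain x' where x': "x' \<in> carrier H" "x = \<Phi> x'" using xy(1) by (rule A\<^sub>0_cases)
      obtain y' where y': "y' \<in> carrier H" "y = \<Phi> y'" using xy(2) by (rule A\<^sub>0_cases)
      have "\<Delta> (x' \<oplus>\<^bsub>H\<^esub> y') = \<Delta> x' \<oplus>\<^bsub>H\<^esub> \<Delta> y'"
        using \<Delta> x' y' by (simp add: derivation_def)
      then show ?thesis
        using x' y' \<Phi>_add[OF x'(1) y'(1)] \<Phi>_add(2)[OF closed[OF x'(1)] closed[OF y'(1)]]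
        by (metis D)
    qed
    show "D (x * y) = D x * y + x * D y" if xy: "x \<in> A\<^sub>0" "y \<in> A\<^sub>0" for x y
    proof -
      obtain x' where x': "x' \<in> carrier H" "x = \<Phi> x'" using xy(1) by (rule A\<^sub>0_cases)
      obtain y' where y': "y' \<in> carrier H" "y = \<Phi> y'" using xy(2) by (rule A\<^sub>0_cases)
      have eq: "\<Delta> (x' \<otimes>\<^bsub>H\<^esub> y') = \<Delta> x' \<otimes>\<^bsub>H\<^esub> y' \<oplus>\<^bsub>H\<^esub> x' \<otimes>\<^bsub>H\<^esub> \<Delta> y'"
        using \<Delta> x' y' by (simp add: derivation_def)
      have "D (x * y) = \<Phi> (\<Delta> (x' \<otimes>\<^bsub>H\<^esub> y'))"
        unfolding x'(2) y'(2) using D \<Phi>_mult[OF x'(1) y'(1)] by metis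
      also have "\<dots> = D x * y + x * D y"
        unfolding eq x'(2) y'(2) D[OF x'(1)] D[OF y'(1)]
        using \<Phi>_mult[OF closed[OF x'(1)] y'(1)] \<Phi>_mult[OF x'(1) closed[OF y'(1)]] \<Phi>_add(2) by metis
      finally show ?thesis .
    qed
    show "\<exists>n. (D ^^ n) x = 0" if x: "x \<in> A\<^sub>0" for x
    proof -
      obtain x' where x': "x' \<in> carrier H" "x = \<Phi> x'" using x by (rule A\<^sub>0_cases)
      then obtain m where "(\<Delta> ^^ m) x' = \<zero>\<^bsub>H\<^esub>" using \<Delta> unfolding locally_nilpotent_def by blast
      then have "(D ^^ m) x = 0" unfolding x'(2) Dpow[OF x'(1)] by (simp only: zero_H)
      then show ?thesis ..
    qed
  qed (fact A\<^sub>0_one A\<^sub>0_add A\<^sub>0_mult)+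
  then have "D (\<Phi> b) = 0" using assms \<Phi>_A\<^sub>0[OF b] by blast
  then have "\<Phi> (\<Delta> b) = \<Phi> \<zero>\<^bsub>H\<^esub>" by (simp only: D[OF b] zero_H)
  then show "\<Delta> b = \<zero>\<^bsub>H\<^esub>" using \<Phi>_inj closed[OF b] zero_H(1) by blast
qed

end

section \<open>Rigidity of the homogeneous localization\<close>

text \<open>If \<open>g\<close> divides \<open>l div a k\<close> for all \<open>k\<close> in
  \<open>T\<close>, then every such \<open>a k\<close> divides \<open>l div g\<close>. So does their
  least common multiple, which is still \<open>l\<close>, and this forces
  \<open>g = 1\<close>.\<close>

lemma Gcd_quotients_eq_1:
  fixes a :: "'v \<Rightarrow> nat"
  assumes fin: "finite I" and apos: "\<And>k. k \<in> I \<Longrightarrow> a k > 0"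
    and T: "T \<subseteq> I" "T \<noteq> {}" and L: "Lcm (a ` T) = Lcm (a ` I)"
  shows "Gcd ((\<lambda>k. Lcm (a ` I) div a k) ` T) = 1"
proof -
  define l where "l = Lcm (a ` I)"
  define g where "g = Gcd ((\<lambda>k. l div a k) ` T)"
  have "0 \<notin> a ` I" using apos by fastforce
  then have l: "l > 0" using fin by (simp add: l_def Lcm_0_iff zero_less_iff_neq_zero)
  have al: "a k dvd l" if "k \<in> T" for k
    using that T(1) by (auto simp: l_def)
  have g: "g dvd l div a k" if "k \<in> T" for k
    unfolding g_def using that by (intro Gcd_dvd) auto
  have ag: "a k * g dvd l" if "k \<in> T" for k
    using mult_dvd_mono[OF dvd_refl g[OF that], of "a k"] al[OF that] by simp
  obtain k where k: "k \<in> T" using T(2) by blast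
  have gl: "g dvd l" using ag[OF k] by (rule dvd_mult_right)
  then have gpos: "g > 0" using l by (metis dvd_0_left gr0I)
  have "a k dvd l div g" if "k \<in> T" for k
    using ag[OF that] gl gpos by (simp add: dvd_div_iff_mult)
  then have "Lcm (a ` T) dvd l div g" by (auto intro: Lcm_least)
  then have "l dvd l div g" unfolding L by (simp add: l_def)
  moreover have "l div g > 0" using gl l gpos by (simp add: dvd_imp_le div_greater_zero_iff)
  ultimately have "l \<le> l div g" by (rule dvd_imp_le)
  then have "\<not> 1 < g" using l div_less_dividend[of g l] by linarith
  then have "g = 1" using gpos by simp
  then show ?thesis by (simp add: g_def l_def)
qed

theorem proposition9p9:
  fixes n i :: nat and a :: "nat \<Rightarrow> nat"
  assumes "n \<ge> 4"
    and "\<forall>j\<in>{1..n}. a j > 0"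
    and "i \<in> {1..n}"
    and "S_set {1..n} a \<subseteq> {i}"
    and "rigid (pb_ring TYPE('k::field_char_0) ({1..n} - {i}) a)"
  shows "rigid (homogeneous_localization (pb_ring TYPE('k) {1..n} a)
           (pb_component TYPE('k) {1..n} a) (pb_var TYPE('k) {1..n} a i))"
proof -
  define I where "I = {1..n}"
  have fin: "finite I" and card4: "card I \<ge> 4" and card3: "card I \<ge> 3" and i: "i \<in> I"
    and apos: "\<And>j. j \<in> I \<Longrightarrow> a j > 0"
    using assms by (auto simp: I_def)
  have "rigid (homogeneous_localization (pb_ring TYPE('k) I a)
      (pb_component TYPE('k) I a) (pb_var TYPE('k) I a i))"
  proof (rule pb_embedding[of I i a, OF fin card3 i apos])
    fix \<kappa> :: "'k \<Rightarrow> (nat, 'k) mpoly fract alg_closure fls" and \<xi>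
    assume \<kappa>: "rhom \<kappa>" and \<xi>: "\<And>j. \<xi> j \<noteq> 0"
      and ker: "\<And>p. p \<in> polys I \<Longrightarrow> mp_eval \<kappa> \<xi> p = 0 \<longleftrightarrow> (\<exists>h\<in>polys I. p = pb_poly I a * h)"
      and sep: "\<And>p. mp_eval \<kappa> \<xi> p \<noteq> 0 \<Longrightarrow> \<exists>N. \<forall>q. mp_eval \<kappa> \<xi> p \<noteq> \<xi> i ^ N * mp_eval \<kappa> \<xi> q"
    interpret pb_model I a i \<kappa> \<xi>
      by (intro pb_model.intro fin i apos \<kappa> \<xi> ker)
    show ?thesis
    proof (rule rigid_homogeneous_localizationI)
      fix D x assume lnd: "field_lnd A\<^sub>0 D" and x: "x \<in> A\<^sub>0"
      have "pb_lnd I a i \<kappa> \<xi> D"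
      proof (intro pb_lnd.intro pb_lnd_axioms.intro)
        show "pb_model I a i \<kappa> \<xi>" by unfold_locales
        show "field_lnd A\<^sub>0 D" by (rule lnd)
        fix j assume j: "j \<in> I - {i}"
        show "Gcd (w ` (I - {j})) = 1"
        proof -
          \<comment> \<open>As \<open>j \<noteq> i\<close>, the index \<open>j\<close> is outside
            \<open>S_set\<close>, so omitting \<open>a j\<close> leaves the least common multiple
            unchanged.\<close>
          have "Lcm (a ` (I - {j})) = Lcm (a ` I)"
            using j assms(4) unfolding S_set_def lcm_omit_def I_def[symmetric] by blast
          moreover have "I - {j} \<noteq> {}" using i j by blast
          ultimately show ?thesis
            unfolding w_def[abs_def] using fin apos by (intro Gcd_quotients_eq_1) auto
        qed
        fix k p q assume k: "k \<in> I - {i}" "j \<noteq> k" and pq: "p \<in> polys I" "q \<in> polys I"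
          and eq: "\<xi> j * \<psi> p = \<xi> k * \<psi> q"
        have "mvar j * p - mvar k * q \<in> polys I" "\<psi> (mvar j * p - mvar k * q) = 0"
          using j k pq eq by (auto intro!: polys_diff polys_mult polys_mvar simp: \<psi>_hom \<psi>_mvar)
        then obtain h where h: "h \<in> polys I" "mvar j * p - mvar k * q = pb_poly I a * h"
          using ker' by blast
        have jk: "j \<in> I" "k \<in> I" using j k by auto
        obtain r s where "r \<in> polys I" "p = pb_poly I a * s + mvar k * r"
          by (rule pb_regular[of I a j k, OF fin card4 apos jk k(2) pq h])
        then show "\<exists>r\<in>polys I. \<psi> p = \<xi> k * \<psi> r"
          by (intro bexI[of _ r])
            (simp_all add: rhom.add[OF rhom_\<psi>] rhom.mult[OF rhom_\<psi>] \<psi>_pb_poly \<psi>_mvar)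
      qed
      then interpret pb_lnd I a i \<kappa> \<xi> D .
      show "D x = 0"
      proof (rule D_zero[OF _ _ x])
        show "\<exists>N. \<forall>q. \<psi> p \<noteq> \<xi> i ^ N * \<psi> q" if "\<psi> p \<noteq> 0" for p
          using sep that unfolding \<psi>_def by blast
        show "\<exists>h\<in>polys (I - {i}). W j = pb_poly (I - {i}) a * h"
          if "\<And>j. j \<in> I - {i} \<Longrightarrow> W j \<in> polys (I - {i})"
            "\<exists>h\<in>polys (I - {i}). pderiv_along W (pb_poly (I - {i}) a) = pb_poly (I - {i}) a * h"
            "\<And>p. p \<in> polys (I - {i}) \<Longrightarrow>
              \<exists>N. \<exists>h\<in>polys (I - {i}). (pderiv_along W ^^ N) p = pb_poly (I - {i}) a * h"
            "j \<in> I - {i}" for W :: "nat \<Rightarrow> (nat, 'k) mpoly" and j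
          using assms(5)[folded I_def] that by (rule rigid_pb_ringD)
      qed
    qed
  qed
  then show ?thesis by (simp only: I_def)
qed

end
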